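(* Let $K$ be a field, let $\Delta$ be the cyclic quiver with $s\geq 1$ vertices and $s$ arrows, let $n\geq 2$, and let $A=K\Delta/R_\Delta^n$. Let $q$ be an integer with $n\leq q\leq 2n-1$. Let $\alpha:A\times A\to D(A)$ be a $2$-cocycle whose cohomology class $[\alpha]\in H^2(A,D(A))$ belongs to $\Theta(D(HH_{2,q}(A)))$, and let $T_\alpha(A)$ be the Hochschild extension algebra of $A$ defined by $\alpha$. Then the ordinary quiver $\Delta_{T_\alpha(A)}$ of $T_\alpha(A)$ is given by $$\Delta_{T_\alpha(A)}=\begin{cases}\Delta_{T_0(A)} & \text{if } n\leq q\leq 2n-2,\\ \Delta & \text{if } q=2n-1.\end{cases}$$
   Context: All algebras are finite dimensional over the field $K$; $D=\mathrm{Hom}_K(-,K)$, and $D(A)$ is an $A$-bimodule via $(a\varphi b)(c)=\varphi(bca)$. **Quiver.** $\Delta$ has vertices $1,\dots,s$ and arrows $x_i$ from $i$ to $i+1$, with indices modulo $s$. Paths are written left to right: a path $x$ satisfies $x=s(x)\,x\,t(x)$, where $s(x),t(x)$ are the trivial paths at its source and target; $e_i$ is the trivial path at $i$. $\Delta_i$ is the set of paths of length $i$, and $K\Delta_i$ is the $K$-space with basis $\Delta_i$. $R_\Delta$ is the arrow ideal, so $R_\Delta^n$ is the ideal of $K\Delta$ generated by the paths of length $n$. The paths of length $<n$ form a basis of $A$; $p^*\in D(A)$ denotes the dual basis element of such a path $p$. **Hochschild extensions.** A $2$-cocycle is a $K$-bilinear map $\alpha:A\times A\to D(A)$ with $a\,\alpha(b,c)-\alpha(ab,c)+\alpha(a,bc)-\alpha(a,b)\,c=0$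 for all $a,b,c\in A$. $[\alpha]$ is its class in the Hochschild cohomology group $H^2(A,D(A))$, i.e. modulo coboundaries $(a,b)\mapsto a f(b)-f(ab)+f(a)b$ with $f\in\mathrm{Hom}_K(A,D(A))$. The Hochschild extension algebra $T_\alpha(A)$ is the $K$-space $A\oplus D(A)$ with multiplication $(a,x)(b,y)=(ab,\ ay+xb+\alpha(a,b))$ and identity $(1,-\alpha(1,1))$. $T_0(A)$ is the trivial extension algebra. **Ordinary quivers.** A complete set of primitive orthogonal idempotents $e_1,\dots,e_s$ of $A$ lifts along $T_\alpha(A)\to A$ to such a set $\mathbf e_1,\dots,\mathbf e_s$ in $T=T_\alpha(A)$. The ordinary quiver $\Delta_T$ has vertices $1,\dots,s$, and the number of arrows from $i$ to $j$ is $\dim_K \mathbf e_iJ(T)\mathbf e_j/\mathbf e_iJ^2(T)\mathbf e_j$, where $J$ is the Jacobson radical. Equality of quivers means equality of the numbers of arrows from $i$ to $j$ for all $i,j$ (with the identified vertices). **Grading on $HH_2(A)$.** For $i\geq 1$, $A\otimes_{K\Delta_0^e}K\Delta_i$ has as basis the elements $u\otimes v$ with $u$ a path of length $<n$, $v$ a path of length $i$, and $uv$ a cycle, i.e. $t(u)=s(v)$ and $t(v)=s(u)$. Its degree $q$ part $(\ )_q$ is spanned by those with total length $q$. In the following formulas, paths of length $\geq n$ in the $A$-factor are zero. Define $$(\tilde d_3)_q:(A\otimes_{K\Delta_0^e}K\Delta_{n+1})_q\to(A\otimes_{K\Delta_0^e}K\Delta_n)_q,$$ $$a_1\cdots a_{q-n-1}\otimes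 a_{q-n}\cdots a_q\mapsto a_1\cdots a_{q-n}\otimes a_{q-n+1}\cdots a_q-a_qa_1\cdots a_{q-n-1}\otimes a_{q-n}\cdots a_{q-1},$$ and $$(\tilde d_2)_q:(A\otimes_{K\Delta_0^e}K\Delta_n)_q\to(A\otimes_{K\Delta_0^e}K\Delta_1)_q,$$ $$a_1\cdots a_{q-n}\otimes a_{q-n+1}\cdots a_q\mapsto\sum_{j=0}^{n-1}a_{j+q-n+2}\cdots a_qa_1\cdots a_{j+q-n}\otimes a_{j+q-n+1}.$$ Set $HH_{2,q}(A)=\mathrm{Ker}(\tilde d_2)_q/\mathrm{Im}(\tilde d_3)_q$. The second Hochschild homology group satisfies $HH_2(A)=\bigoplus_q HH_{2,q}(A)$, and $D(HH_{2,q}(A))\cong \mathrm{Ker}\,D((\tilde d_3)_q)/\mathrm{Im}\,D((\tilde d_2)_q)$. **The map $\Theta$.** For a basis element $u=a_{n+1}\cdots a_r\otimes a_1\cdots a_n$ of $A\otimes_{K\Delta_0^e}K\Delta_n$ ($a_i$ arrows), with dual basis element $u^*$, let $\Theta(u^* ):A\times A\to D(A)$ be the bilinear map given, on nonzero paths $b_1\cdots b_{m_1}$ and $b_{m_1+1}\cdots b_{m_1+m_2}$ of $A$ ($b_i$ arrows), by $$(b_1\cdots b_{m_1},\ b_{m_1+1}\cdots b_{m_1+m_2})\mapsto (a_{m_1+m_2+1}\cdots a_r)^*$$ if $n\leq m_1+m_2\leq r$ and $b_t=a_t$ for $1\leq t\leq m_1+m_2$, and by $0$ otherwise (including when one of the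 two paths is trivial). When $m_1+m_2=r$, the value is $(t(a_r))^*$, the dual of the trivial path. Extended linearly, $\Theta$ induces an isomorphism, also denoted $\Theta$, from $\bigoplus_qD(HH_{2,q}(A))\cong D(HH_2(A))$ to $H^2(A,D(A))$; $\Theta(D(HH_{2,q}(A)))$ is the image of the degree $q$ summand.
   Formalization: For q = 2n−1 the class [α] is additionally assumed to be nonzero; the zero class also lies in Θ(D(HH_{2,2n−1}(A))) and gives T_0(A), whose ordinary quiver has extra arrows beyond Δ, so the printed claim fails there. *)

theory Defs
  imports
    "HOL-Algebra.QuotRing"
    "HOL-Algebra.Ideal_Product"
    "Graph_Theory.Arc_Walk"
    "Jordan_Normal_Form.VS_Connect"
begin

hide_const (open) Multiset.mult Polynomial.smult Modules.module

section \<open>Path algebras and truncated quiver algebras\<close>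

text \<open>
  A quiver is a digraph in the sense of the Graph Theory entry. A path is its source together with
  the list of its arrows, read from left to right, so that trivial paths at different vertices are
  different. The ground field is the type \<open>'k\<close>; as a ring record it is \<^term>\<open>class_ring\<close>.
\<close>

type_synonym ('v, 'a) path = "'v \<times> 'a list"

definition paths :: "('v, 'a) pre_digraph \<Rightarrow> ('v, 'a) path set" where
  "paths Q = {p. \<exists>w. pre_digraph.awalk Q (fst p) (snd p) w}"

abbreviation path_length :: "('v, 'a) path \<Rightarrow> nat" where
  "path_length p \<equiv> length (snd p)"

abbreviation path_source :: "('v, 'a) path \<Rightarrow> 'v" where
  "path_source p \<equiv> fst p"

definition path_target :: "('v, 'a) pre_digraph \<Rightarrow> ('v, 'a) path \<Rightarrow> 'v" where
  "path_target Q p = last (pre_digraph.awalk_verts Q (fst p) (snd p))"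

text \<open>
  Elements of the path algebra are finitely supported functions on paths. The coefficient of
  \<open>f g\<close> at a path is the sum over all ways of writing that path as a concatenation, which is the
  bilinear extension of concatenation (or zero, if the paths do not compose).
\<close>

definition path_algebra :: "('v, 'a) pre_digraph \<Rightarrow> ('k::field, ('v, 'a) path \<Rightarrow> 'k) module" where
  "path_algebra Q =
    \<lparr>carrier = {f. finite {p. f p \<noteq> 0} \<and> {p. f p \<noteq> 0} \<subseteq> paths Q},
     mult = (\<lambda>f g (v, xs). \<Sum>k\<le>length xs.
       f (v, take k xs) * g (path_target Q (v, take k xs), drop k xs)),
     one = (\<lambda>(v, xs). if v \<in> verts Q \<and> xs = [] then 1 else 0),
     zero = (\<lambda>p. 0),
     add = (\<lambda>f g p. f p + g p),
     smult = (\<lambda>c f p. c * f p)\<rparr>"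

definition path_elem :: "('v, 'a) path \<Rightarrow> ('v, 'a) path \<Rightarrow> 'k::field" where
  "path_elem p = (\<lambda>p'. if p' = p then 1 else 0)"

definition arrow_ideal_power ::
    "('v, 'a) pre_digraph \<Rightarrow> nat \<Rightarrow> (('v, 'a) path \<Rightarrow> 'k::field) set" where
  "arrow_ideal_power Q n =
    genideal (path_algebra Q) (path_elem ` {p \<in> paths Q. path_length p = n})"

text \<open>
  \<^term>\<open>M Quot I\<close> with the induced scalar multiplication. It is used for ideals of algebras, and also
  for subspaces of vector spaces, where its multiplicative part is irrelevant.
\<close>

definition quot_module :: "('k, 'b) module \<Rightarrow> 'b set \<Rightarrow> ('k, 'b set) module" where
  "quot_module M I =
    \<lparr>carrier = carrier (M Quot I), mult = mult (M Quot I), one = one (M Quot I),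
     zero = zero (M Quot I), add = add (M Quot I),
     smult = (\<lambda>c X. \<Union>x\<in>X. I +>\<^bsub>M\<^esub> (c \<odot>\<^bsub>M\<^esub> x))\<rparr>"

type_synonym ('v, 'a, 'k) path_class = "(('v, 'a) path \<Rightarrow> 'k) set"

definition truncated_algebra ::
    "('v, 'a) pre_digraph \<Rightarrow> nat \<Rightarrow> ('k::field, ('v, 'a, 'k) path_class) module" where
  "truncated_algebra Q n = quot_module (path_algebra Q) (arrow_ideal_power Q n)"

definition path_class ::
    "('v, 'a) pre_digraph \<Rightarrow> nat \<Rightarrow> ('v, 'a) path \<Rightarrow> ('v, 'a, 'k::field) path_class" where
  "path_class Q n p = arrow_ideal_power Q n +>\<^bsub>path_algebra Q\<^esub> path_elem p"

text \<open>Vertices are the residues modulo \<open>s\<close>; the arrow \<open>i\<close> goes from \<open>i\<close> to \<open>i + 1\<close>.\<close>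

definition cyclic_quiver :: "nat \<Rightarrow> (nat, nat) pre_digraph" where
  "cyclic_quiver s =
    \<lparr>verts = {..<s}, arcs = {..<s}, tail = (\<lambda>i. i), head = (\<lambda>i. Suc i mod s)\<rparr>"

definition num_arrows :: "('v, 'a) pre_digraph \<Rightarrow> 'v \<Rightarrow> 'v \<Rightarrow> nat" where
  "num_arrows Q i j = card {a \<in> arcs Q. tail Q a = i \<and> head Q a = j}"


section \<open>Hochschild extensions\<close>

text \<open>
  Functionals are extensional functions on the carrier. The fields \<open>mult\<close> and \<open>one\<close> are irrelevant.
\<close>

definition dual :: "('k::field, 'b) module \<Rightarrow> ('k, 'b \<Rightarrow> 'k) module" where
  "dual A =
    \<lparr>carrier = {\<phi> \<in> extensional (carrier A).
       (\<forall>x\<in>carrier A. \<forall>y\<in>carrier A. \<phi> (x \<oplus>\<^bsub>A\<^esub> y) = \<phi> x + \<phi> y) \<and>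
       (\<forall>c. \<forall>x\<in>carrier A. \<phi> (c \<odot>\<^bsub>A\<^esub> x) = c * \<phi> x)},
     mult = (\<lambda>\<phi> \<psi>. \<lambda>x\<in>carrier A. 0),
     one = (\<lambda>x\<in>carrier A. 0),
     zero = (\<lambda>x\<in>carrier A. 0),
     add = (\<lambda>\<phi> \<psi>. \<lambda>x\<in>carrier A. \<phi> x + \<psi> x),
     smult = (\<lambda>c \<phi>. \<lambda>x\<in>carrier A. c * \<phi> x)\<rparr>"

text \<open>The bimodule structure \<open>(a \<phi> b)(c) = \<phi>(b c a)\<close>, split into left and right action.\<close>

definition dual_left :: "('k::field, 'b) module \<Rightarrow> 'b \<Rightarrow> ('b \<Rightarrow> 'k) \<Rightarrow> 'b \<Rightarrow> 'k" where
  "dual_left A a \<phi> = (\<lambda>c\<in>carrier A. \<phi> (c \<otimes>\<^bsub>A\<^esub> a))"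

definition dual_right :: "('k::field, 'b) module \<Rightarrow> ('b \<Rightarrow> 'k) \<Rightarrow> 'b \<Rightarrow> 'b \<Rightarrow> 'k" where
  "dual_right A \<phi> b = (\<lambda>c\<in>carrier A. \<phi> (b \<otimes>\<^bsub>A\<^esub> c))"

definition bilinear_to_dual :: "('k::field, 'b) module \<Rightarrow> ('b \<Rightarrow> 'b \<Rightarrow> 'b \<Rightarrow> 'k) \<Rightarrow> bool" where
  "bilinear_to_dual A \<alpha> \<longleftrightarrow>
    (\<forall>a\<in>carrier A. \<alpha> a \<in> module_hom class_ring A (dual A)) \<and>
    (\<forall>b\<in>carrier A. (\<lambda>a. \<alpha> a b) \<in> module_hom class_ring A (dual A))"

definition two_cocycle :: "('k::field, 'b) module \<Rightarrow> ('b \<Rightarrow> 'b \<Rightarrow> 'b \<Rightarrow> 'k) \<Rightarrow> bool" where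
  "two_cocycle A \<alpha> \<longleftrightarrow> bilinear_to_dual A \<alpha> \<and>
    (\<forall>a\<in>carrier A. \<forall>b\<in>carrier A. \<forall>c\<in>carrier A.
      dual_left A a (\<alpha> b c) \<ominus>\<^bsub>dual A\<^esub> \<alpha> (a \<otimes>\<^bsub>A\<^esub> b) c \<oplus>\<^bsub>dual A\<^esub> \<alpha> a (b \<otimes>\<^bsub>A\<^esub> c)
        \<ominus>\<^bsub>dual A\<^esub> dual_right A (\<alpha> a b) c = \<zero>\<^bsub>dual A\<^esub>)"

definition coboundary ::
    "('k::field, 'b) module \<Rightarrow> ('b \<Rightarrow> 'b \<Rightarrow> 'k) \<Rightarrow> 'b \<Rightarrow> 'b \<Rightarrow> 'b \<Rightarrow> 'k" where
  "coboundary A f a b =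
    dual_left A a (f b) \<ominus>\<^bsub>dual A\<^esub> f (a \<otimes>\<^bsub>A\<^esub> b) \<oplus>\<^bsub>dual A\<^esub> dual_right A (f a) b"

text \<open>The cohomology class of \<open>\<alpha>\<close>, as the set of all cocycles cohomologous to it.\<close>

definition H2_class ::
    "('k::field, 'b) module \<Rightarrow> ('b \<Rightarrow> 'b \<Rightarrow> 'b \<Rightarrow> 'k) \<Rightarrow> ('b \<Rightarrow> 'b \<Rightarrow> 'b \<Rightarrow> 'k) set" where
  "H2_class A \<alpha> = {\<beta>. two_cocycle A \<beta> \<and>
    (\<exists>f\<in>module_hom class_ring A (dual A). \<forall>a\<in>carrier A. \<forall>b\<in>carrier A.
      \<beta> a b = \<alpha> a b \<oplus>\<^bsub>dual A\<^esub> coboundary A f a b)}"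

definition zero_cocycle :: "('k::field, 'b) module \<Rightarrow> 'b \<Rightarrow> 'b \<Rightarrow> 'b \<Rightarrow> 'k" where
  "zero_cocycle A = (\<lambda>a b. \<zero>\<^bsub>dual A\<^esub>)"

definition hochschild_extension ::
    "('k::field, 'b) module \<Rightarrow> ('b \<Rightarrow> 'b \<Rightarrow> 'b \<Rightarrow> 'k) \<Rightarrow> ('k, 'b \<times> ('b \<Rightarrow> 'k)) module" where
  "hochschild_extension A \<alpha> =
    \<lparr>carrier = carrier A \<times> carrier (dual A),
     mult = (\<lambda>(a, x) (b, y). (a \<otimes>\<^bsub>A\<^esub> b,
       dual_left A a y \<oplus>\<^bsub>dual A\<^esub> dual_right A x b \<oplus>\<^bsub>dual A\<^esub> \<alpha> a b)),
     one = (\<one>\<^bsub>A\<^esub>, \<ominus>\<^bsub>dual A\<^esub> \<alpha> \<one>\<^bsub>A\<^esub> \<one>\<^bsub>A\<^esub>),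
     zero = (\<zero>\<^bsub>A\<^esub>, \<zero>\<^bsub>dual A\<^esub>),
     add = (\<lambda>(a, x) (b, y). (a \<oplus>\<^bsub>A\<^esub> b, x \<oplus>\<^bsub>dual A\<^esub> y)),
     smult = (\<lambda>c (a, x). (c \<odot>\<^bsub>A\<^esub> a, c \<odot>\<^bsub>dual A\<^esub> x))\<rparr>"


section \<open>Ordinary quivers\<close>

definition left_ideal :: "'b set \<Rightarrow> ('b, 'm) ring_scheme \<Rightarrow> bool" where
  "left_ideal I R \<longleftrightarrow> additive_subgroup I R \<and> (\<forall>a\<in>carrier R. \<forall>x\<in>I. a \<otimes>\<^bsub>R\<^esub> x \<in> I)"

definition maximal_left_ideal :: "'b set \<Rightarrow> ('b, 'm) ring_scheme \<Rightarrow> bool" where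
  "maximal_left_ideal I R \<longleftrightarrow> left_ideal I R \<and> I \<noteq> carrier R \<and>
    (\<forall>J. left_ideal J R \<and> I \<subseteq> J \<longrightarrow> J = I \<or> J = carrier R)"

definition jacobson_radical :: "('b, 'm) ring_scheme \<Rightarrow> 'b set" where
  "jacobson_radical R = carrier R \<inter> \<Inter> {I. maximal_left_ideal I R}"

definition idempotent :: "('b, 'm) ring_scheme \<Rightarrow> 'b \<Rightarrow> bool" where
  "idempotent R x \<longleftrightarrow> x \<in> carrier R \<and> x \<otimes>\<^bsub>R\<^esub> x = x"

definition primitive_idempotent :: "('b, 'm) ring_scheme \<Rightarrow> 'b \<Rightarrow> bool" where
  "primitive_idempotent R x \<longleftrightarrow> idempotent R x \<and> x \<noteq> \<zero>\<^bsub>R\<^esub> \<and>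
    (\<forall>y z. idempotent R y \<and> idempotent R z \<and> y \<otimes>\<^bsub>R\<^esub> z = \<zero>\<^bsub>R\<^esub> \<and> z \<otimes>\<^bsub>R\<^esub> y = \<zero>\<^bsub>R\<^esub> \<and>
      x = y \<oplus>\<^bsub>R\<^esub> z \<longrightarrow> y = \<zero>\<^bsub>R\<^esub> \<or> z = \<zero>\<^bsub>R\<^esub>)"

definition complete_primitive_orthogonal ::
    "('b, 'm) ring_scheme \<Rightarrow> 'i set \<Rightarrow> ('i \<Rightarrow> 'b) \<Rightarrow> bool" where
  "complete_primitive_orthogonal R V e \<longleftrightarrow>
    (\<forall>i\<in>V. primitive_idempotent R (e i)) \<and>
    (\<forall>i\<in>V. \<forall>j\<in>V. i \<noteq> j \<longrightarrow> e i \<otimes>\<^bsub>R\<^esub> e j = \<zero>\<^bsub>R\<^esub>) \<and>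
    finsum R e V = \<one>\<^bsub>R\<^esub>"

definition corner :: "('b, 'm) ring_scheme \<Rightarrow> 'b \<Rightarrow> 'b set \<Rightarrow> 'b \<Rightarrow> 'b set" where
  "corner R x I y = {x \<otimes>\<^bsub>R\<^esub> z \<otimes>\<^bsub>R\<^esub> y | z. z \<in> I}"

text \<open>
  The number of arrows from \<open>i\<close> to \<open>j\<close> in the ordinary quiver of \<open>T\<close>, computed from the idempotents
  \<open>e\<close>: the dimension of \<open>e\<^sub>i J e\<^sub>j / e\<^sub>i J\<^sup>2 e\<^sub>j\<close>, where \<open>J\<close> is the Jacobson radical.
\<close>

definition ordinary_arrows :: "('k::field, 'b) module \<Rightarrow> ('i \<Rightarrow> 'b) \<Rightarrow> 'i \<Rightarrow> 'i \<Rightarrow> nat" where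
  "ordinary_arrows T e i j =
    (let J = jacobson_radical T in
     vectorspace.dim class_ring
       (quot_module (T\<lparr>carrier := corner T (e i) J (e j)\<rparr>)
         (corner T (e i) (ideal_prod T J J) (e j))))"

text \<open>
  A complete set of primitive orthogonal idempotents of \<open>T\<^sub>\<alpha>(A)\<close>, for \<open>A\<close> a truncated algebra, that
  lifts the classes of the trivial paths along the projection to \<open>A\<close>.
\<close>

definition lifted_idempotents ::
    "('v, 'a) pre_digraph \<Rightarrow> nat \<Rightarrow>
     (('v, 'a, 'k) path_class \<Rightarrow> ('v, 'a, 'k) path_class \<Rightarrow> ('v, 'a, 'k) path_class \<Rightarrow> 'k) \<Rightarrow>
     ('v \<Rightarrow> ('v, 'a, 'k::field) path_class \<times> (('v, 'a, 'k) path_class \<Rightarrow> 'k)) \<Rightarrow> bool" where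
  "lifted_idempotents Q n \<alpha> e \<longleftrightarrow>
    complete_primitive_orthogonal (hochschild_extension (truncated_algebra Q n) \<alpha>) (verts Q) e \<and>
    (\<forall>i\<in>verts Q. fst (e i) = path_class Q n (i, []))"


section \<open>The graded pieces of the dual of second Hochschild homology\<close>

text \<open>The basis of \<open>(A \<otimes> K\<Delta>\<^sub>m)\<^sub>q\<close>; the pair \<open>(u, v)\<close> stands for \<open>u \<otimes> v\<close>.\<close>

definition tensor_basis ::
    "('v, 'a) pre_digraph \<Rightarrow> nat \<Rightarrow> nat \<Rightarrow> nat \<Rightarrow> (('v, 'a) path \<times> ('v, 'a) path) set" where
  "tensor_basis Q n m q = {(u, v). u \<in> paths Q \<and> v \<in> paths Q \<and>
     path_length u < n \<and> path_length v = m \<and> path_length u + path_length v = q \<and>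
     path_target Q u = path_source v \<and> path_target Q v = path_source u}"

text \<open>Tensors are given by their coordinates. Paths of length \<open>\<ge> n\<close> in the first factor are zero.\<close>

definition tensor_elem ::
    "nat \<Rightarrow> ('v, 'a) path \<Rightarrow> ('v, 'a) path \<Rightarrow> ('v, 'a) path \<times> ('v, 'a) path \<Rightarrow> 'k::field" where
  "tensor_elem n u v = (\<lambda>w. if path_length u < n \<and> w = (u, v) then 1 else 0)"

text \<open>
  Values of the differentials on a basis element \<open>u \<otimes> v\<close>, where \<open>u = (i, xs)\<close> and \<open>v = (j, ys)\<close>.
  In the sum defining the second one, the index \<open>k\<close> is the position of the arrow of \<open>v\<close> that is split
  off: the arrows after it, then \<open>u\<close>, then the arrows before it form the first factor.
\<close>

definition d3_basis ::
    "('v, 'a) pre_digraph \<Rightarrow> nat \<Rightarrow> ('v, 'a) path \<times> ('v, 'a) path \<Rightarrow>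
     ('v, 'a) path \<times> ('v, 'a) path \<Rightarrow> 'k::field" where
  "d3_basis Q n = (\<lambda>((i, xs), (j, ys)) w.
     tensor_elem n (i, xs @ [hd ys]) (head Q (hd ys), tl ys) w
     - tensor_elem n (tail Q (last ys), last ys # xs) (j, butlast ys) w)"

definition d2_basis ::
    "('v, 'a) pre_digraph \<Rightarrow> nat \<Rightarrow> ('v, 'a) path \<times> ('v, 'a) path \<Rightarrow>
     ('v, 'a) path \<times> ('v, 'a) path \<Rightarrow> 'k::field" where
  "d2_basis Q n = (\<lambda>((i, xs), (j, ys)) w. \<Sum>k<length ys.
     tensor_elem n (head Q (ys ! k), drop (Suc k) ys @ xs @ take k ys)
       (tail Q (ys ! k), [ys ! k]) w)"

text \<open>
  A functional on \<open>(A \<otimes> K\<Delta>\<^sub>m)\<^sub>q\<close> is given by its values on the basis, i.e. by its coordinates with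
  respect to the dual basis, and is zero off the basis.
\<close>

definition tensor_dual ::
    "('v, 'a) pre_digraph \<Rightarrow> nat \<Rightarrow> nat \<Rightarrow> nat \<Rightarrow>
     (('v, 'a) path \<times> ('v, 'a) path \<Rightarrow> 'k::field) set" where
  "tensor_dual Q n m q = {\<phi>. \<forall>w. w \<notin> tensor_basis Q n m q \<longrightarrow> \<phi> w = 0}"

definition D_d3 ::
    "('v, 'a) pre_digraph \<Rightarrow> nat \<Rightarrow> nat \<Rightarrow> (('v, 'a) path \<times> ('v, 'a) path \<Rightarrow> 'k::field) \<Rightarrow>
     ('v, 'a) path \<times> ('v, 'a) path \<Rightarrow> 'k" where
  "D_d3 Q n q \<phi> = (\<lambda>w. if w \<in> tensor_basis Q n (n + 1) q
     then \<Sum>z\<in>tensor_basis Q n n q. d3_basis Q n w z * \<phi> z else 0)"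

definition D_d2 ::
    "('v, 'a) pre_digraph \<Rightarrow> nat \<Rightarrow> nat \<Rightarrow> (('v, 'a) path \<times> ('v, 'a) path \<Rightarrow> 'k::field) \<Rightarrow>
     ('v, 'a) path \<times> ('v, 'a) path \<Rightarrow> 'k" where
  "D_d2 Q n q \<phi> = (\<lambda>w. if w \<in> tensor_basis Q n n q
     then \<Sum>z\<in>tensor_basis Q n 1 q. d2_basis Q n w z * \<phi> z else 0)"

text \<open>\<open>D(HH\<^sub>2\<^sub>,\<^sub>q(A))\<close> as \<open>Ker D(d\<^sub>3) / Im D(d\<^sub>2)\<close>; its elements are cosets.\<close>

definition dual_HH2 ::
    "('v, 'a) pre_digraph \<Rightarrow> nat \<Rightarrow> nat \<Rightarrow>
     (('v, 'a) path \<times> ('v, 'a) path \<Rightarrow> 'k::field) set set" where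
  "dual_HH2 Q n q =
    {{(\<lambda>w. \<phi> w + D_d2 Q n q \<psi> w) | \<psi>. \<psi> \<in> tensor_dual Q n 1 q} | \<phi>.
      \<phi> \<in> tensor_dual Q n n q \<and> D_d3 Q n q \<phi> = (\<lambda>w. 0)}"


section \<open>The map Theta\<close>

text \<open>
  The dual basis element \<open>p\<^sup>*\<close> of a path \<open>p\<close> of length less than \<open>n\<close>. All representatives of an
  element of \<open>A\<close> have the same coefficient at \<open>p\<close>.
\<close>

definition dual_path ::
    "('v, 'a) pre_digraph \<Rightarrow> nat \<Rightarrow> ('v, 'a) path \<Rightarrow> ('v, 'a, 'k) path_class \<Rightarrow> 'k::field" where
  "dual_path Q n p = (\<lambda>X\<in>carrier (truncated_algebra Q n). THE c. \<forall>f\<in>X. f p = c)"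

text \<open>
  The value of \<open>\<Theta>((u \<otimes> v)\<^sup>*)\<close> at a pair of paths. The list \<open>snd v @ snd u\<close> is \<open>a\<^sub>1 \<dots> a\<^sub>r\<close>, and
  \<open>head Q (last bs)\<close> is the source of \<open>a\<^sub>m\<^sub>+\<^sub>1 \<dots> a\<^sub>r\<close> for \<open>m\<close> the length of \<open>bs\<close>, and the target of
  \<open>a\<^sub>r\<close> if \<open>m = r\<close>.
\<close>

definition Theta_paths ::
    "('v, 'a) pre_digraph \<Rightarrow> nat \<Rightarrow> ('v, 'a) path \<times> ('v, 'a) path \<Rightarrow>
     ('v, 'a) path \<Rightarrow> ('v, 'a) path \<Rightarrow> ('v, 'a, 'k) path_class \<Rightarrow> 'k::field" where
  "Theta_paths Q n = (\<lambda>(u, v) p p'.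
     (let as = snd v @ snd u; bs = snd p @ snd p'; m = length bs in
      if snd p \<noteq> [] \<and> snd p' \<noteq> [] \<and> n \<le> m \<and> m \<le> length as \<and> bs = take m as
      then dual_path Q n (head Q (last bs), drop m as)
      else \<zero>\<^bsub>dual (truncated_algebra Q n)\<^esub>))"

text \<open>
  \<open>\<Theta>\<close> on the degree \<open>q\<close> functional \<open>\<phi> = \<Sum>\<^sub>u \<phi>(u) u\<^sup>*\<close>, extended bilinearly from pairs of paths.
\<close>

definition Theta ::
    "('v, 'a) pre_digraph \<Rightarrow> nat \<Rightarrow> nat \<Rightarrow> (('v, 'a) path \<times> ('v, 'a) path \<Rightarrow> 'k::field) \<Rightarrow>
     ('v, 'a, 'k) path_class \<Rightarrow> ('v, 'a, 'k) path_class \<Rightarrow> ('v, 'a, 'k) path_class \<Rightarrow> 'k" where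
  "Theta Q n q \<phi> X Y =
    (\<lambda>Z\<in>carrier (truncated_algebra Q n).
      \<Sum>u\<in>tensor_basis Q n n q.
      \<Sum>p\<in>{p \<in> paths Q. path_length p < n}. \<Sum>p'\<in>{p \<in> paths Q. path_length p < n}.
        \<phi> u * dual_path Q n p X * dual_path Q n p' Y * Theta_paths Q n u p p' Z)"

definition Theta_image ::
    "('v, 'a) pre_digraph \<Rightarrow> nat \<Rightarrow> nat \<Rightarrow>
     (('v, 'a, 'k::field) path_class \<Rightarrow> ('v, 'a, 'k) path_class \<Rightarrow>
      ('v, 'a, 'k) path_class \<Rightarrow> 'k) set set" where
  "Theta_image Q n q =
    {H2_class (truncated_algebra Q n) (Theta Q n q \<phi>) | \<phi>. \<phi> \<in> \<Union> (dual_HH2 Q n q)}"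

end

theory Submission
  imports Defs
begin

text \<open>
  Write \<open>\<alpha> = \<Theta>(\<phi>) + \<delta>f\<close>. After the shift \<open>x \<mapsto> x + f(a)\<close> of the bimodule part, the radical \<open>J\<close> of
  \<open>T\<^sub>\<alpha>(A)\<close> consists of the pairs \<open>(a, x)\<close> with \<open>a\<close> in the arrow ideal. Let \<open>u\<close> be the sum of all
  arrows. Every element of \<open>J\<^sup>2\<close> has no arrow coefficients, and multiplication with \<open>u\<close> reaches all
  such elements except possibly for the values of the bimodule part at the paths of length \<open>n - 1\<close>.
  At these paths the bimodule part of a product of radical elements is the value of \<open>\<Theta>(\<phi>)\<close> alone.

  If \<open>q \<le> 2n - 2\<close>, this value is zero since \<open>\<Theta>(\<phi>)\<close> only produces dual paths of length at most
  \<open>q - n < n - 1\<close>. Hence \<open>J/J\<^sup>2\<close> is dual to the arrows and the paths of length \<open>n - 1\<close>, independently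
  of \<open>\<alpha>\<close>.

  If \<open>q = 2n - 1\<close>, then \<open>D(d\<^sub>2) = 0\<close>, and \<open>D(d\<^sub>3) \<phi> = 0\<close> says that \<open>\<phi>\<close> is constant on the basis, which
  is empty unless \<open>s\<close> divides \<open>2n - 1\<close>. Since the class of \<open>\<alpha>\<close> is nonzero, the constant is nonzero, so
  \<open>\<Theta>(\<phi>)\<close> takes all values at the paths of length \<open>n - 1\<close>, and \<open>J/J\<^sup>2\<close> is dual to the arrows.
\<close>

section \<open>Dimensions of quotient spaces\<close>

text \<open>In the cyclic quiver every path has exactly one prolongation by an arrow on each side.
  Multiplication with \<open>u\<close> is therefore a shift of coordinates, and no sums of products
  are needed to exhaust \<open>J^2\<close>: in both cases each of its elements is a single product
  of \<open>u\<close> with a radical element. The shift breaks down only at the longest paths,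
  because their products with radical elements vanish on both sides; for the same reason nothing but
  \<Theta>(\<phi>) is visible there. The bound \<open>2n - 1\<close> is the total length of a first
  factor of length \<open>n - 1\<close> and a second factor of length \<open>n\<close>: only in this
  degree can \<open>n - 1\<close> arrows be left after \<open>n\<close> have been consumed. Passing
  to the dual reverses direction, so a longest path starting at \<open>v\<close> yields an arrow
  from its end to \<open>v\<close>. The lifted idempotents are arbitrary. Their unknown bimodule
  parts do no harm: on longest paths they are only evaluated at products of such a path with a
  radical element, that is, at zero.\<close>

lemma dim_eq_card_coordinates:
  fixes V :: "('k::field, 'b) module" and h :: "'i \<Rightarrow> 'b \<Rightarrow> 'k"
  assumes fin: "finite I"
    and zero: "\<zero>\<^bsub>V\<^esub> \<in> carrier V"
    and add: "\<And>x y. x \<in> carrier V \<Longrightarrow> y \<in> carrier V \<Longrightarrow> x \<oplus>\<^bsub>V\<^esub> y \<in> carrier V"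
    and smult: "\<And>c x. x \<in> carrier V \<Longrightarrow> c \<odot>\<^bsub>V\<^esub> x \<in> carrier V"
    and h_zero: "\<And>i. i \<in> I \<Longrightarrow> h i \<zero>\<^bsub>V\<^esub> = 0"
    and h_add: "\<And>i x y. i \<in> I \<Longrightarrow> x \<in> carrier V \<Longrightarrow> y \<in> carrier V \<Longrightarrow>
      h i (x \<oplus>\<^bsub>V\<^esub> y) = h i x + h i y"
    and h_smult: "\<And>i c x. i \<in> I \<Longrightarrow> x \<in> carrier V \<Longrightarrow> h i (c \<odot>\<^bsub>V\<^esub> x) = c * h i x"
    and eqI: "\<And>x y. x \<in> carrier V \<Longrightarrow> y \<in> carrier V \<Longrightarrow> (\<And>i. i \<in> I \<Longrightarrow> h i x = h i y) \<Longrightarrow> x = y"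
    and d: "\<And>i. i \<in> I \<Longrightarrow> d i \<in> carrier V"
    and h_d: "\<And>i j. i \<in> I \<Longrightarrow> j \<in> I \<Longrightarrow> h j (d i) = (if j = i then 1 else 0)"
  shows "vectorspace.dim class_ring V = card I"
proof -
  have neg: "\<exists>y\<in>carrier V. x \<oplus>\<^bsub>V\<^esub> y = \<zero>\<^bsub>V\<^esub>" if x: "x \<in> carrier V" for x
    by (rule bexI[of _ "(-1) \<odot>\<^bsub>V\<^esub> x"]) (auto intro!: eqI simp: x zero add smult h_zero h_add h_smult)
  have "vectorspace (class_ring :: 'k ring) V"
    by (rule vs_criteria; (intro ballI allI impI)?; (elim conjE)?; (rule eqI)?)
      (simp_all add: class_field neg zero add smult h_zero h_add h_smult algebra_simps)
  then interpret V: vectorspace "class_ring :: 'k ring" V .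
  have inj: "inj_on d I"
    by (rule inj_onI) (metis h_d zero_neq_one)
  have sub: "d ` I \<subseteq> carrier V" using d by auto
  have h_finsum: "h j (finsum V g S) = (\<Sum>x\<in>S. h j (g x))"
    if "j \<in> I" "finite S" "g \<in> S \<rightarrow> carrier V" for j S and g :: "'b \<Rightarrow> 'b"
    using that(2,3)
    by (induction S) (auto simp: that(1) h_zero h_add V.finsum_closed Pi_def)
  have h_lincomb: "h j (V.lincomb a (d ` I)) = a (d j)" if j: "j \<in> I" for a j
  proof -
    have "h j (V.lincomb a (d ` I)) = (\<Sum>x\<in>d ` I. h j (a x \<odot>\<^bsub>V\<^esub> x))"
      unfolding V.lincomb_def using j fin sub by (intro h_finsum) (auto simp: smult)
    also have "\<dots> = (\<Sum>i\<in>I. a (d i) * h j (d i))"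
      unfolding sum.reindex[OF inj] o_def using j d by (intro sum.cong) (auto simp: h_smult)
    also have "\<dots> = (\<Sum>i\<in>I. if i = j then a (d j) else 0)"
      by (rule sum.cong) (auto simp: h_d j)
    finally show ?thesis using fin j by simp
  qed
  have "V.lin_indpt (d ` I)"
  proof (rule V.finite_lin_indpt2)
    fix a assume "V.lincomb a (d ` I) = \<zero>\<^bsub>V\<^esub>"
    then show "\<forall>v\<in>d ` I. a v = \<zero>\<^bsub>class_ring\<^esub>"
      using h_lincomb[of _ a] h_zero by auto
  qed (use fin sub in auto)
  moreover have "V.span (d ` I) = carrier V"
  proof
    show "V.span (d ` I) \<subseteq> carrier V" 
      using V.span_is_subset2[OF sub] .
    show "carrier V \<subseteq> V.span (d ` I)"
    proof
      fix x assume x: "x \<in> carrier V"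
      \<comment> \<open>The coefficient of \<open>d i\<close> is the coordinate
        \<open>h i x\<close>; the inverse of \<open>d\<close> appears because linear combinations
        index their coefficients by vectors.\<close>
      let ?a = "\<lambda>y. h (the_inv_into I d y) x"
      have x_eq: "x = V.lincomb ?a (d ` I)"
        using sub by (intro eqI[OF x]) (auto simp: h_lincomb the_inv_into_f_f[OF inj])
      show "x \<in> V.span (d ` I)"
        unfolding V.finite_span[OF finite_imageI[OF fin] sub]
        by (intro CollectI exI[of _ ?a] conjI x_eq) auto
    qed
  qed
  ultimately have "V.basis (d ` I)" unfolding V.basis_def using sub by blast
  then show ?thesis
    using V.dim_basis[of "d ` I"] fin card_image[OF inj] by simp
qed

lemma set_add_image: "A <+>\<^bsub>G\<^esub> B = {a \<oplus>\<^bsub>G\<^esub> b | a b. a \<in> A \<and> b \<in> B}"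
  by (auto simp: set_add_def')

text \<open>As \<open>W\<close> is the common kernel of the \<open>h i\<close>, the coset of
  \<open>x\<close> consists of all elements of \<open>V\<close> with the same coordinates as
  \<open>x\<close>. The coordinates thus descend to the quotient, where the classes of the
  \<open>d i\<close> are dual to them.\<close>

lemma dim_quotient_by_functionals:
  fixes M :: "('k::field, 'b) module" and h :: "'i \<Rightarrow> 'b \<Rightarrow> 'k"
  assumes M: "Module.module class_ring M" and sub: "LinearCombinations.submodule class_ring V M"
    and fin: "finite I"
    and h_add: "\<And>i x y. i \<in> I \<Longrightarrow> x \<in> V \<Longrightarrow> y \<in> V \<Longrightarrow> h i (x \<oplus>\<^bsub>M\<^esub> y) = h i x + h i y"
    and h_smult: "\<And>i c x. i \<in> I \<Longrightarrow> x \<in> V \<Longrightarrow> h i (c \<odot>\<^bsub>M\<^esub> x) = c * h i x"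
    and d: "\<And>i. i \<in> I \<Longrightarrow> d i \<in> V"
    and h_d: "\<And>i j. i \<in> I \<Longrightarrow> j \<in> I \<Longrightarrow> h j (d i) = (if j = i then 1 else 0)"
    and W: "W = {x \<in> V. \<forall>i\<in>I. h i x = 0}"
  shows "vectorspace.dim class_ring (quot_module (M\<lparr>carrier := V\<rparr>) W) = card I"
proof -
  interpret M: Module.module "class_ring :: 'k ring" M by (rule M)
  interpret sub: LinearCombinations.submodule "class_ring :: 'k ring" V M by (rule sub)
  let ?Q = "quot_module (M\<lparr>carrier := V\<rparr>) W"
  define C where "C t = {x \<in> V. \<forall>i\<in>I. h i x = t i}" for t
  have V: "x \<in> carrier M" if "x \<in> V" for x using that sub.subset by auto
  have sm: "c \<odot>\<^bsub>M\<^esub> x \<in> V" if "x \<in> V" for c x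
    using sub.smult_closed[of c x] that by simp
  have neg: "\<ominus>\<^bsub>M\<^esub> x \<in> V" and h_neg: "i \<in> I \<Longrightarrow> h i (\<ominus>\<^bsub>M\<^esub> x) = - h i x" if x: "x \<in> V" for x i
  proof -
    have "\<ominus>\<^bsub>M\<^esub> x = (-1) \<odot>\<^bsub>M\<^esub> x"
      using M.smult_minus_1[of x] V[OF x] by (simp add: class_ring_simps)
    then show "\<ominus>\<^bsub>M\<^esub> x \<in> V" "i \<in> I \<Longrightarrow> h i (\<ominus>\<^bsub>M\<^esub> x) = - h i x"
      using x by (auto simp: sm h_smult)
  qed
  have coset: "W +>\<^bsub>M\<lparr>carrier := V\<rparr>\<^esub> x = C (\<lambda>i. h i x)" if x: "x \<in> V" for x
  proof
    show "W +>\<^bsub>M\<lparr>carrier := V\<rparr>\<^esub> x \<subseteq> C (\<lambda>i. h i x)"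
      using x by (auto simp: a_r_coset_def' W C_def h_add)
    show "C (\<lambda>i. h i x) \<subseteq> W +>\<^bsub>M\<lparr>carrier := V\<rparr>\<^esub> x"
    proof
      fix y assume y: "y \<in> C (\<lambda>i. h i x)"
      then have yV: "y \<in> V" by (simp add: C_def)
      have "y \<oplus>\<^bsub>M\<^esub> \<ominus>\<^bsub>M\<^esub> x \<in> W"
        using y x yV by (auto simp: W C_def h_add h_neg neg)
      moreover have "y = (y \<oplus>\<^bsub>M\<^esub> \<ominus>\<^bsub>M\<^esub> x) \<oplus>\<^bsub>M\<^esub> x"
        using V[OF x] V[OF yV] by (simp add: M.a_assoc M.l_neg)
      ultimately show "y \<in> W +>\<^bsub>M\<lparr>carrier := V\<rparr>\<^esub> x" by (auto simp: a_r_coset_def')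
    qed
  qed
  have carrier: "carrier ?Q = {C (\<lambda>i. h i x) | x. x \<in> V}"
    by (auto simp: quot_module_def FactRing_def A_RCOSETS_def' coset)
  have zeroQ: "\<zero>\<^bsub>?Q\<^esub> = W" by (simp add: quot_module_def FactRing_def)
  have h_zero: "h i \<zero>\<^bsub>M\<^esub> = 0" if "i \<in> I" for i
    using h_smult[of i "\<zero>\<^bsub>M\<^esub>" 0] that by simp
  have W_C: "W = C (\<lambda>i. h i \<zero>\<^bsub>M\<^esub>)" by (auto simp: W C_def h_zero)
  have C_cong: "C s = C t" if "\<And>i. i \<in> I \<Longrightarrow> s i = t i" for s t
    using that by (auto simp: C_def)
  have addQ: "C (\<lambda>i. h i x) \<oplus>\<^bsub>?Q\<^esub> C (\<lambda>i. h i y) = C (\<lambda>i. h i (x \<oplus>\<^bsub>M\<^esub> y))"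
    if x: "x \<in> V" and y: "y \<in> V" for x y
  proof -
    have "C (\<lambda>i. h i x) \<oplus>\<^bsub>?Q\<^esub> C (\<lambda>i. h i y)
      = {a \<oplus>\<^bsub>M\<^esub> b | a b. a \<in> C (\<lambda>i. h i x) \<and> b \<in> C (\<lambda>i. h i y)}"
      by (simp add: quot_module_def FactRing_def set_add_image)
    also have "\<dots> = C (\<lambda>i. h i (x \<oplus>\<^bsub>M\<^esub> y))"
    proof (intro equalityI subsetI)
      fix z assume z: "z \<in> C (\<lambda>i. h i (x \<oplus>\<^bsub>M\<^esub> y))"
      then have zV: "z \<in> V" by (simp add: C_def)
      have "z = x \<oplus>\<^bsub>M\<^esub> (\<ominus>\<^bsub>M\<^esub> x \<oplus>\<^bsub>M\<^esub> z)"
        using V x zV by (simp add: M.r_neg2)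
      moreover have "\<ominus>\<^bsub>M\<^esub> x \<oplus>\<^bsub>M\<^esub> z \<in> C (\<lambda>i. h i y)"
        using z x y zV by (auto simp: C_def h_add h_neg neg)
      ultimately show "z \<in> {a \<oplus>\<^bsub>M\<^esub> b | a b. a \<in> C (\<lambda>i. h i x) \<and> b \<in> C (\<lambda>i. h i y)}"
        using x by (auto simp: C_def)
    qed (use x y in \<open>auto simp: C_def h_add\<close>)
    finally show ?thesis .
  qed
  have smultQ: "c \<odot>\<^bsub>?Q\<^esub> C (\<lambda>i. h i x) = C (\<lambda>i. h i (c \<odot>\<^bsub>M\<^esub> x))" if x: "x \<in> V" for c x
  proof -
    have "c \<odot>\<^bsub>?Q\<^esub> C (\<lambda>i. h i x)
      = (\<Union>y\<in>C (\<lambda>i. h i x). W +>\<^bsub>M\<lparr>carrier := V\<rparr>\<^esub> (c \<odot>\<^bsub>M\<^esub> y))"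
      by (simp add: quot_module_def)
    also have "\<dots> = (\<Union>y\<in>C (\<lambda>i. h i x). C (\<lambda>i. h i (c \<odot>\<^bsub>M\<^esub> x)))"
    proof (rule SUP_cong[OF refl])
      fix y assume "y \<in> C (\<lambda>i. h i x)"
      then have "y \<in> V" "\<And>i. i \<in> I \<Longrightarrow> h i y = h i x" by (auto simp: C_def)
      then show "W +>\<^bsub>M\<lparr>carrier := V\<rparr>\<^esub> (c \<odot>\<^bsub>M\<^esub> y) = C (\<lambda>i. h i (c \<odot>\<^bsub>M\<^esub> x))"
        using x by (simp add: coset sm h_smult cong: C_cong)
    qed
    also have "\<dots> = C (\<lambda>i. h i (c \<odot>\<^bsub>M\<^esub> x))" using x by (auto simp: C_def)
    finally show ?thesis .
  qed
  \<comment> \<open>Any representative may be chosen, since the coordinates are constant on a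
    coset.\<close>
  define H where "H i X = h i (SOME x. x \<in> X)" for i X
  have H: "H i (C (\<lambda>i. h i x)) = h i x" if "i \<in> I" "x \<in> V" for i x
  proof -
    have "(SOME y. y \<in> C (\<lambda>i. h i x)) \<in> C (\<lambda>i. h i x)"
      by (rule someI[of _ x]) (use that in \<open>auto simp: C_def\<close>)
    then show ?thesis using that by (auto simp: H_def C_def)
  qed
  show ?thesis
  proof (rule dim_eq_card_coordinates[where h = H and d = "\<lambda>i. C (\<lambda>j. h j (d i))", OF fin])
    fix X Y assume "X \<in> carrier ?Q" "Y \<in> carrier ?Q" and eq: "\<And>i. i \<in> I \<Longrightarrow> H i X = H i Y"
    then obtain x y where xy: "X = C (\<lambda>i. h i x)" "Y = C (\<lambda>i. h i y)" "x \<in> V" "y \<in> V"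
      by (auto simp: carrier)
    show "X = Y" unfolding xy by (rule C_cong) (use eq xy in \<open>auto simp: H\<close>)
  next
    have "\<zero>\<^bsub>?Q\<^esub> = C (\<lambda>i. h i \<zero>\<^bsub>M\<^esub>)" using zeroQ W_C by simp
    then show "\<zero>\<^bsub>?Q\<^esub> \<in> carrier ?Q" "\<And>i. i \<in> I \<Longrightarrow> H i \<zero>\<^bsub>?Q\<^esub> = 0"
      using sub.zero_closed by (auto simp: carrier H h_zero simp del: sub.zero_closed)
  next
    fix X Y assume "X \<in> carrier ?Q" "Y \<in> carrier ?Q"
    then obtain x y where xy: "X = C (\<lambda>i. h i x)" "Y = C (\<lambda>i. h i y)" "x \<in> V" "y \<in> V"
      by (auto simp: carrier)
    then show "X \<oplus>\<^bsub>?Q\<^esub> Y \<in> carrier ?Q" "\<And>c. c \<odot>\<^bsub>?Q\<^esub> X \<in> carrier ?Q"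
      "\<And>i. i \<in> I \<Longrightarrow> H i (X \<oplus>\<^bsub>?Q\<^esub> Y) = H i X + H i Y"
      "\<And>i c. i \<in> I \<Longrightarrow> H i (c \<odot>\<^bsub>?Q\<^esub> X) = c * H i X"
      unfolding carrier xy addQ[OF xy(3,4)] smultQ[OF xy(3)]
      using sub.m_closed[OF xy(3,4)] sm[OF xy(3)] by (auto simp: H h_add h_smult)
  next
    show "\<And>i. i \<in> I \<Longrightarrow> C (\<lambda>j. h j (d i)) \<in> carrier ?Q"
      unfolding carrier using d by auto
    show "\<And>i j. i \<in> I \<Longrightarrow> j \<in> I \<Longrightarrow> H j (C (\<lambda>j. h j (d i))) = (if j = i then 1 else 0)"
      using d by (simp add: H h_d)
  qed
qed

section \<open>Associative algebras and their Hochschild extensions\<close>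

text \<open>Ring and vector space live on one record and are tied together by the two scalar rules.
  Path algebras, truncated algebras and Hochschild extensions are all shown to be instances.\<close>

locale assoc_algebra = ring A + module: Module.module "class_ring :: 'k ring" A
  for A :: "('k::field, 'b) module" (structure) +
  assumes smult_mult_left: "x \<in> carrier A \<Longrightarrow> y \<in> carrier A \<Longrightarrow> (c \<odot> x) \<otimes> y = c \<odot> (x \<otimes> y)"
    and smult_mult_right: "x \<in> carrier A \<Longrightarrow> y \<in> carrier A \<Longrightarrow> x \<otimes> (c \<odot> y) = c \<odot> (x \<otimes> y)"
begin

lemma smult_carrier [simp, intro]: "x \<in> carrier A \<Longrightarrow> c \<odot> x \<in> carrier A"
  using module.smult_closed[of c x] by simp

lemma minus_eq_smult: "x \<in> carrier A \<Longrightarrow> \<ominus> x = (-1) \<odot> x"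
  using module.smult_minus_1[of x] by (simp add: class_ring_simps)

section \<open>Linear functionals and the dual bimodule, evaluated at elements\<close>

lemma dualI:
  assumes "\<phi> \<in> extensional (carrier A)"
    and "\<And>x y. x \<in> carrier A \<Longrightarrow> y \<in> carrier A \<Longrightarrow> \<phi> (x \<oplus> y) = \<phi> x + \<phi> y"
    and "\<And>c x. x \<in> carrier A \<Longrightarrow> \<phi> (c \<odot> x) = c * \<phi> x"
  shows "\<phi> \<in> carrier (dual A)"
  using assms by (simp add: dual_def)

lemma dual_apply_add:
  "\<phi> \<in> carrier (dual A) \<Longrightarrow> x \<in> carrier A \<Longrightarrow> y \<in> carrier A \<Longrightarrow> \<phi> (x \<oplus> y) = \<phi> x + \<phi> y"
  and dual_apply_smult: "\<phi> \<in> carrier (dual A) \<Longrightarrow> x \<in> carrier A \<Longrightarrow> \<phi> (c \<odot> x) = c * \<phi> x"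
  and dual_extensional: "\<phi> \<in> carrier (dual A) \<Longrightarrow> \<phi> \<in> extensional (carrier A)"
  by (simp_all add: dual_def)

lemma dual_apply_zero: "\<phi> \<in> carrier (dual A) \<Longrightarrow> \<phi> \<zero> = 0"
  using dual_apply_smult[of \<phi> \<zero> 0] by simp

lemma dual_eqI:
  assumes "\<phi> \<in> carrier (dual A)" "\<psi> \<in> carrier (dual A)" "\<And>x. x \<in> carrier A \<Longrightarrow> \<phi> x = \<psi> x"
  shows "\<phi> = \<psi>"
  using assms by (auto intro: extensionalityI dual_extensional)

lemma add_dual_apply: "x \<in> carrier A \<Longrightarrow> (\<phi> \<oplus>\<^bsub>dual A\<^esub> \<psi>) x = \<phi> x + \<psi> x"
  and zero_dual_apply: "x \<in> carrier A \<Longrightarrow> \<zero>\<^bsub>dual A\<^esub> x = 0"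
  and smult_dual_apply: "x \<in> carrier A \<Longrightarrow> (c \<odot>\<^bsub>dual A\<^esub> \<phi>) x = c * \<phi> x"
  and dual_left_apply: "x \<in> carrier A \<Longrightarrow> dual_left A a \<phi> x = \<phi> (x \<otimes> a)"
  and dual_right_apply: "x \<in> carrier A \<Longrightarrow> dual_right A \<phi> a x = \<phi> (a \<otimes> x)"
  by (simp_all add: dual_def dual_left_def dual_right_def)

lemmas dual_applies =
  add_dual_apply zero_dual_apply smult_dual_apply dual_left_apply dual_right_apply

lemma add_dual_closed [simp, intro]:
  "\<phi> \<in> carrier (dual A) \<Longrightarrow> \<psi> \<in> carrier (dual A) \<Longrightarrow> \<phi> \<oplus>\<^bsub>dual A\<^esub> \<psi> \<in> carrier (dual A)"
  by (simp add: dual_def algebra_simps)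

lemma zero_dual_closed [simp, intro]: "\<zero>\<^bsub>dual A\<^esub> \<in> carrier (dual A)"
  by (simp add: dual_def)

lemma smult_dual_closed [simp, intro]:
  "\<phi> \<in> carrier (dual A) \<Longrightarrow> c \<odot>\<^bsub>dual A\<^esub> \<phi> \<in> carrier (dual A)"
  by (simp add: dual_def algebra_simps)

lemma dual_left_closed [simp, intro]:
  "a \<in> carrier A \<Longrightarrow> \<phi> \<in> carrier (dual A) \<Longrightarrow> dual_left A a \<phi> \<in> carrier (dual A)"
  by (rule dualI)
    (simp_all add: dual_left_def l_distr smult_mult_left dual_apply_add dual_apply_smult)

lemma dual_right_closed [simp, intro]:
  "a \<in> carrier A \<Longrightarrow> \<phi> \<in> carrier (dual A) \<Longrightarrow> dual_right A \<phi> a \<in> carrier (dual A)"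
  by (rule dualI)
    (simp_all add: dual_right_def r_distr smult_mult_right dual_apply_add dual_apply_smult)

lemma dual_neg_ex: 
  "\<phi> \<in> carrier (dual A) \<Longrightarrow> \<exists>\<psi>\<in>carrier (dual A). \<psi> \<oplus>\<^bsub>dual A\<^esub> \<phi> = \<zero>\<^bsub>dual A\<^esub>"
  by (rule bexI[of _ "(-1) \<odot>\<^bsub>dual A\<^esub> \<phi>"]) (auto intro: dual_eqI simp: dual_applies)

lemma abelian_group_dual: "abelian_group (dual A)"
  by (rule abelian_groupI)
    (auto intro: dual_eqI simp: dual_applies algebra_simps dual_neg_ex)

lemma minus_dual_closed [simp, intro]:
  "\<phi> \<in> carrier (dual A) \<Longrightarrow> \<ominus>\<^bsub>dual A\<^esub> \<phi> \<in> carrier (dual A)"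
  using abelian_group.a_inv_closed[OF abelian_group_dual] .

lemma uminus_dual_apply:
  "\<phi> \<in> carrier (dual A) \<Longrightarrow> x \<in> carrier A \<Longrightarrow> (\<ominus>\<^bsub>dual A\<^esub> \<phi>) x = - \<phi> x"
  using add_dual_apply[of x \<phi> "\<ominus>\<^bsub>dual A\<^esub> \<phi>"] abelian_group.r_neg[OF abelian_group_dual, of \<phi>]
  by (simp add: zero_dual_apply eq_neg_iff_add_eq_0 add.commute)

lemma minus_dual_apply:
  "\<phi> \<in> carrier (dual A) \<Longrightarrow> \<psi> \<in> carrier (dual A) \<Longrightarrow> x \<in> carrier A \<Longrightarrow>
    (\<phi> \<ominus>\<^bsub>dual A\<^esub> \<psi>) x = \<phi> x - \<psi> x"
  by (simp add: a_minus_def add_dual_apply uminus_dual_apply)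

lemma minus_dual_closed2 [simp, intro]:
  "\<phi> \<in> carrier (dual A) \<Longrightarrow> \<psi> \<in> carrier (dual A) \<Longrightarrow> \<phi> \<ominus>\<^bsub>dual A\<^esub> \<psi> \<in> carrier (dual A)"
  by (simp add: a_minus_def)

section \<open>Coboundaries and two-cocycles, evaluated at elements\<close>

lemma module_hom_dual_closed:
  "f \<in> module_hom class_ring A (dual A) \<Longrightarrow> a \<in> carrier A \<Longrightarrow> f a \<in> carrier (dual A)"
  using module_hom_closed by blast

lemma module_hom_dual_add:
  "f \<in> module_hom class_ring A (dual A) \<Longrightarrow> a \<in> carrier A \<Longrightarrow> b \<in> carrier A \<Longrightarrow> d \<in> carrier A \<Longrightarrow>
    f (a \<oplus> b) d = f a d + f b d"
  by (simp add: module_hom_def add_dual_apply)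

lemma module_hom_dual_smult:
  "f \<in> module_hom class_ring A (dual A) \<Longrightarrow> a \<in> carrier A \<Longrightarrow> d \<in> carrier A \<Longrightarrow>
    f (c \<odot> a) d = c * f a d"
  by (simp add: module_hom_def smult_dual_apply)

lemma coboundary_apply:
  assumes "f \<in> module_hom class_ring A (dual A)" "a \<in> carrier A" "b \<in> carrier A" "d \<in> carrier A"
  shows "coboundary A f a b d = f b (d \<otimes> a) - f (a \<otimes> b) d + f a (b \<otimes> d)"
  using assms
  by (simp add: coboundary_def module_hom_dual_closed minus_dual_apply dual_applies)

lemma two_cocycle_closed:
  "two_cocycle A \<alpha> \<Longrightarrow> a \<in> carrier A \<Longrightarrow> b \<in> carrier A \<Longrightarrow> \<alpha> a b \<in> carrier (dual A)"
  unfolding two_cocycle_def bilinear_to_dual_def using module_hom_dual_closed by blast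

lemma
  assumes "two_cocycle A \<alpha>" "a \<in> carrier A" "b \<in> carrier A" "c \<in> carrier A" "d \<in> carrier A"
  shows two_cocycle_apply_add_left: "\<alpha> (a \<oplus> b) c d = \<alpha> a c d + \<alpha> b c d"
    and two_cocycle_apply_add_right: "\<alpha> c (a \<oplus> b) d = \<alpha> c a d + \<alpha> c b d"
    and two_cocycle_apply_smult_left: "\<alpha> (k \<odot> a) c d = k * \<alpha> a c d"
    and two_cocycle_apply_smult_right: "\<alpha> c (k \<odot> a) d = k * \<alpha> c a d"
proof -
  have l: "(\<lambda>x. \<alpha> x c) \<in> module_hom class_ring A (dual A)"
    and r: "\<alpha> c \<in> module_hom class_ring A (dual A)"
    using assms by (auto simp: two_cocycle_def bilinear_to_dual_def)
  show "\<alpha> (a \<oplus> b) c d = \<alpha> a c d + \<alpha> b c d" "\<alpha> (k \<odot> a) c d = k * \<alpha> a c d"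
    using module_hom_dual_add[OF l] module_hom_dual_smult[OF l] assms by auto
  show "\<alpha> c (a \<oplus> b) d = \<alpha> c a d + \<alpha> c b d" "\<alpha> c (k \<odot> a) d = k * \<alpha> c a d"
    using module_hom_dual_add[OF r] module_hom_dual_smult[OF r] assms by auto
qed

lemma two_cocycle_apply:
  assumes \<alpha>: "two_cocycle A \<alpha>" and c: "a \<in> carrier A" "b \<in> carrier A" "c \<in> carrier A" "d \<in> carrier A"
  shows "\<alpha> b c (d \<otimes> a) - \<alpha> (a \<otimes> b) c d + \<alpha> a (b \<otimes> c) d - \<alpha> a b (c \<otimes> d) = 0"
proof -
  have "dual_left A a (\<alpha> b c) \<ominus>\<^bsub>dual A\<^esub> \<alpha> (a \<otimes> b) c \<oplus>\<^bsub>dual A\<^esub> \<alpha> a (b \<otimes> c)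
        \<ominus>\<^bsub>dual A\<^esub> dual_right A (\<alpha> a b) c = \<zero>\<^bsub>dual A\<^esub>"
    using assms unfolding two_cocycle_def by blast
  from arg_cong[OF this, of "\<lambda>x. x d"] show ?thesis
    using c two_cocycle_closed[OF \<alpha>]
    by (simp add: minus_dual_apply dual_applies)
qed

lemma two_cocycle_zero: "two_cocycle A (zero_cocycle A)"
proof -
  have "\<zero>\<^bsub>dual A\<^esub> = c \<odot>\<^bsub>dual A\<^esub> \<zero>\<^bsub>dual A\<^esub>" "\<zero>\<^bsub>dual A\<^esub> = \<zero>\<^bsub>dual A\<^esub> \<oplus>\<^bsub>dual A\<^esub> \<zero>\<^bsub>dual A\<^esub>" for c
    by (auto intro!: dual_eqI simp: dual_applies)
  then have "bilinear_to_dual A (zero_cocycle A)"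
    by (simp add: bilinear_to_dual_def zero_cocycle_def module_hom_def)
  then show ?thesis unfolding two_cocycle_def
    by (auto intro!: dual_eqI simp: zero_cocycle_def dual_applies minus_dual_apply)
qed

text \<open>This is the cocycle identity at \<open>a\<close>, \<open>\<one>\<close>,
  \<open>\<one>\<close>, whose two middle terms cancel. Together with its mirror image below it
  makes \<open>(1, -\<alpha>(1, 1))\<close> a two-sided identity.\<close>

lemma two_cocycle_one_right:
  assumes "two_cocycle A \<alpha>" "a \<in> carrier A" "d \<in> carrier A"
  shows "\<alpha> a \<one> d = \<alpha> \<one> \<one> (d \<otimes> a)"
  using two_cocycle_apply[OF assms(1,2) one_closed one_closed assms(3)] assms by simp

lemma two_cocycle_one_left:
  assumes "two_cocycle A \<alpha>" "b \<in> carrier A" "d \<in> carrier A"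
  shows "\<alpha> \<one> b d = \<alpha> \<one> \<one> (b \<otimes> d)"
  using two_cocycle_apply[OF assms(1) one_closed one_closed assms(2,3)] assms by simp

end

section \<open>The Hochschild extension as an algebra\<close>

lemma hochschild_carrier: "carrier (hochschild_extension A \<alpha>) = carrier A \<times> carrier (dual A)"
  and hochschild_add: "(a, x) \<oplus>\<^bsub>hochschild_extension A \<alpha>\<^esub> (b, y) = (a \<oplus>\<^bsub>A\<^esub> b, x \<oplus>\<^bsub>dual A\<^esub> y)"
  and hochschild_zero: "\<zero>\<^bsub>hochschild_extension A \<alpha>\<^esub> = (\<zero>\<^bsub>A\<^esub>, \<zero>\<^bsub>dual A\<^esub>)"
  and hochschild_one: "\<one>\<^bsub>hochschild_extension A \<alpha>\<^esub> = (\<one>\<^bsub>A\<^esub>, \<ominus>\<^bsub>dual A\<^esub> \<alpha> \<one>\<^bsub>A\<^esub> \<one>\<^bsub>A\<^esub>)"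
  and hochschild_smult: "c \<odot>\<^bsub>hochschild_extension A \<alpha>\<^esub> (a, x) = (c \<odot>\<^bsub>A\<^esub> a, c \<odot>\<^bsub>dual A\<^esub> x)"
  and hochschild_mult: "(a, x) \<otimes>\<^bsub>hochschild_extension A \<alpha>\<^esub> (b, y) = (a \<otimes>\<^bsub>A\<^esub> b,
       dual_left A a y \<oplus>\<^bsub>dual A\<^esub> dual_right A x b \<oplus>\<^bsub>dual A\<^esub> \<alpha> a b)"
  by (simp_all add: hochschild_extension_def)

lemmas hochschild_simps = hochschild_carrier hochschild_add hochschild_zero hochschild_one
  hochschild_smult hochschild_mult

context assoc_algebra
begin

theorem assoc_algebra_hochschild_extension:
  assumes \<alpha>: "two_cocycle A \<alpha>"
  shows "assoc_algebra (hochschild_extension A \<alpha>)" (is "assoc_algebra ?T")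
proof -
  note [simp] = two_cocycle_closed[OF \<alpha>]
    two_cocycle_apply_add_left[OF \<alpha>] two_cocycle_apply_add_right[OF \<alpha>]
    two_cocycle_apply_smult_left[OF \<alpha>] two_cocycle_apply_smult_right[OF \<alpha>]
    hochschild_simps
    dual_applies dual_apply_add dual_apply_smult uminus_dual_apply
  have ag: "abelian_group ?T"
  proof (rule abelian_groupI)
    fix z assume "z \<in> carrier ?T"
    then obtain a x where z: "z = (a, x)" "a \<in> carrier A" "x \<in> carrier (dual A)" by auto
    then have "(\<ominus> a, \<ominus>\<^bsub>dual A\<^esub> x) \<oplus>\<^bsub>?T\<^esub> z = \<zero>\<^bsub>?T\<^esub>"
      by (auto simp: l_neg intro: dual_eqI)
    moreover have "(\<ominus> a, \<ominus>\<^bsub>dual A\<^esub> x) \<in> carrier ?T" using z by auto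
    ultimately show "\<exists>y\<in>carrier ?T. y \<oplus>\<^bsub>?T\<^esub> z = \<zero>\<^bsub>?T\<^esub>" by blast
  qed (auto simp: a_ac intro!: dual_eqI)
  have assoc: "x \<otimes>\<^bsub>?T\<^esub> y \<otimes>\<^bsub>?T\<^esub> z = x \<otimes>\<^bsub>?T\<^esub> (y \<otimes>\<^bsub>?T\<^esub> z)"
    if "x \<in> carrier ?T" "y \<in> carrier ?T" "z \<in> carrier ?T" for x y z
  proof -
    obtain a x' b y' c z' where eqs: "x = (a, x')" "y = (b, y')" "z = (c, z')" by (metis surj_pair)
    have cs: "a \<in> carrier A" "x' \<in> carrier (dual A)" "b \<in> carrier A" "y' \<in> carrier (dual A)"
      "c \<in> carrier A" "z' \<in> carrier (dual A)" using that by (auto simp: eqs)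
    \<comment> \<open>The cocycle identity is brought into a form without subtraction, in which it
      equates the \<alpha>-terms of the two triple products.\<close>
    have sum_eq: "w + y = x + z" if "x - y + z - w = 0" for x y z w :: 'k
      using arg_cong[OF that, of "\<lambda>t. t + w + y"] by (simp add: algebra_simps)
    have "\<alpha> a b (c \<otimes> d) + \<alpha> (a \<otimes> b) c d = \<alpha> b c (d \<otimes> a) + \<alpha> a (b \<otimes> c) d" if "d \<in> carrier A" for d
      by (rule sum_eq) (rule two_cocycle_apply[OF \<alpha> cs(1,3,5) that])
    then show ?thesis using cs
      by (auto simp: eqs m_assoc algebra_simps intro!: dual_eqI)
  qed
  have monoid: "monoid ?T"
  proof (rule monoidI)
    fix z assume "z \<in> carrier ?T"
    then obtain a x where z: "z = (a, x)" "a \<in> carrier A" "x \<in> carrier (dual A)" by auto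
    then show "\<one>\<^bsub>?T\<^esub> \<otimes>\<^bsub>?T\<^esub> z = z" "z \<otimes>\<^bsub>?T\<^esub> \<one>\<^bsub>?T\<^esub> = z"
      by (auto intro!: dual_eqI simp: two_cocycle_one_left[OF \<alpha>, of a] two_cocycle_one_right[OF \<alpha>, of a])
  qed (use assoc in auto)
  have "ring ?T"
    by (rule ringI[OF ag monoid])
      (auto simp: l_distr r_distr algebra_simps intro!: dual_eqI)
  moreover have "Module.module (class_ring :: 'k ring) ?T"
    by (rule moduleI[OF _ ag])
      (auto simp: class_cring.cring_axioms module.smult_l_distr[simplified]
        module.smult_r_distr[simplified] module.smult_assoc1[simplified]
        module.smult_one[simplified] algebra_simps intro!: dual_eqI)
  moreover have "assoc_algebra_axioms ?T"
    by unfold_locales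
      (auto simp: smult_mult_left smult_mult_right algebra_simps intro!: dual_eqI)
  ultimately show ?thesis by (intro assoc_algebra.intro)
qed

end

section \<open>The Jacobson radical and the ordinary quiver\<close>

context assoc_algebra
begin

lemma smult_eq_mult: "x \<in> carrier A \<Longrightarrow> c \<odot> x = (c \<odot> \<one>) \<otimes> x"
  by (simp add: smult_mult_left)

lemma left_idealD:
  assumes "left_ideal I A"
  shows "I \<subseteq> carrier A" "\<zero> \<in> I" "x \<in> I \<Longrightarrow> y \<in> I \<Longrightarrow> x \<oplus> y \<in> I"
    "x \<in> I \<Longrightarrow> y \<in> I \<Longrightarrow> x \<ominus> y \<in> I" "a \<in> carrier A \<Longrightarrow> x \<in> I \<Longrightarrow> a \<otimes> x \<in> I"
proof -
  interpret additive_subgroup I A using assms by (simp add: left_ideal_def)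
  show "I \<subseteq> carrier A" "\<zero> \<in> I" "x \<in> I \<Longrightarrow> y \<in> I \<Longrightarrow> x \<oplus> y \<in> I"
    "x \<in> I \<Longrightarrow> y \<in> I \<Longrightarrow> x \<ominus> y \<in> I"
    using a_subset is_abelian_group by (auto simp: a_minus_def a_inv_closed)
  show "a \<in> carrier A \<Longrightarrow> x \<in> I \<Longrightarrow> a \<otimes> x \<in> I"
    using assms by (simp add: left_ideal_def)
qed

lemma left_idealI:
  assumes "I \<subseteq> carrier A" "\<zero> \<in> I" "\<And>x y. x \<in> I \<Longrightarrow> y \<in> I \<Longrightarrow> x \<oplus> y \<in> I"
    "\<And>a x. a \<in> carrier A \<Longrightarrow> x \<in> I \<Longrightarrow> a \<otimes> x \<in> I"
  shows "left_ideal I A"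
proof -
  have "\<ominus> x \<in> I" if "x \<in> I" for x
  proof -
    have "x \<in> carrier A" using that assms(1) by blast
    then have "\<ominus> x = (\<ominus> \<one>) \<otimes> x" by (simp add: l_minus)
    then show ?thesis using assms(4)[OF _ that, of "\<ominus> \<one>"] by simp
  qed
  then show ?thesis
    unfolding left_ideal_def using assms
    by (auto intro!: additive_subgroupI add.subgroupI simp flip: a_inv_def)
qed

text \<open>The kernel of a character has codimension one: if \<open>z\<close> lies outside, every
  \<open>t\<close> differs from the multiple \<open>(\<chi> t / \<chi> z) z\<close> by an element of
  the kernel.\<close>

lemma maximal_left_ideal_kernel:
  fixes \<chi> :: "'b \<Rightarrow> 'k"
  assumes add: "\<And>x y. x \<in> carrier A \<Longrightarrow> y \<in> carrier A \<Longrightarrow> \<chi> (x \<oplus> y) = \<chi> x + \<chi> y"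
    and smult: "\<And>c x. x \<in> carrier A \<Longrightarrow> \<chi> (c \<odot> x) = c * \<chi> x"
    and mult: "\<And>x y. x \<in> carrier A \<Longrightarrow> y \<in> carrier A \<Longrightarrow> \<chi> (x \<otimes> y) = \<chi> x * \<chi> y"
    and one: "\<chi> \<one> = 1"
  shows "maximal_left_ideal {z \<in> carrier A. \<chi> z = 0} A" (is "maximal_left_ideal ?K A")
  unfolding maximal_left_ideal_def
proof (intro conjI allI impI)
  have "\<chi> \<zero> = 0" using smult[of \<zero> 0] by simp
  then show "left_ideal ?K A"
    by (intro left_idealI) (auto simp: add mult)
  have "\<one> \<notin> ?K" using one by simp
  then show "?K \<noteq> carrier A" using one_closed by blast
  fix J assume J: "left_ideal J A \<and> ?K \<subseteq> J"
  note JD = left_idealD[of J]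
  have "J = carrier A" if "J \<noteq> ?K"
  proof -
    have "\<not> J \<subseteq> ?K" using J that by blast
    then obtain z where z: "z \<in> J" "\<chi> z \<noteq> 0" "z \<in> carrier A" using J JD(1) by blast
    have "t \<in> J" if t: "t \<in> carrier A" for t
    proof -
      let ?c = "\<chi> t / \<chi> z"
      have "?c \<odot> z \<in> J" using JD(5)[of "?c \<odot> \<one>" z] J z smult_eq_mult[of z] by simp
      moreover have "t \<ominus> ?c \<odot> z \<in> ?K"
        using t z by (simp add: a_minus_def add minus_eq_smult smult)
      ultimately have "(t \<ominus> ?c \<odot> z) \<oplus> ?c \<odot> z \<in> J" using J JD(3) by blast
      then show ?thesis using t z by (simp add: a_minus_def a_assoc l_neg)
    qed
    then show ?thesis using J JD(1) by blast
  qed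
  then show "J = ?K \<or> J = carrier A" by blast
qed

text \<open>By \<open>1 - w^(j+1) = (1 - w^j) + w^j (1 - w)\<close> the left ideal contains
  \<open>1 - w^j\<close> for all \<open>j\<close>, in particular for an exponent with
  \<open>w^j = 0\<close>.\<close>

lemma one_in_left_ideal_if_nilpotent:
  assumes M: "left_ideal M A" and w: "w \<in> carrier A" "\<one> \<ominus> w \<in> M" "w [^] (k::nat) = \<zero>"
  shows "\<one> \<in> M"
proof -
  have "\<one> \<ominus> w [^] j \<in> M" for j :: nat
  proof (induction j)
    case 0
    then show ?case using left_idealD(2)[OF M] by (simp add: r_neg a_minus_def)
  next
    case (Suc j)
    have "\<one> \<ominus> w [^] Suc j = (\<one> \<ominus> w [^] j) \<oplus> w [^] j \<otimes> (\<one> \<ominus> w)"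
      using w(1) by (simp add: a_minus_def r_distr r_minus a_assoc r_neg2 r_neg1)
    then show ?case using Suc left_idealD(3,5)[OF M] w by simp
  qed
  from this[of k] show ?thesis using w by (simp add: a_minus_def)
qed

text \<open>One inclusion holds because kernels of characters are maximal left ideals. For the
  other, if some \<open>z\<close> in \<open>N\<close> were outside a maximal left ideal
  \<open>M\<close>, then \<open>1 = m + r z\<close> with \<open>m\<close> in \<open>M\<close>; here
  \<open>r z\<close> is again in \<open>N\<close>, hence nilpotent, which forces \<open>1\<close>
  into \<open>M\<close>.\<close>

lemma jacobson_radical_eqI:
  fixes \<chi> :: "'v \<Rightarrow> 'b \<Rightarrow> 'k"
  assumes add: "\<And>v x y. v \<in> V \<Longrightarrow> x \<in> carrier A \<Longrightarrow> y \<in> carrier A \<Longrightarrow> \<chi> v (x \<oplus> y) = \<chi> v x + \<chi> v y"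
    and smult: "\<And>v c x. v \<in> V \<Longrightarrow> x \<in> carrier A \<Longrightarrow> \<chi> v (c \<odot> x) = c * \<chi> v x"
    and mult: "\<And>v x y. v \<in> V \<Longrightarrow> x \<in> carrier A \<Longrightarrow> y \<in> carrier A \<Longrightarrow> \<chi> v (x \<otimes> y) = \<chi> v x * \<chi> v y"
    and one: "\<And>v. v \<in> V \<Longrightarrow> \<chi> v \<one> = 1"
    and N: "N = {z \<in> carrier A. \<forall>v\<in>V. \<chi> v z = 0}"
    and nil: "\<And>z. z \<in> N \<Longrightarrow> \<exists>k::nat. z [^] k = \<zero>"
  shows "jacobson_radical A = N"
proof
  have "maximal_left_ideal {z \<in> carrier A. \<chi> v z = 0} A" if "v \<in> V" for v
    by (rule maximal_left_ideal_kernel) (simp_all add: add smult mult one that)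
  then show "jacobson_radical A \<subseteq> N"
    unfolding jacobson_radical_def N by blast
  have "z \<in> M" if z: "z \<in> N" and M: "maximal_left_ideal M A" for z M
  proof (rule ccontr)
    assume "z \<notin> M"
    have zc: "z \<in> carrier A" using z N by simp
    have li: "left_ideal M A" using M by (simp add: maximal_left_ideal_def)
    note MD = left_idealD[OF li]
    let ?L = "{m \<oplus> r \<otimes> z | m r. m \<in> M \<and> r \<in> carrier A}"
    have Mc: "m \<in> carrier A" if "m \<in> M" for m using that MD(1) by blast
    have "left_ideal ?L A"
    proof (rule left_idealI)
      show "?L \<subseteq> carrier A" using zc Mc by auto
      show "\<zero> \<in> ?L" using MD(2) zc by (auto intro!: exI[of _ \<zero>])
      fix x y assume "x \<in> ?L" "y \<in> ?L"
      then obtain m r m' r' where xy: "x = m \<oplus> r \<otimes> z" "y = m' \<oplus> r' \<otimes> z"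
        "m \<in> M" "m' \<in> M" "r \<in> carrier A" "r' \<in> carrier A" by blast
      then have "x \<oplus> y = (m \<oplus> m') \<oplus> (r \<oplus> r') \<otimes> z"
        using Mc zc by (simp add: l_distr a_ac)
      then show "x \<oplus> y \<in> ?L" using xy MD(3) by blast
      fix a assume a: "a \<in> carrier A"
      then have "a \<otimes> x = a \<otimes> m \<oplus> (a \<otimes> r) \<otimes> z"
        using xy Mc zc by (simp add: r_distr m_assoc)
      then show "a \<otimes> x \<in> ?L" using a xy MD(5) by blast
    qed
    moreover have "M \<subseteq> ?L"
    proof
      fix m assume "m \<in> M"
      then show "m \<in> ?L" using Mc zc by (intro CollectI exI[of _ m] exI[of _ \<zero>]) auto
    qed
    moreover have "z \<in> ?L" using MD(2) zc by (intro CollectI exI[of _ \<zero>] exI[of _ \<one>]) auto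
    ultimately have "?L = carrier A"
      using M \<open>z \<notin> M\<close> unfolding maximal_left_ideal_def by blast
    then have "\<one> \<in> ?L" by simp
    then obtain m r where mr: "\<one> = m \<oplus> r \<otimes> z" "m \<in> M" "r \<in> carrier A" by blast
    have "r \<otimes> z \<in> N" using mr z by (simp add: N mult)
    then obtain k :: nat where "(r \<otimes> z) [^] k = \<zero>" using nil by blast
    moreover have "\<one> \<ominus> r \<otimes> z \<in> M"
      using mr Mc zc by (simp add: a_minus_def a_assoc r_neg)
    ultimately have "\<one> \<in> M"
      using one_in_left_ideal_if_nilpotent[OF li, of "r \<otimes> z" k] mr zc by simp
    then have "carrier A \<subseteq> M" using MD(5)[of _ \<one>] by (metis r_one subsetI)
    then show False using \<open>z \<notin> M\<close> zc by blast
  qed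
  then show "N \<subseteq> jacobson_radical A" unfolding jacobson_radical_def using N by blast
qed

lemma ideal_jacobson_kernel:
  fixes \<chi> :: "'v \<Rightarrow> 'b \<Rightarrow> 'k"
  assumes "\<And>v x y. v \<in> V \<Longrightarrow> x \<in> carrier A \<Longrightarrow> y \<in> carrier A \<Longrightarrow> \<chi> v (x \<oplus> y) = \<chi> v x + \<chi> v y"
    and smult: "\<And>v c x. v \<in> V \<Longrightarrow> x \<in> carrier A \<Longrightarrow> \<chi> v (c \<odot> x) = c * \<chi> v x"
    and "\<And>v x y. v \<in> V \<Longrightarrow> x \<in> carrier A \<Longrightarrow> y \<in> carrier A \<Longrightarrow> \<chi> v (x \<otimes> y) = \<chi> v x * \<chi> v y"
  shows "ideal {z \<in> carrier A. \<forall>v\<in>V. \<chi> v z = 0} A" (is "ideal ?N A")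
proof -
  have "\<chi> v \<zero> = 0" if "v \<in> V" for v using smult[OF that, of \<zero> 0] by simp
  then have "left_ideal ?N A"
    by (intro left_idealI) (auto simp: assms)
  then have "subgroup ?N (add_monoid A)"
    by (simp add: left_ideal_def additive_subgroup_def)
  then show ?thesis
    by (rule idealI[OF ring_axioms]) (auto simp: assms)
qed

text \<open>The functionals \<open>h b\<close> are coordinates on \<open>N / N^2\<close>. Passing to
  the corner of \<open>e i\<close> and \<open>e j\<close> keeps the coordinates with
  \<open>src b = i\<close> and \<open>tgt b = j\<close> and kills all others.\<close>

lemma ordinary_arrows_eq_card:
  fixes h :: "'c \<Rightarrow> 'b \<Rightarrow> 'k"
  assumes J: "jacobson_radical A = N" and id: "ideal N A"
    and ei: "e i \<in> carrier A" "e i \<otimes> e i = e i" and ej: "e j \<in> carrier A" "e j \<otimes> e j = e j"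
    and fin: "finite B"
    and h_add: "\<And>b x y. b \<in> B \<Longrightarrow> x \<in> N \<Longrightarrow> y \<in> N \<Longrightarrow> h b (x \<oplus> y) = h b x + h b y"
    and h_smult: "\<And>b c x. b \<in> B \<Longrightarrow> x \<in> N \<Longrightarrow> h b (c \<odot> x) = c * h b x"
    and N2: "ideal_prod A N N = {z \<in> N. \<forall>b\<in>B. h b z = 0}"
    and d: "\<And>b. b \<in> B \<Longrightarrow> d b \<in> N"
    and h_d: "\<And>b b'. b \<in> B \<Longrightarrow> b' \<in> B \<Longrightarrow> h b' (d b) = (if b' = b then 1 else 0)"
    and h_corner: "\<And>b z. b \<in> B \<Longrightarrow> z \<in> N \<Longrightarrow>
      h b (e i \<otimes> z \<otimes> e j) = (if src b = i \<and> tgt b = j then h b z else 0)"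
  shows "ordinary_arrows A e i j = card {b \<in> B. src b = i \<and> tgt b = j}"
proof -
  interpret N: ideal N A by (rule id)
  let ?V = "corner A (e i) N (e j)" and ?W = "corner A (e i) (ideal_prod A N N) (e j)"
  note [simp] = ei ej N.Icarr
  have VN: "z \<in> N" if "z \<in> ?V" for z
    using that by (auto simp: corner_def N.I_l_closed N.I_r_closed)
  have fix_V: "e i \<otimes> z \<otimes> e j = z" if z: "z \<in> ?V" for z
  proof -
    obtain w where w: "z = e i \<otimes> w \<otimes> e j" "w \<in> N" using z unfolding corner_def by blast
    then have wc: "w \<in> carrier A" by simp
    have "e i \<otimes> (e i \<otimes> w \<otimes> e j) \<otimes> e j = (e i \<otimes> e i) \<otimes> w \<otimes> (e j \<otimes> e j)"
      using wc ei(1) ej(1) by (simp add: m_assoc del: ei(2) ej(2))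
    then show ?thesis using w by simp
  qed
  have sm: "c \<odot> z \<in> N" if "z \<in> N" for c z
    using that N.I_l_closed[of z "c \<odot> \<one>"] smult_eq_mult[of z c] by simp
  have sub: "LinearCombinations.submodule class_ring ?V A"
  proof (unfold_locales)
    show "?V \<subseteq> carrier A" using VN by auto
    have "e i \<otimes> \<zero> \<otimes> e j = \<zero>" by simp
    then show "\<zero> \<in> ?V" unfolding corner_def using N.zero_closed by (metis (mono_tags, lifting) mem_Collect_eq)
    fix v w assume "v \<in> ?V" "w \<in> ?V"
    then have "e i \<otimes> (v \<oplus> w) \<otimes> e j = v \<oplus> w" "v \<oplus> w \<in> N"
      using fix_V VN by (auto simp: r_distr l_distr)
    then show "v \<oplus> w \<in> ?V" unfolding corner_def by (metis (mono_tags, lifting) mem_Collect_eq)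
  next
    fix c :: 'k and v assume "v \<in> ?V"
    then have "e i \<otimes> (c \<odot> v) \<otimes> e j = c \<odot> v" "c \<odot> v \<in> N"
      using fix_V VN sm by (auto simp: smult_mult_left smult_mult_right)
    then show "c \<odot> v \<in> ?V" unfolding corner_def by (metis (mono_tags, lifting) mem_Collect_eq)
  qed
  have "vectorspace.dim class_ring (quot_module (A\<lparr>carrier := ?V\<rparr>) ?W)
    = card {b \<in> B. src b = i \<and> tgt b = j}"
  proof (rule dim_quotient_by_functionals[where h = h and d = "\<lambda>b. e i \<otimes> d b \<otimes> e j",
        OF module.module_axioms sub])
    have h_off: "h b z = 0" if "b \<in> B" "\<not> (src b = i \<and> tgt b = j)" "z \<in> ?V" for b z
      using h_corner[OF that(1), of z] that fix_V VN by auto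
    show "?W = {z \<in> ?V. \<forall>b\<in>{b \<in> B. src b = i \<and> tgt b = j}. h b z = 0}"
    proof (intro equalityI subsetI CollectI conjI ballI)
      fix z assume "z \<in> ?W"
      then obtain w where w: "z = e i \<otimes> w \<otimes> e j" "w \<in> N" "\<forall>b\<in>B. h b w = 0"
        by (auto simp: corner_def N2)
      then show "z \<in> ?V" by (auto simp: corner_def)
      fix b assume "b \<in> {b \<in> B. src b = i \<and> tgt b = j}"
      then show "h b z = 0" using w by (simp add: h_corner)
    next
      fix z assume z: "z \<in> {z \<in> ?V. \<forall>b\<in>{b \<in> B. src b = i \<and> tgt b = j}. h b z = 0}"
      then have "h b z = 0" if "b \<in> B" for b using h_off[OF that] that by blast
      then have "z \<in> ideal_prod A N N" using z VN N2 by blast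
      \<comment> \<open>An element of the corner is fixed by multiplication with \<open>e i\<close>
        and \<open>e j\<close>, so lying in \<open>N^2\<close> it also lies in the corner of
        \<open>N^2\<close>.\<close>
      then show "z \<in> ?W" using fix_V[of z] z unfolding corner_def
        by (metis (mono_tags, lifting) mem_Collect_eq)
    qed
    show "e i \<otimes> d b \<otimes> e j \<in> ?V" if "b \<in> {b \<in> B. src b = i \<and> tgt b = j}" for b
      using that d by (auto simp: corner_def)
    show "h b' (e i \<otimes> d b \<otimes> e j) = (if b' = b then 1 else 0)"
      if "b \<in> {b \<in> B. src b = i \<and> tgt b = j}" "b' \<in> {b \<in> B. src b = i \<and> tgt b = j}" for b b'
      using that by (simp add: h_corner d h_d)
  qed (use fin VN h_add h_smult in auto)
  then show ?thesis by (simp add: ordinary_arrows_def J Let_def)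
qed

end

section \<open>Truncated path algebras\<close>

text \<open>Factor rings are plain ring records, whereas \<open>truncated_algebra\<close> is a
  module record with the same operations; this transfers the ring laws from one to the
  other.\<close>

lemma ring_cong:
  assumes "ring R" and eqs: "carrier S = carrier R" "mult S = mult R" "one S = one R"
    "zero S = zero R" "add S = add R"
  shows "ring S"
proof -
  interpret R: ring R by (rule assms)
  have "abelian_group S"
  proof (rule abelian_groupI)
    show "\<exists>y\<in>carrier S. y \<oplus>\<^bsub>S\<^esub> x = \<zero>\<^bsub>S\<^esub>" if "x \<in> carrier S" for x
      using that R.l_neg[of x] R.a_inv_closed[of x] unfolding eqs by blast
  qed (simp_all add: eqs R.a_ac)
  moreover have "monoid S" by (rule monoidI) (simp_all add: eqs R.m_assoc)
  ultimately show ?thesis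
    by (rule ringI) (simp_all add: eqs R.l_distr R.r_distr)
qed

lemma path_target_Nil [simp]: "path_target Q (v, []) = v"
  by (simp add: path_target_def pre_digraph.awalk_verts.simps)

lemma path_target_conv: "path_target Q (v, xs) = (if xs = [] then v else head Q (last xs))"
  by (simp add: path_target_def pre_digraph.awalk_verts_conv)

lemma path_target_append:
  "path_target Q (path_target Q (v, xs), ys) = path_target Q (v, xs @ ys)"
  by (simp add: path_target_conv)

lemma path_algebra_carrier:
    "carrier (path_algebra Q) = {f. finite {p. f p \<noteq> 0} \<and> {p. f p \<noteq> 0} \<subseteq> paths Q}"
  and path_algebra_add: "f \<oplus>\<^bsub>path_algebra Q\<^esub> g = (\<lambda>p. f p + g p)"
  and path_algebra_zero: "\<zero>\<^bsub>path_algebra Q\<^esub> = (\<lambda>p. 0)"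
  and path_algebra_smult: "c \<odot>\<^bsub>path_algebra Q\<^esub> f = (\<lambda>p. c * f p)"
  and path_algebra_one:
    "\<one>\<^bsub>path_algebra Q\<^esub> (v, xs) = (if v \<in> verts Q \<and> xs = [] then 1 else 0)"
  and path_algebra_mult: "(f \<otimes>\<^bsub>path_algebra Q\<^esub> g) (v, xs) = (\<Sum>k\<le>length xs.
       f (v, take k xs) * g (path_target Q (v, take k xs), drop k xs))"
  by (simp_all add: path_algebra_def)

text \<open>Both sides sum over all ways to cut the path into three consecutive pieces;
  \<open>F j m\<close> is the term with a first piece of length \<open>j\<close> and a second of
  length \<open>m\<close>.\<close>

lemma path_algebra_mult_assoc:
  fixes f g h :: "('v, 'a) path \<Rightarrow> 'k::field"
  shows "f \<otimes>\<^bsub>path_algebra Q\<^esub> g \<otimes>\<^bsub>path_algebra Q\<^esub> h = f \<otimes>\<^bsub>path_algebra Q\<^esub> (g \<otimes>\<^bsub>path_algebra Q\<^esub> h)"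
proof (rule ext, clarify)
  fix v :: 'v and xs :: "'a list"
  let ?R = "path_algebra Q" and ?L = "length xs"
  let ?t = "\<lambda>k. path_target Q (v, take k xs)"
  define F where "F j m = f (v, take j xs) * g (?t j, take m (drop j xs)) * h (?t (j + m), drop (j + m) xs)"
    for j m
  have "(f \<otimes>\<^bsub>?R\<^esub> g \<otimes>\<^bsub>?R\<^esub> h) (v, xs) = (\<Sum>k\<le>?L. \<Sum>j\<le>k. F j (k - j))"
    unfolding path_algebra_mult[where f = "f \<otimes>\<^bsub>?R\<^esub> g"]
    by (intro sum.cong) (simp_all add: path_algebra_mult sum_distrib_right F_def min_absorb1 drop_take)
  also have "\<dots> = (\<Sum>(j, m)\<in>{(j, m). j + m \<le> ?L}. F j m)"
    by (rule sum.triangle_reindex_eq[symmetric])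
  also have "{(j, m). j + m \<le> ?L} = Sigma {..?L} (\<lambda>j. {..?L - j})" by auto
  also have "(\<Sum>(j, m)\<in>Sigma {..?L} (\<lambda>j. {..?L - j}). F j m) = (\<Sum>j\<le>?L. \<Sum>m\<le>?L - j. F j m)"
    by (rule sum.Sigma[symmetric]) auto
  also have "\<dots> = (f \<otimes>\<^bsub>?R\<^esub> (g \<otimes>\<^bsub>?R\<^esub> h)) (v, xs)"
    unfolding path_algebra_mult[where f = f]
    by (intro sum.cong)
      (simp_all add: path_algebra_mult sum_distrib_left F_def mult.assoc path_target_append take_add add.commute)
  finally show "(f \<otimes>\<^bsub>?R\<^esub> g \<otimes>\<^bsub>?R\<^esub> h) (v, xs) = (f \<otimes>\<^bsub>?R\<^esub> (g \<otimes>\<^bsub>?R\<^esub> h)) (v, xs)" .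
qed

context fin_digraph
begin

lemma paths_append_iff:
  "(v, xs @ ys) \<in> paths G \<longleftrightarrow> (v, xs) \<in> paths G \<and> (path_target G (v, xs), ys) \<in> paths G"
  by (auto simp: paths_def path_target_def)

lemma paths_Nil_iff: "(v, []) \<in> paths G \<longleftrightarrow> v \<in> verts G"
  by (auto simp: paths_def awalk_Nil_iff)

lemma path_source_in_verts: "(v, xs) \<in> paths G \<Longrightarrow> v \<in> verts G"
  by (auto simp: paths_def)

lemma path_target_in_verts: "(v, xs) \<in> paths G \<Longrightarrow> path_target G (v, xs) \<in> verts G"
  using paths_append_iff[of v xs "[]"] paths_Nil_iff by simp

lemma path_algebra_one_closed: "(\<one>\<^bsub>path_algebra G\<^esub> :: _ \<Rightarrow> 'k :: field) \<in> carrier (path_algebra G)"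
proof -
  have "{p. \<one>\<^bsub>path_algebra G\<^esub> p \<noteq> (0 :: 'k)} = (\<lambda>v. (v, [])) ` verts G"
    by (auto simp: path_algebra_one split: if_splits)
  then show ?thesis by (auto simp: path_algebra_carrier paths_Nil_iff)
qed

lemma path_algebra_add_closed:
  fixes f g :: "('a, 'b) path \<Rightarrow> 'k :: field"
  assumes "f \<in> carrier (path_algebra G)" "g \<in> carrier (path_algebra G)"
  shows "(\<lambda>p. f p + g p) \<in> carrier (path_algebra G)"
proof -
  have sub: "{p. f p + g p \<noteq> 0} \<subseteq> {p. f p \<noteq> 0} \<union> {p. g p \<noteq> 0}" by auto
  have "finite ({p. f p \<noteq> 0} \<union> {p. g p \<noteq> 0})" "{p. f p \<noteq> 0} \<union> {p. g p \<noteq> 0} \<subseteq> paths G"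
    using assms by (auto simp: path_algebra_carrier)
  then show ?thesis using finite_subset[OF sub] order_trans[OF sub] by (simp add: path_algebra_carrier)
qed

lemma path_algebra_smult_closed:
  fixes f :: "('a, 'b) path \<Rightarrow> 'k :: field"
  assumes "f \<in> carrier (path_algebra G)"
  shows "(\<lambda>p. c * f p) \<in> carrier (path_algebra G)"
proof -
  have sub: "{p. c * f p \<noteq> 0} \<subseteq> {p. f p \<noteq> 0}" by auto
  show ?thesis using assms finite_subset[OF sub] order_trans[OF sub] by (simp add: path_algebra_carrier)
qed

lemma path_algebra_mult_closed:
  fixes f g :: "('a, 'b) path \<Rightarrow> 'k :: field"
  assumes "f \<in> carrier (path_algebra G)" "g \<in> carrier (path_algebra G)"
  shows "f \<otimes>\<^bsub>path_algebra G\<^esub> g \<in> carrier (path_algebra G)"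
proof -
  let ?h = "f \<otimes>\<^bsub>path_algebra G\<^esub> g"
  have *: "\<exists>k. f (v, take k xs) \<noteq> 0 \<and> g (path_target G (v, take k xs), drop k xs) \<noteq> 0"
    if "?h (v, xs) \<noteq> 0" for v xs
  proof (rule ccontr)
    assume "\<not> ?thesis"
    then have "?h (v, xs) = 0" unfolding path_algebra_mult by (intro sum.neutral) auto
    then show False using that by simp
  qed
  have "{p. ?h p \<noteq> 0} \<subseteq> (\<lambda>(p, q). (fst p, snd p @ snd q)) ` ({p. f p \<noteq> 0} \<times> {p. g p \<noteq> 0})"
  proof clarify
    fix v xs assume "?h (v, xs) \<noteq> 0"
    then obtain k where "f (v, take k xs) \<noteq> 0" "g (path_target G (v, take k xs), drop k xs) \<noteq> 0"
      using * by blast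
    then show "(v, xs) \<in> (\<lambda>(p, q). (fst p, snd p @ snd q)) ` ({p. f p \<noteq> 0} \<times> {p. g p \<noteq> 0})"
      by (intro rev_image_eqI[of "((v, take k xs), (path_target G (v, take k xs), drop k xs))"]) auto
  qed
  moreover have "finite ((\<lambda>(p, q). (fst p, snd p @ snd q)) ` ({p. f p \<noteq> 0} \<times> {p. g p \<noteq> 0}))"
    using assms by (auto simp: path_algebra_carrier)
  ultimately have "finite {p. ?h p \<noteq> 0}" by (rule finite_subset)
  moreover have "{p. ?h p \<noteq> 0} \<subseteq> paths G"
  proof clarify
    fix v xs assume "?h (v, xs) \<noteq> 0"
    then obtain k where "f (v, take k xs) \<noteq> 0" "g (path_target G (v, take k xs), drop k xs) \<noteq> 0"
      using * by blast
    then have "(v, take k xs) \<in> paths G" "(path_target G (v, take k xs), drop k xs) \<in> paths G"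
      using assms by (auto simp: path_algebra_carrier)
    then show "(v, xs) \<in> paths G" using paths_append_iff[of v "take k xs" "drop k xs"] by simp
  qed
  ultimately show ?thesis by (simp add: path_algebra_carrier)
qed

lemma assoc_algebra_path_algebra:
  "assoc_algebra (path_algebra G :: ('k :: field, ('a, 'b) path \<Rightarrow> 'k) module)" (is "assoc_algebra ?R")
proof -
  note closed = path_algebra_add_closed path_algebra_smult_closed path_algebra_mult_closed
    path_algebra_one_closed
  note simps = path_algebra_add path_algebra_zero path_algebra_smult path_algebra_one path_algebra_mult
  have zero: "(\<lambda>p. 0) \<in> carrier ?R" by (simp add: path_algebra_carrier)
  have off: "f p = 0" if "f \<in> carrier ?R" "p \<notin> paths G" for f p
    using that by (auto simp: path_algebra_carrier)
  have ag: "abelian_group ?R"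
  proof (rule abelian_groupI)
    fix f assume "f \<in> carrier ?R"
    then show "\<exists>g\<in>carrier ?R. g \<oplus>\<^bsub>?R\<^esub> f = \<zero>\<^bsub>?R\<^esub>"
      using path_algebra_smult_closed[of f "-1"] by (intro bexI[of _ "\<lambda>p. -1 * f p"]) (auto simp: simps)
  qed (simp_all add: simps zero closed algebra_simps)
  have one_left: "(\<one>\<^bsub>?R\<^esub> \<otimes>\<^bsub>?R\<^esub> f) (v, xs) = f (v, xs)" if "f \<in> carrier ?R" for f v xs
  proof -
    have "(\<one>\<^bsub>?R\<^esub> \<otimes>\<^bsub>?R\<^esub> f) (v, xs) = (\<Sum>k\<le>length xs. if k = 0 then f (v, xs) else 0)"
      unfolding path_algebra_mult
      using off[OF that, of "(v, xs)"] path_source_in_verts[of v xs]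
      by (intro sum.cong) (auto simp: path_algebra_one)
    then show ?thesis by simp
  qed
  have one_right: "(f \<otimes>\<^bsub>?R\<^esub> \<one>\<^bsub>?R\<^esub>) (v, xs) = f (v, xs)" if "f \<in> carrier ?R" for f v xs
  proof -
    have "(f \<otimes>\<^bsub>?R\<^esub> \<one>\<^bsub>?R\<^esub>) (v, xs) = (\<Sum>k\<le>length xs. if k = length xs then f (v, xs) else 0)"
      unfolding path_algebra_mult
      using off[OF that, of "(v, xs)"] path_target_in_verts[of v xs]
      by (intro sum.cong) (auto simp: path_algebra_one)
    then show ?thesis by simp
  qed
  have monoid: "monoid ?R"
    by (rule monoidI) (auto simp: closed path_algebra_mult_assoc one_left one_right)
  have "ring ?R"
    by (rule ringI[OF ag monoid]) (auto simp: simps algebra_simps sum.distrib)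
  moreover have "Module.module (class_ring :: 'k ring) ?R"
    by (rule moduleI[OF _ ag]) (auto simp: class_cring.cring_axioms simps closed algebra_simps)
  moreover have "assoc_algebra_axioms ?R"
    by unfold_locales (auto simp: simps sum_distrib_left mult_ac intro!: sum.cong)
  ultimately show ?thesis by (intro assoc_algebra.intro)
qed

section \<open>Powers of the arrow ideal\<close>

lemma path_elem_closed: "p \<in> paths G \<Longrightarrow> path_elem p \<in> carrier (path_algebra G)"
  by (simp add: path_algebra_carrier path_elem_def)

lemma path_elem_mult_append:
  assumes "(v, xs @ ys) \<in> paths G"
  shows "path_elem (v, xs) \<otimes>\<^bsub>path_algebra G\<^esub> path_elem (path_target G (v, xs), ys)
    = (path_elem (v, xs @ ys) :: _ \<Rightarrow> 'k :: field)"
proof (rule ext, clarify)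
  fix w and zs :: "'b list"
  have "(path_elem (v, xs) \<otimes>\<^bsub>path_algebra G\<^esub> path_elem (path_target G (v, xs), ys)) (w, zs)
    = (\<Sum>k\<le>length zs. if k = length xs then (if (w, zs) = (v, xs @ ys) then 1 else 0) else (0 :: 'k))"
    unfolding path_algebra_mult
  proof (intro sum.cong refl)
    fix k assume "k \<in> {..length zs}"
    then have k: "k \<le> length zs" by simp
    show "path_elem (v, xs) (w, take k zs)
        * path_elem (path_target G (v, xs), ys) (path_target G (w, take k zs), drop k zs)
      = (if k = length xs then if (w, zs) = (v, xs @ ys) then 1 else 0 else (0 :: 'k))"
    proof (cases "w = v \<and> take k zs = xs")
      case True
      then have tk: "take k zs = xs" by simp
      from arg_cong[OF tk, of length] have "k = length xs" using k by simp
      have "zs = xs @ drop k zs" unfolding tk[symmetric] by (rule append_take_drop_id[symmetric])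
      then have "zs = xs @ ys \<longleftrightarrow> drop k zs = ys" using same_append_eq[of xs "drop k zs" ys] by simp
      then show ?thesis using True \<open>k = length xs\<close> by (simp add: path_elem_def)
    next
      case False
      then have "k = length xs \<Longrightarrow> (w, zs) \<noteq> (v, xs @ ys)" by fastforce
      moreover have "path_elem (v, xs) (w, take k zs) = (0 :: 'k)"
        using False unfolding path_elem_def by (intro if_not_P) blast
      ultimately show ?thesis by (simp only: mult_zero_left if_False if_cancel split: if_split) blast
    qed
  qed
  also have "\<dots> = path_elem (v, xs @ ys) (w, zs)" by (auto simp: path_elem_def)
  finally show "(path_elem (v, xs) \<otimes>\<^bsub>path_algebra G\<^esub> path_elem (path_target G (v, xs), ys)) (w, zs)
    = (path_elem (v, xs @ ys) (w, zs) :: 'k)" .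
qed

text \<open>A concatenation is at least as long as each of its factors, so the right-hand side is a
  two-sided ideal. Conversely, a path of length at least \<open>n\<close> is its initial segment of
  length \<open>n\<close> times the rest, and an element of the right-hand side is a finite
  combination of such paths.\<close>

lemma arrow_ideal_power_eq:
  "arrow_ideal_power G n = {f \<in> carrier (path_algebra G). \<forall>p. path_length p < n \<longrightarrow> f p = (0 :: 'k :: field)}"
  (is "_ = ?I")
proof -
  interpret R: assoc_algebra "path_algebra G :: ('k, ('a, 'b) path \<Rightarrow> 'k) module"
    by (rule assoc_algebra_path_algebra)
  let ?R = "path_algebra G :: ('k, ('a, 'b) path \<Rightarrow> 'k) module"
  let ?S = "path_elem ` {p \<in> paths G. path_length p = n} :: (('a, 'b) path \<Rightarrow> 'k) set"
  have "left_ideal ?I ?R"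
    by (rule R.left_idealI)
      (auto simp: path_algebra_add path_algebra_zero path_algebra_mult path_algebra_add_closed
        path_algebra_mult_closed R.zero_closed[unfolded path_algebra_zero] intro!: sum.neutral)
  then have "ideal ?I ?R"
    by (intro idealI R.ring_axioms)
      (auto simp: left_ideal_def additive_subgroup_def path_algebra_mult
        path_algebra_mult_closed intro!: sum.neutral)
  moreover have "?S \<subseteq> ?I" by (auto simp: path_elem_closed) (auto simp: path_elem_def)
  moreover have "f \<in> J" if J: "ideal J ?R" "?S \<subseteq> J" and f: "f \<in> ?I" for f J
  proof -
    interpret J: ideal J ?R by (rule J)
    have long: "(path_elem (v, xs) :: _ \<Rightarrow> 'k) \<in> J" if p: "(v, xs) \<in> paths G" "n \<le> length xs" for v xs
    proof -
      let ?xs = "take n xs" and ?ys = "drop n xs"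
      have "(v, ?xs) \<in> paths G" "(path_target G (v, ?xs), ?ys) \<in> paths G"
        using paths_append_iff[of v ?xs ?ys] p by auto
      then have "(path_elem (v, ?xs) :: _ \<Rightarrow> 'k) \<in> J" 
        "path_elem (path_target G (v, ?xs), ?ys) \<in> carrier ?R"
        using J(2) p by (auto simp: path_elem_closed)
      from J.I_r_closed[OF this]
      have "path_elem (v, ?xs) \<otimes>\<^bsub>?R\<^esub> path_elem (path_target G (v, ?xs), ?ys) \<in> J" .
      moreover have "path_elem (v, ?xs) \<otimes>\<^bsub>?R\<^esub> path_elem (path_target G (v, ?xs), ?ys)
          = (path_elem (v, xs) :: _ \<Rightarrow> 'k)"
        using path_elem_mult_append[of v ?xs ?ys] p by simp
      ultimately show ?thesis by simp
    qed
    \<comment> \<open>Induction on a finite set containing the support, with \<open>f\<close>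
      arbitrary: the multiple of the path \<open>p\<close> is subtracted before the induction
      hypothesis is applied and added again afterwards.\<close>
    have "finite S \<Longrightarrow> f \<in> ?I \<Longrightarrow> {p. f p \<noteq> 0} \<subseteq> S \<Longrightarrow> f \<in> J" for S f
    proof (induction S arbitrary: f rule: finite_induct)
      case empty
      then have "f = \<zero>\<^bsub>?R\<^esub>" by (auto simp: path_algebra_zero)
      then show ?case by simp
    next
      case (insert p S)
      show ?case
      proof (cases "f p = 0")
        case True
        then show ?thesis using insert.prems insert.IH by blast
      next
        case False
        then have "\<not> path_length p < n" using insert.prems by blast
        then have p: "p \<in> paths G" "n \<le> path_length p"
          using insert.prems False by (auto simp: path_algebra_carrier)
        let ?g = "\<lambda>q. - f p * path_elem p q" and ?e = "path_elem p :: _ \<Rightarrow> 'k"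
        have e: "?e \<in> carrier ?R" "?e \<in> J" using long[of "fst p" "snd p"] p by (auto simp: path_elem_closed)
        have "(\<lambda>q. f q + ?g q) \<in> ?I"
          using insert.prems p path_algebra_add_closed[OF _ path_algebra_smult_closed[OF e(1)], of f "- f p"]
          by (auto simp: path_elem_def)
        moreover have "{q. f q + ?g q \<noteq> 0} \<subseteq> S"
          using insert.prems by (auto simp: path_elem_def)
        ultimately have "(\<lambda>q. f q + ?g q) \<in> J" using insert.IH by blast
        moreover have "f p \<odot>\<^bsub>?R\<^esub> ?e \<in> J"
          using J.I_l_closed[OF e(2)] R.smult_eq_mult[OF e(1)] by simp
        ultimately have "(\<lambda>q. f q + ?g q) \<oplus>\<^bsub>?R\<^esub> f p \<odot>\<^bsub>?R\<^esub> ?e \<in> J" by (rule J.a_closed)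
        then show ?thesis by (simp add: path_algebra_add path_algebra_smult)
      qed
    qed
    from this[OF _ f order_refl] show ?thesis using f by (auto simp: path_algebra_carrier)
  qed
  ultimately show ?thesis unfolding arrow_ideal_power_def genideal_def by blast
qed


text \<open>The coset of \<open>f\<close> modulo the \<open>n\<close>-th power of the arrow ideal,
  described by the coefficients at short paths that its members share.\<close>

definition truncated_class :: "nat \<Rightarrow> (('a, 'b) path \<Rightarrow> 'k) \<Rightarrow> ('a, 'b, 'k :: field) path_class" where
  "truncated_class n f = {g \<in> carrier (path_algebra G). \<forall>p. path_length p < n \<longrightarrow> g p = f p}"

lemma path_algebra_coset:
  fixes f :: "('a, 'b) path \<Rightarrow> 'k :: field"
  assumes f: "f \<in> carrier (path_algebra G)"
  shows "arrow_ideal_power G n +>\<^bsub>path_algebra G\<^esub> f = truncated_class n f"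
proof -
  have "\<exists>h\<in>arrow_ideal_power G n. g = (\<lambda>p. h p + f p)" if "g \<in> truncated_class n f" for g
    using that path_algebra_add_closed[OF _ path_algebra_smult_closed[OF f], of g "-1"]
    by (intro bexI[of _ "\<lambda>p. g p + -1 * f p"]) (auto simp: arrow_ideal_power_eq truncated_class_def)
  then show ?thesis
    by (auto simp: a_r_coset_def' path_algebra_add arrow_ideal_power_eq truncated_class_def
        path_algebra_add_closed f)
qed

lemma truncated_class_eq_iff:
  assumes "f \<in> carrier (path_algebra G)" "g \<in> carrier (path_algebra G)"
  shows "truncated_class n f = truncated_class n g \<longleftrightarrow> (\<forall>p. path_length p < n \<longrightarrow> f p = g p)"
proof
  assume "truncated_class n f = truncated_class n g"
  moreover have "f \<in> truncated_class n f" using assms by (simp add: truncated_class_def)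
  ultimately have "f \<in> truncated_class n g" by simp
  then show "\<forall>p. path_length p < n \<longrightarrow> f p = g p" by (simp add: truncated_class_def)
qed (auto simp: truncated_class_def)

lemma ideal_arrow_ideal_power:
  "ideal (arrow_ideal_power G n) (path_algebra G :: ('k :: field, ('a, 'b) path \<Rightarrow> 'k) module)"
proof -
  interpret R: assoc_algebra "path_algebra G :: ('k, ('a, 'b) path \<Rightarrow> 'k) module"
    by (rule assoc_algebra_path_algebra)
  show ?thesis unfolding arrow_ideal_power_def
    by (rule R.genideal_ideal) (auto simp: path_elem_closed)
qed

lemma carrier_truncated_algebra:
  "carrier (truncated_algebra G n) = truncated_class n ` carrier (path_algebra G)"
  by (auto simp: truncated_algebra_def quot_module_def FactRing_def A_RCOSETS_def' path_algebra_coset)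

lemma truncated_class_simps:
  fixes f g :: "('a, 'b) path \<Rightarrow> 'k :: field"
  assumes f: "f \<in> carrier (path_algebra G)" and g: "g \<in> carrier (path_algebra G)"
  shows truncated_class_add: "truncated_class n f \<oplus>\<^bsub>truncated_algebra G n\<^esub> truncated_class n g
      = truncated_class n (\<lambda>p. f p + g p)"
    and truncated_class_mult: "truncated_class n f \<otimes>\<^bsub>truncated_algebra G n\<^esub> truncated_class n g
      = truncated_class n (f \<otimes>\<^bsub>path_algebra G\<^esub> g)"
    and truncated_class_smult: "c \<odot>\<^bsub>truncated_algebra G n\<^esub> truncated_class n f
      = truncated_class n (\<lambda>p. c * f p)"
proof -
  interpret I: ideal "arrow_ideal_power G n" "path_algebra G :: ('k, ('a, 'b) path \<Rightarrow> 'k) module"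
    by (rule ideal_arrow_ideal_power)
  note coset = path_algebra_coset[of _ n]
  have "truncated_class n f \<oplus>\<^bsub>truncated_algebra G n\<^esub> truncated_class n g
    = arrow_ideal_power G n +>\<^bsub>path_algebra G\<^esub> (f \<oplus>\<^bsub>path_algebra G\<^esub> g)"
    using I.a_rcos_sum[OF f g] f g
    by (simp add: truncated_algebra_def quot_module_def FactRing_def coset)
  then show "truncated_class n f \<oplus>\<^bsub>truncated_algebra G n\<^esub> truncated_class n g
      = truncated_class n (\<lambda>p. f p + g p)"
    using f g by (simp add: path_algebra_add coset path_algebra_add_closed)
  have "truncated_class n f \<otimes>\<^bsub>truncated_algebra G n\<^esub> truncated_class n g
    = arrow_ideal_power G n +>\<^bsub>path_algebra G\<^esub> (f \<otimes>\<^bsub>path_algebra G\<^esub> g)"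
    using I.rcoset_mult_add[OF f g] f g
    by (simp add: truncated_algebra_def quot_module_def FactRing_def coset)
  then show "truncated_class n f \<otimes>\<^bsub>truncated_algebra G n\<^esub> truncated_class n g
      = truncated_class n (f \<otimes>\<^bsub>path_algebra G\<^esub> g)"
    using f g by (simp add: coset path_algebra_mult_closed)
  have "c \<odot>\<^bsub>truncated_algebra G n\<^esub> truncated_class n f
    = (\<Union>h\<in>truncated_class n f. arrow_ideal_power G n +>\<^bsub>path_algebra G\<^esub> (\<lambda>p. c * h p))"
    by (simp add: truncated_algebra_def quot_module_def path_algebra_smult)
  also have "\<dots> = (\<Union>h\<in>truncated_class n f. truncated_class n (\<lambda>p. c * f p))"
  proof (rule SUP_cong[OF refl])
    fix h assume "h \<in> truncated_class n f"
    then have h: "h \<in> carrier (path_algebra G)" "\<And>p. path_length p < n \<Longrightarrow> h p = f p"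
      by (auto simp: truncated_class_def)
    show "arrow_ideal_power G n +>\<^bsub>path_algebra G\<^esub> (\<lambda>p. c * h p) = truncated_class n (\<lambda>p. c * f p)"
      unfolding path_algebra_coset[OF path_algebra_smult_closed[OF h(1)]]
      using h f by (subst truncated_class_eq_iff) (auto simp: path_algebra_smult_closed)
  qed
  also have "\<dots> = truncated_class n (\<lambda>p. c * f p)"
    using f by (auto simp: truncated_class_def)
  finally show "c \<odot>\<^bsub>truncated_algebra G n\<^esub> truncated_class n f = truncated_class n (\<lambda>p. c * f p)" .
qed

lemma one_truncated_algebra:
  "\<one>\<^bsub>truncated_algebra G n\<^esub> = truncated_class n (\<one>\<^bsub>path_algebra G\<^esub>)"
  by (simp add: truncated_algebra_def quot_module_def FactRing_def path_algebra_coset path_algebra_one_closed)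

lemma path_class_eq: "p \<in> paths G \<Longrightarrow> path_class G n p = truncated_class n (path_elem p)"
  by (simp add: path_class_def path_algebra_coset path_elem_closed)

lemma dual_path_truncated_class:
  assumes "f \<in> carrier (path_algebra G)" "path_length p < n"
  shows "dual_path G n p (truncated_class n f) = f p"
proof -
  have "(THE c. \<forall>g\<in>truncated_class n f. g p = c) = f p"
  proof (rule the_equality)
    show "\<forall>g\<in>truncated_class n f. g p = f p" using assms unfolding truncated_class_def by blast
    fix c assume "\<forall>g\<in>truncated_class n f. g p = c"
    then show "c = f p" using assms by (auto simp: truncated_class_def)
  qed
  then show ?thesis using assms by (simp add: dual_path_def carrier_truncated_algebra)
qed

lemma assoc_algebra_truncated_algebra:
  "assoc_algebra (truncated_algebra G n :: ('k :: field, ('a, 'b, 'k) path_class) module)"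
  (is "assoc_algebra ?A")
proof -
  interpret R: assoc_algebra "path_algebra G :: ('k, ('a, 'b) path \<Rightarrow> 'k) module"
    by (rule assoc_algebra_path_algebra)
  interpret I: ideal "arrow_ideal_power G n" "path_algebra G :: ('k, ('a, 'b) path \<Rightarrow> 'k) module"
    by (rule ideal_arrow_ideal_power)
  have "ring (path_algebra G Quot arrow_ideal_power G n
    :: (('a, 'b, 'k) path_class, unit) ring_scheme)"
    by (rule I.quotient_is_ring)
  then have ring: "ring ?A"
    by (rule ring_cong) (simp_all add: truncated_algebra_def quot_module_def)
  then interpret A: ring ?A .
  note simps = carrier_truncated_algebra truncated_class_simps path_algebra_add_closed
    path_algebra_smult_closed path_algebra_mult_closed
  have "Module.module (class_ring :: 'k ring) ?A"
  proof (rule moduleI[OF class_cring.cring_axioms A.abelian_group_axioms])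
    fix X Y :: "('a, 'b, 'k) path_class" and c d :: 'k
    assume "X \<in> carrier ?A" "Y \<in> carrier ?A"
    then obtain f g where fg: "X = truncated_class n f" "Y = truncated_class n g"
      "f \<in> carrier (path_algebra G)" "g \<in> carrier (path_algebra G)"
      by (auto simp: carrier_truncated_algebra)
    note fg' = fg(3,4)[THEN path_algebra_smult_closed]
    show "c \<odot>\<^bsub>?A\<^esub> X \<in> carrier ?A" "\<one>\<^bsub>class_ring\<^esub> \<odot>\<^bsub>?A\<^esub> X = X"
      "(c \<oplus>\<^bsub>class_ring\<^esub> d) \<odot>\<^bsub>?A\<^esub> X = c \<odot>\<^bsub>?A\<^esub> X \<oplus>\<^bsub>?A\<^esub> d \<odot>\<^bsub>?A\<^esub> X"
      "c \<odot>\<^bsub>?A\<^esub> (X \<oplus>\<^bsub>?A\<^esub> Y) = c \<odot>\<^bsub>?A\<^esub> X \<oplus>\<^bsub>?A\<^esub> c \<odot>\<^bsub>?A\<^esub> Y"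
      "(c \<otimes>\<^bsub>class_ring\<^esub> d) \<odot>\<^bsub>?A\<^esub> X = c \<odot>\<^bsub>?A\<^esub> (d \<odot>\<^bsub>?A\<^esub> X)"
      unfolding fg using fg(3,4) fg' path_algebra_add_closed[OF fg(3,4)]
      by (simp_all add: truncated_class_simps carrier_truncated_algebra distrib_left distrib_right mult.assoc)
  qed
  moreover have "assoc_algebra_axioms ?A"
  proof
    fix X Y :: "('a, 'b, 'k) path_class" and c
    assume "X \<in> carrier ?A" "Y \<in> carrier ?A"
    then obtain f g where fg: "X = truncated_class n f" "Y = truncated_class n g"
      "f \<in> carrier (path_algebra G)" "g \<in> carrier (path_algebra G)"
      by (auto simp: carrier_truncated_algebra)
    show "(c \<odot>\<^bsub>?A\<^esub> X) \<otimes>\<^bsub>?A\<^esub> Y = c \<odot>\<^bsub>?A\<^esub> (X \<otimes>\<^bsub>?A\<^esub> Y)"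
      using fg R.smult_mult_left[OF fg(3,4), of c] by (simp add: simps path_algebra_smult)
    show "X \<otimes>\<^bsub>?A\<^esub> (c \<odot>\<^bsub>?A\<^esub> Y) = c \<odot>\<^bsub>?A\<^esub> (X \<otimes>\<^bsub>?A\<^esub> Y)"
      using fg R.smult_mult_right[OF fg(3,4), of c] by (simp add: simps path_algebra_smult)
  qed
  ultimately show ?thesis using ring by (intro assoc_algebra.intro)
qed

end

section \<open>Extensions of truncated algebras in cyclic coordinates\<close>

lemma idempotentD:
  assumes "idempotent R x"
  shows "x \<in> carrier R" "x \<otimes>\<^bsub>R\<^esub> x = x"
  using assms by (simp_all add: idempotent_def)

text \<open>The truncated algebra in coordinates: a path is given by its source \<open>v\<close> and
  its length \<open>l\<close>, and \<open>cf v l\<close> is the coefficient at it.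
  \<open>cf_mult\<close> is the convolution over all cuts of this path, while \<open>cf_eqI\<close>
  and \<open>cf_surj\<close> say that elements correspond to arbitrary families of coefficients.
  Cosets and lists of arrows are thereby out of sight until the cyclic quiver returns.\<close>

locale cyclic_truncated = assoc_algebra A for A :: "('k::field, 'b) module" (structure) +
  fixes s n :: nat and cf :: "nat \<Rightarrow> nat \<Rightarrow> 'b \<Rightarrow> 'k"
  assumes s_pos: "0 < s" and n_ge_2: "2 \<le> n"
    and cf_add: "v < s \<Longrightarrow> l < n \<Longrightarrow> x \<in> carrier A \<Longrightarrow> y \<in> carrier A \<Longrightarrow> cf v l (x \<oplus> y) = cf v l x + cf v l y"
    and cf_smult: "v < s \<Longrightarrow> l < n \<Longrightarrow> x \<in> carrier A \<Longrightarrow> cf v l (c \<odot> x) = c * cf v l x"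
    and cf_mult: "v < s \<Longrightarrow> l < n \<Longrightarrow> x \<in> carrier A \<Longrightarrow> y \<in> carrier A \<Longrightarrow>
      cf v l (x \<otimes> y) = (\<Sum>k\<le>l. cf v k x * cf ((v + k) mod s) (l - k) y)"
    and cf_one: "v < s \<Longrightarrow> l < n \<Longrightarrow> cf v l \<one> = (if l = 0 then 1 else 0)"
    and cf_eqI: "x \<in> carrier A \<Longrightarrow> y \<in> carrier A \<Longrightarrow>
      (\<And>v l. v < s \<Longrightarrow> l < n \<Longrightarrow> cf v l x = cf v l y) \<Longrightarrow> x = y"
    and cf_surj: "\<exists>x\<in>carrier A. \<forall>v<s. \<forall>l<n. cf v l x = g v l"
begin

lemma mod_s [simp]: "v mod s < s"
  using s_pos by simp

definition elt :: "(nat \<Rightarrow> nat \<Rightarrow> 'k) \<Rightarrow> 'b" where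
  "elt c = (SOME x. x \<in> carrier A \<and> (\<forall>v<s. \<forall>l<n. cf v l x = c v l))"

lemma elt_closed [simp]: "elt c \<in> carrier A"
  and cf_elt [simp]: "v < s \<Longrightarrow> l < n \<Longrightarrow> cf v l (elt c) = c v l"
proof -
  have "elt c \<in> carrier A \<and> (\<forall>v<s. \<forall>l<n. cf v l (elt c) = c v l)"
    unfolding elt_def by (rule someI_ex) (use cf_surj[of c] in blast)
  then show "elt c \<in> carrier A" "v < s \<Longrightarrow> l < n \<Longrightarrow> cf v l (elt c) = c v l" by auto
qed

definition bas :: "nat \<Rightarrow> nat \<Rightarrow> 'b" where
  "bas v l = elt (\<lambda>w k. if w = v \<and> k = l then 1 else 0)"

definition arrow_sum :: 'b where
  "arrow_sum = elt (\<lambda>w k. if k = Suc 0 then 1 else 0)"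

lemma bas_closed [simp]: "bas v l \<in> carrier A"
  and cf_bas [simp]: "w < s \<Longrightarrow> k < n \<Longrightarrow> cf w k (bas v l) = (if w = v \<and> k = l then 1 else 0)"
  by (simp_all add: bas_def)

lemma arrow_sum_closed [simp]: "arrow_sum \<in> carrier A"
  and cf_arrow_sum [simp]: "w < s \<Longrightarrow> k < n \<Longrightarrow> cf w k arrow_sum = (if k = Suc 0 then 1 else 0)"
  by (simp_all add: arrow_sum_def)

lemma cf_zero [simp]: "v < s \<Longrightarrow> l < n \<Longrightarrow> cf v l \<zero> = 0"
  using cf_smult[of v l \<zero> 0] by simp

lemma cf_bas_mult:
  assumes "w < s" "k < n" "v < s" "l < n" "a \<in> carrier A"
  shows "cf w k (bas v l \<otimes> a) = (if w = v \<and> l \<le> k then cf ((v + l) mod s) (k - l) a else 0)"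
proof -
  have "cf w k (bas v l \<otimes> a)
    = (\<Sum>j\<le>k. if j = l then (if w = v then cf ((v + l) mod s) (k - l) a else 0) else 0)"
    unfolding cf_mult[OF assms(1,2) bas_closed assms(5)] by (rule sum.cong) (use assms in auto)
  then show ?thesis by (simp add: sum.delta)
qed

lemma cf_mult_bas:
  assumes "w < s" "k < n" "v < s" "l < n" "a \<in> carrier A"
  shows "cf w k (a \<otimes> bas v l) = (if l \<le> k \<and> (w + (k - l)) mod s = v then cf w (k - l) a else 0)"
proof -
  have "cf w k (a \<otimes> bas v l)
    = (\<Sum>j\<le>k. if j = k - l then (if l \<le> k \<and> (w + (k - l)) mod s = v then cf w (k - l) a else 0) else 0)"
    unfolding cf_mult[OF assms(1,2,5) bas_closed]
  proof (rule sum.cong[OF refl])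
    fix j assume "j \<in> {..k}"
    then have "j \<le> k" by simp
    then have j: "k - j = l \<longleftrightarrow> j = k - l \<and> l \<le> k" "k - j < n" using assms(2) by arith+
    show "cf w j a * cf ((w + j) mod s) (k - j) (bas v l)
      = (if j = k - l then (if l \<le> k \<and> (w + (k - l)) mod s = v then cf w (k - l) a else 0) else 0)"
      unfolding cf_bas[OF mod_s j(2)] j(1) by (cases "j = k - l"; cases "l \<le> k") simp_all
  qed
  then show ?thesis by (simp add: sum.delta)
qed

lemma bas_mult_bas_0:
  assumes "v < s" "l < n" "i < s"
  shows "bas v l \<otimes> bas i 0 = (if (v + l) mod s = i then bas v l else \<zero>)"
  using assms n_ge_2 by (intro cf_eqI) (auto simp: cf_mult_bas)

lemma bas_0_mult_bas:
  assumes "v < s" "l < n" "j < s"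
  shows "bas j 0 \<otimes> bas v l = (if v = j then bas v l else \<zero>)"
  using assms n_ge_2 by (intro cf_eqI) (auto simp: cf_bas_mult)

text \<open>Exactly one summand of \<open>arrow_sum\<close> continues the path, so the product is
  the path prolonged by one arrow.\<close>

lemma bas_mult_arrow_sum:
  assumes "v < s" "l < n"
  shows "bas v l \<otimes> arrow_sum = (if Suc l < n then bas v (Suc l) else \<zero>)"
  using assms by (intro cf_eqI) (auto simp: cf_bas_mult)

lemma cf_arrow_sum_mult:
  assumes "v < s" "k < n" "b \<in> carrier A"
  shows "cf v k (arrow_sum \<otimes> b) = (if k = 0 then 0 else cf (Suc v mod s) (k - 1) b)"
proof -
  have "cf v k (arrow_sum \<otimes> b)
    = (\<Sum>j\<le>k. if j = 1 then cf (Suc v mod s) (k - 1) b else 0)"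
    unfolding cf_mult[OF assms(1,2) arrow_sum_closed assms(3)] by (rule sum.cong) (use assms in auto)
  then show ?thesis by (simp add: sum.delta)
qed

text \<open>Concatenating a path of length \<open>n - 1\<close> with a path of positive length gives
  length at least \<open>n\<close>.\<close>

lemma top_mult_radical:
  assumes "v < s" "a \<in> carrier A" "\<And>v. v < s \<Longrightarrow> cf v 0 a = 0"
  shows "bas v (n - Suc 0) \<otimes> a = \<zero>" "a \<otimes> bas v (n - Suc 0) = \<zero>"
  using assms n_ge_2 by (auto intro!: cf_eqI simp: cf_bas_mult cf_mult_bas)

lemma cf_pow_radical:
  fixes k :: nat
  assumes a: "a \<in> carrier A" "\<And>v. v < s \<Longrightarrow> cf v 0 a = 0"
  shows "v < s \<Longrightarrow> l < n \<Longrightarrow> l < k \<Longrightarrow> cf v l (a [^] k) = 0"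
proof (induction k arbitrary: v l)
  case (Suc k)
  \<comment> \<open>If \<open>j \<ge> k\<close>, then \<open>j \<le> l < Suc k\<close> leaves only
    \<open>j = l = k\<close>, and the second factor is a coefficient at a trivial path.\<close>
  have "cf v j (a [^] k) * cf ((v + j) mod s) (l - j) a = 0" if "j \<le> l" for j
  proof (cases "j < k")
    case True
    then show ?thesis using Suc that by simp
  next
    case False
    then show ?thesis using Suc.prems that a(2)[of "(v + j) mod s"] by simp
  qed
  then have "(\<Sum>j\<le>l. cf v j (a [^] k) * cf ((v + j) mod s) (l - j) a) = 0"
    by (intro sum.neutral) blast
  then show ?case using Suc.prems a(1) cf_mult[of v l "a [^] k" a] by simp
qed simp

lemma dual_finsum:
  assumes "\<phi> \<in> carrier (dual A)" "finite I" "g \<in> I \<rightarrow> carrier A"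
  shows "\<phi> (finsum A g I) = (\<Sum>i\<in>I. \<phi> (g i))"
  using assms(2,3)
  by (induction I) (auto simp: dual_apply_zero dual_apply_add assms(1) Pi_def)

lemma cf_dual: "v < s \<Longrightarrow> l < n \<Longrightarrow> (\<lambda>x\<in>carrier A. cf v l x) \<in> carrier (dual A)"
  by (rule dualI) (simp_all add: cf_add cf_smult)

lemma expansion:
  assumes x: "x \<in> carrier A"
  shows "x = (\<Oplus>i\<in>{..<s} \<times> {..<n}. cf (fst i) (snd i) x \<odot> bas (fst i) (snd i))"
    (is "x = finsum A ?g ?I")
proof (rule cf_eqI[OF x])
  have g: "?g \<in> ?I \<rightarrow> carrier A" by auto
  show fc: "finsum A ?g ?I \<in> carrier A" using g by (rule finsum_closed)
  fix v l assume vl: "v < s" "l < n"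
  have "cf v l (finsum A ?g ?I) = (\<Sum>i\<in>?I. cf v l (?g i))"
    using dual_finsum[OF cf_dual[OF vl] _ g] fc by simp
  also have "\<dots> = (\<Sum>i\<in>?I. if i = (v, l) then cf v l x else 0)"
    using vl by (intro sum.cong) (auto simp: cf_smult)
  finally show "cf v l x = cf v l (finsum A ?g ?I)" using vl by simp
qed

lemma dual_basis_eqI:
  assumes \<phi>: "\<phi> \<in> carrier (dual A)" and \<psi>: "\<psi> \<in> carrier (dual A)"
    and eq: "\<And>v l. v < s \<Longrightarrow> l < n \<Longrightarrow> \<phi> (bas v l) = \<psi> (bas v l)"
  shows "\<phi> = \<psi>"
proof (rule dual_eqI[OF \<phi> \<psi>])
  fix x assume x: "x \<in> carrier A"
  let ?I = "{..<s} \<times> {..<n}" and ?g = "\<lambda>i. cf (fst i) (snd i) x \<odot> bas (fst i) (snd i)"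
  have "\<phi> (finsum A ?g ?I) = \<psi> (finsum A ?g ?I)"
    by (subst (1 2) dual_finsum) (auto simp: \<phi> \<psi> eq dual_apply_smult intro!: sum.cong)
  then show "\<phi> x = \<psi> x" using expansion[OF x] by simp
qed

definition functional :: "(nat \<Rightarrow> nat \<Rightarrow> 'k) \<Rightarrow> 'b \<Rightarrow> 'k" where
  "functional g = (\<lambda>x\<in>carrier A. \<Sum>v<s. \<Sum>l<n. cf v l x * g v l)"

lemma functional_closed [simp]: "functional g \<in> carrier (dual A)"
  by (rule dualI)
    (simp_all add: functional_def cf_add cf_smult distrib_right sum.distrib sum_distrib_left mult.assoc)

lemma functional_bas [simp]: "v < s \<Longrightarrow> l < n \<Longrightarrow> functional g (bas v l) = g v l"
proof -
  assume vl: "v < s" "l < n"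
  have "functional g (bas v l) = (\<Sum>w<s. \<Sum>k<n. if k = l then (if w = v then g v l else 0) else 0)"
    unfolding functional_def using bas_closed[of v l]
    by (simp only: restrict_apply if_True) (intro sum.cong refl, use vl in auto)
  then show ?thesis using vl by simp
qed

end

text \<open>
  In the coordinates \<open>(fst z, tw z)\<close>, see \<open>tw\<close> below, the coboundary of \<open>f\<close> disappears from the
  multiplication of \<open>T\<close>.
\<close>

locale twisted_extension = cyclic_truncated A s n cf
  for A :: "('k::field, 'b) module" (structure) and s n cf +
  fixes \<alpha> \<theta> :: "'b \<Rightarrow> 'b \<Rightarrow> 'b \<Rightarrow> 'k" and f :: "'b \<Rightarrow> 'b \<Rightarrow> 'k"
  assumes cocycle: "two_cocycle A \<alpha>" and f_hom: "f \<in> module_hom class_ring A (dual A)"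
    and \<alpha>_eq: "a \<in> carrier A \<Longrightarrow> b \<in> carrier A \<Longrightarrow> d \<in> carrier A \<Longrightarrow>
      \<alpha> a b d = \<theta> a b d + coboundary A f a b d"
begin

abbreviation T :: "('k, 'b \<times> ('b \<Rightarrow> 'k)) module" where
  "T \<equiv> hochschild_extension A \<alpha>"

sublocale T: assoc_algebra T
  by (rule assoc_algebra_hochschild_extension[OF cocycle])

definition tw :: "'b \<times> ('b \<Rightarrow> 'k) \<Rightarrow> 'b \<Rightarrow> 'k" where
  "tw z = snd z \<oplus>\<^bsub>dual A\<^esub> f (fst z)"

text \<open>The element of \<open>T\<close> with coordinates \<open>a\<close> and \<phi>:
  subtracting \<open>f a\<close> undoes the shift made by \<open>tw\<close>.\<close>

definition mk :: "'b \<Rightarrow> ('b \<Rightarrow> 'k) \<Rightarrow> 'b \<times> ('b \<Rightarrow> 'k)" where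
  "mk a \<phi> = (a, \<phi> \<ominus>\<^bsub>dual A\<^esub> f a)"

lemmas f_closed [simp] = module_hom_dual_closed[OF f_hom]

lemma fst_closed [simp]: "z \<in> carrier T \<Longrightarrow> fst z \<in> carrier A"
  and snd_closed [simp]: "z \<in> carrier T \<Longrightarrow> snd z \<in> carrier (dual A)"
  by (auto simp: hochschild_carrier)

lemma tw_closed [simp]: "z \<in> carrier T \<Longrightarrow> tw z \<in> carrier (dual A)"
  by (simp add: tw_def)

lemma mk_closed [simp]: "a \<in> carrier A \<Longrightarrow> \<phi> \<in> carrier (dual A) \<Longrightarrow> mk a \<phi> \<in> carrier T"
  and fst_mk [simp]: "fst (mk a \<phi>) = a"
  by (auto simp: mk_def hochschild_carrier)

lemma tw_mk [simp]: "a \<in> carrier A \<Longrightarrow> \<phi> \<in> carrier (dual A) \<Longrightarrow> tw (mk a \<phi>) = \<phi>"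
  by (rule dual_eqI) (auto simp: mk_def tw_def add_dual_apply minus_dual_apply)

lemma fst_add: "z \<in> carrier T \<Longrightarrow> z' \<in> carrier T \<Longrightarrow> fst (z \<oplus>\<^bsub>T\<^esub> z') = fst z \<oplus> fst z'"
  and fst_mult: "z \<in> carrier T \<Longrightarrow> z' \<in> carrier T \<Longrightarrow> fst (z \<otimes>\<^bsub>T\<^esub> z') = fst z \<otimes> fst z'"
  and fst_smult: "z \<in> carrier T \<Longrightarrow> fst (c \<odot>\<^bsub>T\<^esub> z) = c \<odot> fst z"
  and fst_one: "fst \<one>\<^bsub>T\<^esub> = \<one>"
  by (cases z; cases z'; simp add: hochschild_simps)+

lemma tw_add:
  "z \<in> carrier T \<Longrightarrow> z' \<in> carrier T \<Longrightarrow> d \<in> carrier A \<Longrightarrow> tw (z \<oplus>\<^bsub>T\<^esub> z') d = tw z d + tw z' d"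
  by (cases z; cases z')
    (auto simp: tw_def hochschild_simps add_dual_apply module_hom_dual_add[OF f_hom])

lemma tw_smult: "z \<in> carrier T \<Longrightarrow> d \<in> carrier A \<Longrightarrow> tw (c \<odot>\<^bsub>T\<^esub> z) d = c * tw z d"
  by (cases z)
    (auto simp: tw_def hochschild_simps dual_applies module_hom_dual_smult[OF f_hom] algebra_simps)

text \<open>The summand \<open>f (a b)\<close> that \<open>tw\<close> adds to the product cancels
  the negative summand of the coboundary. The two remaining summands of the coboundary complete the
  bimodule parts of the factors to \<open>tw z\<close> and \<open>tw z'\<close>.\<close>

lemma tw_mult:
  "z \<in> carrier T \<Longrightarrow> z' \<in> carrier T \<Longrightarrow> d \<in> carrier A \<Longrightarrow>
    tw (z \<otimes>\<^bsub>T\<^esub> z') d = tw z' (d \<otimes> fst z) + tw z (fst z' \<otimes> d) + \<theta> (fst z) (fst z') d"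
  by (cases z; cases z')
    (auto simp: tw_def hochschild_simps dual_applies \<alpha>_eq coboundary_apply[OF f_hom]
      two_cocycle_closed[OF cocycle])

lemma T_eqI:
  assumes z: "z \<in> carrier T" "z' \<in> carrier T" and eq: "fst z = fst z'"
    and tw: "\<And>v l. v < s \<Longrightarrow> l < n \<Longrightarrow> tw z (bas v l) = tw z' (bas v l)"
  shows "z = z'"
proof -
  have "tw z = tw z'" by (rule dual_basis_eqI) (simp_all add: z tw)
  have "snd z d = snd z' d" if "d \<in> carrier A" for d
    using arg_cong[OF \<open>tw z = tw z'\<close>, of "\<lambda>\<phi>. \<phi> d"] that z by (simp add: tw_def add_dual_apply eq)
  then have "snd z = snd z'" by (intro dual_eqI) (simp_all add: z)
  then show ?thesis using eq by (rule prod_eqI[rotated])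
qed

section \<open>The radical of the extension and its square\<close>

definition N :: "('b \<times> ('b \<Rightarrow> 'k)) set" where
  "N = {z \<in> carrier T. \<forall>v\<in>{..<s}. cf v 0 (fst z) = 0}"

lemma n_pos: "0 < n" and one_less_n: "Suc 0 < n"
  using n_ge_2 by simp_all

text \<open>The \<open>n\<close>-th power has zero component in \<open>A\<close>. The bimodule part
  has square zero in \<open>T\<close>, since \<alpha> vanishes at a pair of zeros.\<close>

lemma N_nilpotent:
  assumes "z \<in> N"
  shows "\<exists>k::nat. z [^]\<^bsub>T\<^esub> k = \<zero>\<^bsub>T\<^esub>"
proof -
  have z: "z \<in> carrier T" "\<And>v. v < s \<Longrightarrow> cf v 0 (fst z) = 0" using assms by (auto simp: N_def)
  have "fst (z [^]\<^bsub>T\<^esub> k) = fst z [^] k" for k :: nat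
    by (induction k) (simp_all add: fst_one fst_mult z)
  moreover have "fst z [^] n = \<zero>"
    using z by (intro cf_eqI) (simp_all add: cf_pow_radical)
  ultimately obtain x where x: "z [^]\<^bsub>T\<^esub> n = (\<zero>, x)" by (metis prod.collapse)
  have "x \<in> carrier (dual A)" using T.nat_pow_closed[OF z(1), of n] by (simp add: x hochschild_carrier)
  moreover have "\<alpha> \<zero> \<zero> d = 0" if "d \<in> carrier A" for d
    using two_cocycle_apply_smult_left[OF cocycle zero_closed zero_closed zero_closed that, of 0] by simp
  ultimately have "(\<zero>, x) \<otimes>\<^bsub>T\<^esub> (\<zero>, x) = \<zero>\<^bsub>T\<^esub>"
    by (auto simp: hochschild_simps dual_applies dual_apply_zero two_cocycle_closed[OF cocycle] intro!: dual_eqI)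
  then have "z [^]\<^bsub>T\<^esub> (n + n) = \<zero>\<^bsub>T\<^esub>"
    using z(1) x by (simp flip: T.nat_pow_mult)
  then show ?thesis by blast
qed

lemma jacobson_radical_T: "jacobson_radical T = N"
  by (rule T.jacobson_radical_eqI[where \<chi> = "\<lambda>v z. cf v 0 (fst z)", OF _ _ _ _ N_def N_nilpotent])
    (simp_all add: fst_add fst_smult fst_mult fst_one cf_add cf_smult cf_mult cf_one n_pos)

lemma ideal_N: "ideal N T"
  unfolding N_def
  by (rule T.ideal_jacobson_kernel)
    (simp_all add: fst_add fst_smult fst_mult cf_add cf_smult cf_mult n_pos)

lemma ND: 
  assumes "z \<in> N"
  shows "z \<in> carrier T" "v < s \<Longrightarrow> cf v 0 (fst z) = 0"
  using assms by (auto simp: N_def)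

text \<open>An arrow can only be cut before or after itself, and either cut produces a coefficient
  at a trivial path, which is zero in the radical.\<close>

lemma cf_1_ideal_prod: "z \<in> ideal_prod T N N \<Longrightarrow> z \<in> carrier T \<and> (\<forall>v<s. cf v 0 (fst z) = 0 \<and> cf v (Suc 0) (fst z) = 0)"
proof (induction rule: ideal_prod.induct)
  case (prod i j)
  then show ?case using ND[OF prod(1)] ND[OF prod(2)] one_less_n
    by (auto simp: fst_mult cf_mult)
next
  case (sum s1 s2)
  then show ?case using one_less_n by (simp add: fst_add cf_add)
qed

lemma ideal_prod_subset_N: "z \<in> ideal_prod T N N \<Longrightarrow> z \<in> N"
  using cf_1_ideal_prod[of z] by (simp add: N_def)

text \<open>In \<open>tw_mult\<close> the first two summands are evaluated at a product of a longest
  path with a radical element, which is zero. Only \<theta> remains, and it vanishes by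
  assumption.\<close>

lemma tw_ideal_prod:
  assumes top: "\<And>a b v. a \<in> carrier A \<Longrightarrow> b \<in> carrier A \<Longrightarrow> v < s \<Longrightarrow> \<theta> a b (bas v (n - Suc 0)) = 0"
  shows "z \<in> ideal_prod T N N \<Longrightarrow> z \<in> carrier T \<and> (\<forall>v<s. tw z (bas v (n - Suc 0)) = 0)"
proof (induction rule: ideal_prod.induct)
  case (prod i j)
  then show ?case using ND[OF prod(1)] ND[OF prod(2)]
    by (auto simp: tw_mult top top_mult_radical dual_apply_zero)
next
  case (sum s1 s2)
  then show ?case by (simp add: tw_add)
qed

text \<open>
  The element \<open>z\<close> is the product of the sum of all arrows and an element \<open>(b, y)\<close> of the radical.
  The bimodule part of such a product vanishes at the longest paths, so that the coefficients \<open>t\<close> of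
  \<open>b\<close> at the longest paths have to produce the values of \<open>tw z\<close> there through \<open>\<theta>\<close>.
\<close>

lemma in_ideal_prod:
  assumes z: "z \<in> N" "\<And>v. v < s \<Longrightarrow> cf v (Suc 0) (fst z) = 0"
    and t: "\<And>b v. b \<in> carrier A \<Longrightarrow> (\<And>w. w < s \<Longrightarrow> cf w 0 b = 0) \<Longrightarrow>
      (\<And>w. w < s \<Longrightarrow> cf w (n - Suc 0) b = t w) \<Longrightarrow> v < s \<Longrightarrow>
      \<theta> arrow_sum b (bas v (n - Suc 0)) = tw z (bas v (n - Suc 0))"
  shows "z \<in> ideal_prod T N N"
proof -
  note zc = ND[OF z(1)]
  \<comment> \<open>Multiplication with \<open>arrow_sum\<close> from the left moves the coefficient
    at source \<open>w\<close> and length \<open>k\<close> to source \<open>w - 1\<close> and length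
    \<open>k + 1\<close>; this dictates \<open>b\<close>, with \<open>w + (s - 1)\<close> in place
    of \<open>w - 1\<close> to stay in the naturals. Coefficients at length \<open>n - 1\<close> are
    lost in the product, so \<open>t\<close> can be prescribed there. Zero at length
    \<open>0\<close> puts \<open>b\<close> into the radical and agrees with the missing arrow
    coefficients of \<open>z\<close>.\<close>
  define b where "b = elt (\<lambda>w k. if k = 0 then 0 else if k = n - Suc 0 then t w
    else cf ((w + (s - 1)) mod s) (Suc k) (fst z))"
  have b: "b \<in> carrier A" "\<And>w. w < s \<Longrightarrow> cf w 0 b = 0" "\<And>w. w < s \<Longrightarrow> cf w (n - Suc 0) b = t w"
    using n_ge_2 by (auto simp: b_def)
  \<comment> \<open>The product of \<open>bas v l\<close> and \<open>arrow_sum\<close> is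
    \<open>bas v (l + 1)\<close>, so the value of \<phi> at length \<open>l\<close> has to account
    for \<open>tw z\<close> at length \<open>l - 1\<close>. The value at length \<open>0\<close> is
    arbitrary.\<close>
  define \<phi> where "\<phi> = functional (\<lambda>v l. tw z (bas v (l - 1)) - \<theta> arrow_sum b (bas v (l - 1)))"
  have \<phi>: "\<phi> \<in> carrier (dual A)" by (simp add: \<phi>_def)
  let ?u = "mk arrow_sum \<zero>\<^bsub>dual A\<^esub>" and ?y = "mk b \<phi>"
  have u: "?u \<in> N" using n_pos by (simp add: N_def)
  have y: "?y \<in> N" using b \<phi> by (simp add: N_def)
  have "z = ?u \<otimes>\<^bsub>T\<^esub> ?y"
  proof (rule T_eqI)
    show "fst z = fst (?u \<otimes>\<^bsub>T\<^esub> ?y)"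
    proof (rule cf_eqI)
      fix v l assume vl: "v < s" "l < n"
      have pred: "(Suc v mod s + (s - 1)) mod s = v"
        using vl s_pos by (cases "Suc v = s") auto
      have "cf v l (arrow_sum \<otimes> b) = cf v l (fst z)"
      proof (cases "l \<le> 1")
        case True
        then have "l = 0 \<or> l = Suc 0" by auto
        then show ?thesis using vl b zc z(2)[of v] by (auto simp: cf_arrow_sum_mult)
      next
        case False
        then have "l - Suc 0 \<noteq> n - Suc 0" "Suc (l - Suc 0) = l" using vl by auto
        then have "cf (Suc v mod s) (l - Suc 0) b = cf v l (fst z)"
          using vl pred False by (simp add: b_def)
        then show ?thesis using vl b False by (simp add: cf_arrow_sum_mult)
      qed
      then show "cf v l (fst z) = cf v l (fst (?u \<otimes>\<^bsub>T\<^esub> ?y))"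
        using u y by (simp add: fst_mult ND)
    qed (use zc b \<phi> in \<open>simp_all add: fst_mult\<close>)
    fix v l assume vl: "v < s" "l < n"
    have "tw (?u \<otimes>\<^bsub>T\<^esub> ?y) (bas v l) = \<phi> (bas v l \<otimes> arrow_sum) + \<theta> arrow_sum b (bas v l)"
      using b \<phi> vl by (simp add: tw_mult zero_dual_apply)
    also have "\<dots> = tw z (bas v l)"
    proof (cases "Suc l < n")
      case True
      then show ?thesis using vl by (simp add: bas_mult_arrow_sum \<phi>_def)
    next
      case False
      then have "l = n - Suc 0" using vl by simp
      then show ?thesis using False vl \<phi> t[OF b] by (simp add: bas_mult_arrow_sum dual_apply_zero)
    qed
    finally show "tw z (bas v l) = tw (?u \<otimes>\<^bsub>T\<^esub> ?y) (bas v l)" by simp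
  qed (use zc b \<phi> in auto)
  then show ?thesis using ideal_prod.prod[OF u y] by simp
qed

section \<open>Corners and the ordinary quiver of the extension\<close>

lemma cf_1_corner:
  assumes x: "x \<in> carrier T" "fst x = bas i 0" "i < s" and y: "y \<in> carrier T" "fst y = bas j 0" "j < s"
    and z: "z \<in> N" and v: "v < s"
  shows "cf v (Suc 0) (fst (x \<otimes>\<^bsub>T\<^esub> z \<otimes>\<^bsub>T\<^esub> y)) = (if v = i \<and> Suc v mod s = j then cf v (Suc 0) (fst z) else 0)"
  using x y ND[OF z] v one_less_n n_pos
  by (auto simp: fst_mult cf_bas_mult cf_mult_bas)

text \<open>The value at \<open>d\<close> becomes the value of \<open>tw z\<close> at
  \<open>bas j 0\<close> times \<open>d\<close> times \<open>bas i 0\<close>. Hence source and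
  target are interchanged: the path has to start at \<open>j\<close> and end at \<open>i\<close>.
  The summands containing \<open>tw x\<close> and \<open>tw y\<close> are evaluated at a product of
  a longest path with a radical element and vanish.\<close>

lemma tw_corner:
  assumes top: "\<And>a b v. a \<in> carrier A \<Longrightarrow> b \<in> carrier A \<Longrightarrow> v < s \<Longrightarrow> \<theta> a b (bas v (n - Suc 0)) = 0"
    and x: "x \<in> carrier T" "fst x = bas i 0" "i < s" and y: "y \<in> carrier T" "fst y = bas j 0" "j < s"
    and z: "z \<in> N" and v: "v < s"
  shows "tw (x \<otimes>\<^bsub>T\<^esub> z \<otimes>\<^bsub>T\<^esub> y) (bas v (n - Suc 0))
    = (if (v + (n - Suc 0)) mod s = i \<and> v = j then tw z (bas v (n - Suc 0)) else 0)"
proof -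
  interpret N: ideal N T by (rule ideal_N)
  have xz: "x \<otimes>\<^bsub>T\<^esub> z \<in> N" using N.I_l_closed[OF z x(1)] .
  have "tw (x \<otimes>\<^bsub>T\<^esub> z \<otimes>\<^bsub>T\<^esub> y) (bas v (n - Suc 0)) = tw (x \<otimes>\<^bsub>T\<^esub> z) (bas j 0 \<otimes> bas v (n - Suc 0))"
    using x y v ND[OF xz] by (simp add: tw_mult top top_mult_radical dual_apply_zero)
  also have "\<dots> = (if v = j then tw (x \<otimes>\<^bsub>T\<^esub> z) (bas v (n - Suc 0)) else 0)"
    using v y ND[OF xz] n_pos by (simp add: bas_0_mult_bas dual_apply_zero)
  also have "tw (x \<otimes>\<^bsub>T\<^esub> z) (bas v (n - Suc 0)) = tw z (bas v (n - Suc 0) \<otimes> bas i 0)"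
    using x v ND[OF z] by (simp add: tw_mult top top_mult_radical dual_apply_zero)
  also have "\<dots> = (if (v + (n - Suc 0)) mod s = i then tw z (bas v (n - Suc 0)) else 0)"
    using v x ND[OF z] n_pos by (simp add: bas_mult_bas_0 dual_apply_zero)
  finally show ?thesis by simp
qed

text \<open>The index \<open>(False, v)\<close> stands for the arrow \<open>v\<close>, and
  \<open>(True, v)\<close> for the dual of the longest path starting at \<open>v\<close>, an arrow
  from the end of this path to \<open>v\<close>.\<close>

theorem ordinary_arrows_top_zero:
  assumes top: "\<And>a b v. a \<in> carrier A \<Longrightarrow> b \<in> carrier A \<Longrightarrow> v < s \<Longrightarrow> \<theta> a b (bas v (n - Suc 0)) = 0"
    and ei: "idempotent T (e i)" "fst (e i) = bas i 0" "i < s"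
    and ej: "idempotent T (e j)" "fst (e j) = bas j 0" "j < s"
  shows "ordinary_arrows T e i j = card {b \<in> (UNIV :: bool set) \<times> {..<s}.
    (if fst b then (snd b + (n - Suc 0)) mod s else snd b) = i \<and>
    (if fst b then snd b else Suc (snd b) mod s) = j}"
proof (rule T.ordinary_arrows_eq_card[OF jacobson_radical_T ideal_N,
      where h = "\<lambda>b z. if fst b then tw z (bas (snd b) (n - Suc 0)) else cf (snd b) (Suc 0) (fst z)"
        and d = "\<lambda>b. if fst b then mk \<zero> (functional (\<lambda>v l. if v = snd b \<and> l = n - Suc 0 then 1 else 0))
          else mk (bas (snd b) (Suc 0)) \<zero>\<^bsub>dual A\<^esub>"])
  let ?B = "(UNIV :: bool set) \<times> {..<s}"
  let ?h = "\<lambda>b z. if fst b then tw z (bas (snd b) (n - Suc 0)) else cf (snd b) (Suc 0) (fst z)"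
  note e = idempotentD[OF ei(1)] idempotentD[OF ej(1)]
  show "e i \<in> carrier T" "e i \<otimes>\<^bsub>T\<^esub> e i = e i" "e j \<in> carrier T" "e j \<otimes>\<^bsub>T\<^esub> e j = e j" by (fact e)+
  show "finite ?B" by simp
  show "ideal_prod T N N = {z \<in> N. \<forall>b\<in>?B. ?h b z = 0}"
  proof (intro equalityI subsetI CollectI conjI ballI)
    fix z b assume "z \<in> ideal_prod T N N" "b \<in> ?B"
    then show "?h b z = 0" using cf_1_ideal_prod[of z] tw_ideal_prod[OF top, of z] by auto
  next
    fix z assume z: "z \<in> {z \<in> N. \<forall>b\<in>?B. ?h b z = 0}"
    then have h: "?h (c, v) z = 0" if "v < s" for c v using that by blast
    show "z \<in> ideal_prod T N N"
      using z h[of _ True] h[of _ False] n_ge_2 by (intro in_ideal_prod[where t = "\<lambda>_. 0"]) (simp_all add: top)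
  qed (rule ideal_prod_subset_N)
  fix b assume b: "b \<in> ?B"
  show "(if fst b then mk \<zero> (functional (\<lambda>v l. if v = snd b \<and> l = n - Suc 0 then 1 else 0))
      else mk (bas (snd b) (Suc 0)) \<zero>\<^bsub>dual A\<^esub>) \<in> N"
    using b n_pos by (auto simp: N_def)
  fix b' assume b': "b' \<in> ?B"
  show "?h b' (if fst b then mk \<zero> (functional (\<lambda>v l. if v = snd b \<and> l = n - Suc 0 then 1 else 0))
      else mk (bas (snd b) (Suc 0)) \<zero>\<^bsub>dual A\<^esub>) = (if b' = b then 1 else 0)"
    using b b' n_pos one_less_n by (auto simp: prod_eq_iff zero_dual_apply)
next
  fix b z assume "b \<in> (UNIV :: bool set) \<times> {..<s}" "z \<in> N"
  then show "(if fst b then tw (e i \<otimes>\<^bsub>T\<^esub> z \<otimes>\<^bsub>T\<^esub> e j) (bas (snd b) (n - Suc 0))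
      else cf (snd b) (Suc 0) (fst (e i \<otimes>\<^bsub>T\<^esub> z \<otimes>\<^bsub>T\<^esub> e j)))
    = (if (if fst b then (snd b + (n - Suc 0)) mod s else snd b) = i \<and>
         (if fst b then snd b else Suc (snd b) mod s) = j
       then if fst b then tw z (bas (snd b) (n - Suc 0)) else cf (snd b) (Suc 0) (fst z) else 0)"
    using tw_corner[OF top, of "e i" i "e j" j z "snd b"] cf_1_corner[of "e i" i "e j" j z "snd b"]
      idempotentD[OF ei(1)] idempotentD[OF ej(1)] ei ej by auto
qed (use one_less_n in \<open>simp_all add: ND fst_add fst_smult cf_add cf_smult tw_add tw_smult mem_Times_iff\<close>)

text \<open>Paired with \<open>arrow_sum\<close>, \<theta> reads off the coefficients of
  \<open>b\<close> at the longest paths, up to the factor \<open>c\<close> and a rotation by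
  \<open>n\<close>. These coefficients are free, so every value of the bimodule part at the longest
  paths is attained in \<open>J^2\<close>, and only the arrows survive in the quotient.\<close>

theorem ordinary_arrows_top_nonzero:
  assumes top: "\<And>b v. b \<in> carrier A \<Longrightarrow> (\<And>w. w < s \<Longrightarrow> cf w 0 b = 0) \<Longrightarrow> v < s \<Longrightarrow>
      \<theta> arrow_sum b (bas v (n - Suc 0)) = c * cf ((v + n) mod s) (n - Suc 0) b"
    and c: "c \<noteq> 0"
    and ei: "idempotent T (e i)" "fst (e i) = bas i 0" "i < s"
    and ej: "idempotent T (e j)" "fst (e j) = bas j 0" "j < s"
  shows "ordinary_arrows T e i j = card {v \<in> {..<s}. v = i \<and> Suc v mod s = j}"
proof (rule T.ordinary_arrows_eq_card[OF jacobson_radical_T ideal_N,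
      where h = "\<lambda>v z. cf v (Suc 0) (fst z)" and d = "\<lambda>v. mk (bas v (Suc 0)) \<zero>\<^bsub>dual A\<^esub>"])
  note e = idempotentD[OF ei(1)] idempotentD[OF ej(1)]
  show "e i \<in> carrier T" "e i \<otimes>\<^bsub>T\<^esub> e i = e i" "e j \<in> carrier T" "e j \<otimes>\<^bsub>T\<^esub> e j = e j" by (fact e)+
  show "ideal_prod T N N = {z \<in> N. \<forall>v\<in>{..<s}. cf v (Suc 0) (fst z) = 0}"
  proof (intro equalityI subsetI CollectI conjI ballI)
    fix z v assume "z \<in> ideal_prod T N N" "v \<in> {..<s}"
    then show "cf v (Suc 0) (fst z) = 0" using cf_1_ideal_prod[of z] by auto
  next
    fix z assume z: "z \<in> {z \<in> N. \<forall>v\<in>{..<s}. cf v (Suc 0) (fst z) = 0}"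
    \<comment> \<open>The solution of the equation that requires \<open>c * t (v + n)\<close> to be
      the value of \<open>tw z\<close> at the longest path from \<open>v\<close>;
      \<open>s - n mod s\<close> represents \<open>-n\<close> modulo \<open>s\<close>.\<close>
    define t where "t w = tw z (bas ((w + (s - n mod s)) mod s) (n - Suc 0)) / c" for w
    show "z \<in> ideal_prod T N N"
    proof (rule in_ideal_prod[where t = t])
      fix b v assume b: "b \<in> carrier A" "\<And>w. w < s \<Longrightarrow> cf w 0 b = 0"
        "\<And>w. w < s \<Longrightarrow> cf w (n - Suc 0) b = t w" and v: "v < s"
      have "n mod s < s" "s * (n div s) + n mod s = n" by simp_all
      then have "n + (s - n mod s) = s + s * (n div s)" by linarith
      then have "v + n + (s - n mod s) = v + s * Suc (n div s)" by simp
      then have "((v + n) mod s + (s - n mod s)) mod s = (v + s * Suc (n div s)) mod s"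
        by (simp only: mod_add_left_eq)
      also have "\<dots> = v" using v mod_mult_self2[of v s "Suc (n div s)"] by simp
      finally show "\<theta> arrow_sum b (bas v (n - Suc 0)) = tw z (bas v (n - Suc 0))"
        using top[OF b(1,2) v] b(3)[of "(v + n) mod s"] c by (simp add: t_def)
    qed (use z n_ge_2 in auto)
  qed (rule ideal_prod_subset_N)
  fix v w assume "v \<in> {..<s}" "w \<in> {..<s}"
  then show "cf w (Suc 0) (fst (mk (bas v (Suc 0)) \<zero>\<^bsub>dual A\<^esub>)) = (if w = v then 1 else 0)"
    using one_less_n by auto
next
  fix v z assume "v \<in> {..<s}" "z \<in> N"
  then show "cf v (Suc 0) (fst (e i \<otimes>\<^bsub>T\<^esub> z \<otimes>\<^bsub>T\<^esub> e j))
    = (if v = i \<and> Suc v mod s = j then cf v (Suc 0) (fst z) else 0)"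
    using cf_1_corner[of "e i" i "e j" j z v]
      idempotentD[OF ei(1)] idempotentD[OF ej(1)] ei ej by auto
qed (use one_less_n in \<open>auto simp: N_def fst_add fst_smult cf_add cf_smult\<close>)

end

section \<open>The cyclic quiver\<close>

text \<open>The arrows of the path of length \<open>l\<close> starting at \<open>v\<close>; each
  arrow bears the number of its source.\<close>

definition cyc :: "nat \<Rightarrow> nat \<Rightarrow> nat \<Rightarrow> nat list" where
  "cyc s v l = map (\<lambda>k. (v + k) mod s) [0..<l]"

lemma length_cyc [simp]: "length (cyc s v l) = l"
  by (simp add: cyc_def)

lemma nth_cyc [simp]: "k < l \<Longrightarrow> cyc s v l ! k = (v + k) mod s"
  by (simp add: cyc_def)

lemma cyc_0 [simp]: "cyc s v 0 = []"
  by (simp add: cyc_def)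

lemma cyc_eq_Nil_iff [simp]: "cyc s v l = [] \<longleftrightarrow> l = 0"
  by (simp add: cyc_def)

lemma cyc_Suc: "v < s \<Longrightarrow> cyc s v (Suc l) = v # cyc s (Suc v mod s) l"
  by (rule nth_equalityI) (auto simp: nth_Cons mod_simps split: nat.split)

lemma take_cyc: "k \<le> l \<Longrightarrow> take k (cyc s v l) = cyc s v k"
  by (rule nth_equalityI) auto

lemma drop_cyc: "drop k (cyc s v l) = cyc s ((v + k) mod s) (l - k)"
  by (rule nth_equalityI) (auto simp: mod_simps add.assoc)

lemma cyc_append: "cyc s v k @ cyc s ((v + k) mod s) l = cyc s v (k + l)"
  using append_take_drop_id[of k "cyc s v (k + l)"] by (simp add: take_cyc drop_cyc)

lemma last_cyc: "0 < l \<Longrightarrow> last (cyc s v l) = (v + (l - 1)) mod s"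
  by (simp add: last_conv_nth)

lemma hd_cyc: "0 < l \<Longrightarrow> v < s \<Longrightarrow> hd (cyc s v l) = v"
  by (simp add: hd_conv_nth)

lemma cyc_eq_cyc_iff:
  "v < s \<Longrightarrow> w < s \<Longrightarrow> 0 < l \<Longrightarrow> cyc s v l = cyc s w k \<longleftrightarrow> v = w \<and> l = k"
  by (metis hd_cyc length_cyc)

lemma cyclic_quiver_simps [simp]:
  "verts (cyclic_quiver s) = {..<s}" "arcs (cyclic_quiver s) = {..<s}"
  "tail (cyclic_quiver s) i = i" "head (cyclic_quiver s) i = Suc i mod s"
  by (simp_all add: cyclic_quiver_def)

lemma fin_digraph_cyclic_quiver: "0 < s \<Longrightarrow> fin_digraph (cyclic_quiver s)"
  by unfold_locales auto

lemma path_target_cyc: "v < s \<Longrightarrow> path_target (cyclic_quiver s) (v, cyc s v l) = (v + l) mod s"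
  by (cases l) (auto simp: path_target_conv last_cyc mod_simps)

text \<open>Exactly one arrow leaves each vertex, so a walk is determined by its source and its
  length.\<close>

lemma awalk_cyclic_quiver:
  "0 < s \<Longrightarrow> (\<exists>w. pre_digraph.awalk (cyclic_quiver s) v xs w) \<longleftrightarrow> v < s \<and> xs = cyc s v (length xs)"
proof (induction xs arbitrary: v)
  case Nil
  then show ?case by (simp add: pre_digraph.awalk_def pre_digraph.cas.simps)
next
  case (Cons x xs)
  interpret fin_digraph "cyclic_quiver s" by (rule fin_digraph_cyclic_quiver) (rule Cons.prems)
  have "(\<exists>w. awalk v (x # xs) w) \<longleftrightarrow> x < s \<and> v = x \<and> xs = cyc s (Suc x mod s) (length xs)"
    using Cons.IH[OF Cons.prems, of "Suc x mod s"] Cons.prems by (simp add: awalk_Cons_iff) 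
  also have "\<dots> \<longleftrightarrow> v < s \<and> x # xs = cyc s v (Suc (length xs))"
    by (auto simp: cyc_Suc)
  finally show ?case by simp
qed

lemma paths_cyclic_quiver:
  "0 < s \<Longrightarrow> (v, xs) \<in> paths (cyclic_quiver s) \<longleftrightarrow> v < s \<and> xs = cyc s v (length xs)"
  by (simp add: paths_def awalk_cyclic_quiver)

lemma short_paths_cyclic_quiver:
  assumes "0 < s"
  shows "{p \<in> paths (cyclic_quiver s). path_length p < n} = (\<lambda>(v, l). (v, cyc s v l)) ` ({..<s} \<times> {..<n})"
proof (intro equalityI subsetI)
  fix p assume p: "p \<in> {p \<in> paths (cyclic_quiver s). path_length p < n}"
  obtain v xs where "p = (v, xs)" by (cases p)
  then show "p \<in> (\<lambda>(v, l). (v, cyc s v l)) ` ({..<s} \<times> {..<n})"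
    using p assms by (intro image_eqI[of _ _ "(v, length xs)"]) (auto simp: paths_cyclic_quiver)
qed (use assms in \<open>auto simp: paths_cyclic_quiver\<close>)

lemma sum_eq_single:
  assumes "finite S" "a \<in> S" "\<And>x. x \<in> S \<Longrightarrow> x \<noteq> a \<Longrightarrow> f x = 0"
  shows "sum f S = f a"
  using sum.mono_neutral_right[of S "{a}" f] assms by auto

lemma truncated_class_eqI:
  assumes "0 < s" "X \<in> carrier (truncated_algebra (cyclic_quiver s) n)"
    "Y \<in> carrier (truncated_algebra (cyclic_quiver s) n)"
    and eq: "\<And>v l. v < s \<Longrightarrow> l < n \<Longrightarrow>
      dual_path (cyclic_quiver s) n (v, cyc s v l) X = (dual_path (cyclic_quiver s) n (v, cyc s v l) Y :: 'k :: field)"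
  shows "X = Y"
proof -
  interpret fin_digraph "cyclic_quiver s" by (rule fin_digraph_cyclic_quiver) fact
  obtain f g where fg: "X = truncated_class n f" "Y = truncated_class n g"
    "f \<in> carrier (path_algebra (cyclic_quiver s))" "g \<in> carrier (path_algebra (cyclic_quiver s))"
    using assms(2,3) by (auto simp: carrier_truncated_algebra)
  have "f (v, xs) = g (v, xs)" if "length xs < n" for v xs
  proof (cases "(v, xs) \<in> paths (cyclic_quiver s)")
    case True
    then have "v < s" "xs = cyc s v (length xs)" using assms(1) by (simp_all add: paths_cyclic_quiver)
    then show ?thesis using eq[of v "length xs"] that fg by (simp add: dual_path_truncated_class)
  next
    case False
    then have "f (v, xs) = 0" "g (v, xs) = 0"
      using fg(3,4) unfolding path_algebra_carrier by blast+
    then show ?thesis by simp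
  qed
  then show ?thesis unfolding fg(1,2) by (subst truncated_class_eq_iff) (auto simp: fg)
qed

theorem cyclic_truncated_truncated_algebra:
  assumes s: "0 < s" and n: "2 \<le> n"
  shows "cyclic_truncated (truncated_algebra (cyclic_quiver s) n :: ('k :: field, (nat, nat, 'k) path_class) module)
    s n (\<lambda>v l. dual_path (cyclic_quiver s) n (v, cyc s v l))"
proof -
  interpret fin_digraph "cyclic_quiver s" by (rule fin_digraph_cyclic_quiver) fact
  let ?Q = "cyclic_quiver s"
  let ?A = "truncated_algebra ?Q n :: ('k, (nat, nat, 'k) path_class) module"
  interpret assoc_algebra ?A by (rule assoc_algebra_truncated_algebra)
  show ?thesis
  proof
    fix X Y :: "(nat, nat, 'k) path_class" and v l and c :: 'k
    assume XY: "X \<in> carrier ?A" "Y \<in> carrier ?A" and vl: "v < s" "l < n"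
    then obtain f g where fg: "X = truncated_class n f" "Y = truncated_class n g"
      "f \<in> carrier (path_algebra ?Q)" "g \<in> carrier (path_algebra ?Q)"
      by (auto simp: carrier_truncated_algebra)
    show "dual_path ?Q n (v, cyc s v l) (X \<oplus>\<^bsub>?A\<^esub> Y)
      = dual_path ?Q n (v, cyc s v l) X + dual_path ?Q n (v, cyc s v l) Y"
      using fg vl by (simp add: truncated_class_add dual_path_truncated_class path_algebra_add_closed)
    show "dual_path ?Q n (v, cyc s v l) (X \<otimes>\<^bsub>?A\<^esub> Y)
      = (\<Sum>k\<le>l. dual_path ?Q n (v, cyc s v k) X
          * dual_path ?Q n ((v + k) mod s, cyc s ((v + k) mod s) (l - k)) Y)"
      using fg vl
      by (auto simp: truncated_class_mult dual_path_truncated_class path_algebra_mult_closed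
          path_algebra_mult take_cyc drop_cyc path_target_cyc intro!: sum.cong)
  next
    fix X :: "(nat, nat, 'k) path_class" and v l and c :: 'k
    assume X: "X \<in> carrier ?A" and vl: "v < s" "l < n"
    then obtain f where f: "X = truncated_class n f" "f \<in> carrier (path_algebra ?Q)"
      by (auto simp: carrier_truncated_algebra)
    show "dual_path ?Q n (v, cyc s v l) (c \<odot>\<^bsub>?A\<^esub> X) = c * dual_path ?Q n (v, cyc s v l) X"
      using f vl by (simp add: truncated_class_smult dual_path_truncated_class path_algebra_smult_closed)
  next
    fix v l assume vl: "v < s" "l < n"
    show "dual_path ?Q n (v, cyc s v l) \<one>\<^bsub>?A\<^esub> = (if l = 0 then 1 else (0 :: 'k))"
      using vl by (simp add: one_truncated_algebra dual_path_truncated_class path_algebra_one_closed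
          path_algebra_one)
  next
    fix g :: "nat \<Rightarrow> nat \<Rightarrow> 'k"
    let ?S = "{p \<in> paths ?Q. path_length p < n}"
    define f where "f p = (if p \<in> ?S then g (fst p) (path_length p) else 0)" for p
    have "finite ?S" using short_paths_cyclic_quiver[OF s, of n] by simp
    then have "finite {p. f p \<noteq> 0}" by (rule finite_subset[rotated]) (auto simp: f_def)
    moreover have "{p. f p \<noteq> 0} \<subseteq> paths ?Q" by (auto simp: f_def split: if_splits)
    ultimately have f: "f \<in> carrier (path_algebra ?Q)" by (simp add: path_algebra_carrier)
    then have "dual_path ?Q n (v, cyc s v l) (truncated_class n f) = g v l" if "v < s" "l < n" for v l
      using that s by (simp add: dual_path_truncated_class f_def paths_cyclic_quiver)
    then show "\<exists>X\<in>carrier ?A. \<forall>v<s. \<forall>l<n. dual_path ?Q n (v, cyc s v l) X = g v l"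
      using f unfolding carrier_truncated_algebra by blast
  next
    fix X Y :: "(nat, nat, 'k) path_class"
    assume "X \<in> carrier ?A" "Y \<in> carrier ?A"
      "\<And>v l. v < s \<Longrightarrow> l < n \<Longrightarrow> dual_path ?Q n (v, cyc s v l) X = dual_path ?Q n (v, cyc s v l) Y"
    then show "X = Y" by (rule truncated_class_eqI[OF s])
  qed (use s n in auto)
qed

text \<open>The parameter \<open>ground_field\<close> carries no data: it fixes the type of the
  field, which \<open>s\<close> and \<open>n\<close> do not determine.\<close>

locale cyclic_quiver_algebra =
  fixes s n :: nat and ground_field :: "'k :: field itself"
  assumes s_pos: "0 < s" and n_ge_2: "2 \<le> n"
begin

abbreviation Q :: "(nat, nat) pre_digraph" where
  "Q \<equiv> cyclic_quiver s"

abbreviation A :: "('k, (nat, nat, 'k) path_class) module" where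
  "A \<equiv> truncated_algebra Q n"

abbreviation coord :: "nat \<Rightarrow> nat \<Rightarrow> (nat, nat, 'k) path_class \<Rightarrow> 'k" where
  "coord v l \<equiv> dual_path Q n (v, cyc s v l)"

sublocale Q: fin_digraph Q
  by (rule fin_digraph_cyclic_quiver) (rule s_pos)

sublocale A: cyclic_truncated A s n coord
  by (rule cyclic_truncated_truncated_algebra) (fact s_pos n_ge_2)+

lemma path_class_cyc: "v < s \<Longrightarrow> l < n \<Longrightarrow> path_class Q n (v, cyc s v l) = A.bas v l"
proof -
  assume vl: "v < s" "l < n"
  then have p: "(v, cyc s v l) \<in> paths Q" by (simp add: paths_cyclic_quiver s_pos)
  have pe: "(path_elem (v, cyc s v l) :: _ \<Rightarrow> 'k) \<in> carrier (path_algebra Q)"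
    by (rule Q.path_elem_closed[OF p])
  show ?thesis unfolding Q.path_class_eq[OF p]
  proof (rule A.cf_eqI)
    fix w k assume wk: "w < s" "k < n"
    show "coord w k (Q.truncated_class n (path_elem (v, cyc s v l))) = coord w k (A.bas v l)"
      unfolding A.cf_bas[OF wk] using wk vl pe
      by (subst Q.dual_path_truncated_class) (auto simp: path_elem_def dest: arg_cong[of _ _ length])
  next
    show "Q.truncated_class n (path_elem (v, cyc s v l)) \<in> carrier A"
      using pe by (simp add: Q.carrier_truncated_algebra)
  qed simp
qed

section \<open>Values of Theta at the longest paths\<close>

lemma dual_path_bas:
  assumes "v < s" "l < n" "path_length p < n"
  shows "dual_path Q n p (A.bas v l) = (if p = (v, cyc s v l) then 1 else 0 :: 'k)"
proof -
  have p: "(v, cyc s v l) \<in> paths Q" using assms by (simp add: paths_cyclic_quiver s_pos)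
  have pe: "(path_elem (v, cyc s v l) :: _ \<Rightarrow> 'k) \<in> carrier (path_algebra Q)"
    by (rule Q.path_elem_closed[OF p])
  show ?thesis
    unfolding path_class_cyc[OF assms(1,2), symmetric] Q.path_class_eq[OF p]
      Q.dual_path_truncated_class[OF pe assms(3)]
    by (simp add: path_elem_def)
qed

lemma Theta_top_zero:
  fixes \<phi> :: "(nat, nat) path \<times> (nat, nat) path \<Rightarrow> 'k"
  assumes "q \<le> 2 * n - 2" "v < s"
  shows "Theta Q n q \<phi> X Y (A.bas v (n - Suc 0)) = 0"
proof -
  have "Theta_paths Q n u p p' (A.bas v (n - Suc 0)) = (0 :: 'k)" if u: "u \<in> tensor_basis Q n n q" for u p p'
  proof -
    obtain a as b bs where u': "u = ((a, as), (b, bs))" by (metis surj_pair)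
    have "length as + length bs = q" "length bs = n" using u by (auto simp: u' tensor_basis_def)
    then have len: "length (drop m (bs @ as)) < n - Suc 0" if "n \<le> m" for m
      using that assms n_ge_2 by auto
    have "dual_path Q n (h, drop m (bs @ as)) (A.bas v (n - Suc 0)) = (0 :: 'k)" if "n \<le> m" for h m
    proof -
      have "drop m (bs @ as) \<noteq> cyc s v (n - Suc 0)"
        using len[OF that] by (metis length_cyc less_irrefl)
      then show ?thesis
        using len[OF that] assms by (subst dual_path_bas) (simp_all del: drop_append)
    qed
    then show ?thesis
      unfolding Theta_paths_def u' Let_def prod.case fst_conv snd_conv
      by (split if_split) (use A.zero_dual_apply[OF A.bas_closed] in blast)
  qed
  then show ?thesis by (simp add: Theta_def)
qed

text \<open>In this degree the factors have lengths \<open>n - 1\<close> and \<open>n\<close> and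
  form a closed walk of length \<open>2n - 1\<close>, which exists only if \<open>s\<close> divides
  that length. The walk is then determined by the source \<open>b\<close> of the second
  factor.\<close>

lemma tensor_basis_top:
  "u \<in> tensor_basis Q n n (2 * n - Suc 0) \<longleftrightarrow>
    (\<exists>b<s. s dvd 2 * n - Suc 0 \<and> u = (((b + n) mod s, cyc s ((b + n) mod s) (n - Suc 0)), (b, cyc s b n)))"
proof
  assume u: "u \<in> tensor_basis Q n n (2 * n - Suc 0)"
  obtain a as b bs where u': "u = ((a, as), (b, bs))" by (metis surj_pair)
  have len: "length bs = n" "length as = n - 1" using u n_ge_2 by (auto simp: u' tensor_basis_def)
  then have ab: "a < s" "b < s" "as = cyc s a (n - Suc 0)" "bs = cyc s b n"
    using u by (auto simp: u' tensor_basis_def paths_cyclic_quiver s_pos)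
  have eqs: "(a + (n - Suc 0)) mod s = b" "(b + n) mod s = a"
    using u ab by (auto simp: u' tensor_basis_def path_target_cyc)
  then have "(b + (n + (n - Suc 0))) mod s = b"
    by (metis add.assoc mod_add_left_eq)
  then have "(b + (n + (n - Suc 0))) mod s = b mod s" using ab(2) by simp
  then have "s dvd n + (n - Suc 0)" by (subst (asm) mod_eq_dvd_iff_nat) auto
  moreover have "n + (n - Suc 0) = 2 * n - Suc 0" using n_ge_2 by simp
  ultimately show "\<exists>b<s. s dvd 2 * n - Suc 0 \<and> u = (((b + n) mod s, cyc s ((b + n) mod s) (n - Suc 0)), (b, cyc s b n))"
    using ab eqs by (auto simp: u')
next
  assume "\<exists>b<s. s dvd 2 * n - Suc 0 \<and> u = (((b + n) mod s, cyc s ((b + n) mod s) (n - Suc 0)), (b, cyc s b n))"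
  then obtain b where b: "b < s" "s dvd 2 * n - Suc 0"
    "u = (((b + n) mod s, cyc s ((b + n) mod s) (n - Suc 0)), (b, cyc s b n))" by blast
  have "((b + n) mod s + (n - Suc 0)) mod s = (b + n + (n - Suc 0)) mod s"
    by (rule mod_add_left_eq)
  also have "b + n + (n - Suc 0) = b + (2 * n - Suc 0)" using n_ge_2 by simp
  also have "(b + (2 * n - Suc 0)) mod s = b" using b by auto
  finally show "u \<in> tensor_basis Q n n (2 * n - Suc 0)"
    using b n_ge_2 s_pos by (auto simp: tensor_basis_def paths_cyclic_quiver path_target_cyc)
qed

lemma Theta_paths_eq:
  "Theta_paths Q n ((a, as), (b, bs)) (w, ps) (w', ps') =
    (if ps \<noteq> [] \<and> ps' \<noteq> [] \<and> n \<le> length (ps @ ps') \<and> length (ps @ ps') \<le> length (bs @ as) \<and>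
        ps @ ps' = take (length (ps @ ps')) (bs @ as)
     then dual_path Q n (head Q (last (ps @ ps')), drop (length (ps @ ps')) (bs @ as))
     else \<zero>\<^bsub>dual A\<^esub>)"
  unfolding Theta_paths_def Let_def prod.case fst_conv snd_conv ..

lemma Theta_paths_eq_dual_path:
  assumes eq: "ps @ ps' = bs" and "length bs = n" "ps \<noteq> []" "ps' \<noteq> []"
  shows "Theta_paths Q n ((a, as), (b, bs)) (w, ps) (w', ps') = (dual_path Q n (head Q (last bs), as) :: _ \<Rightarrow> 'k)"
  unfolding Theta_paths_eq eq using assms(2-) by simp

abbreviation top_basis :: "nat \<Rightarrow> (nat, nat) path \<times> (nat, nat) path" where
  "top_basis b \<equiv> (((b + n) mod s, cyc s ((b + n) mod s) (n - Suc 0)), (b, cyc s b n))"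

lemma finite_tensor_basis_top: "finite (tensor_basis Q n n (2 * n - Suc 0))"
  by (rule finite_subset[of _ "top_basis ` {..<s}"]) (auto simp: tensor_basis_top)

lemma finite_short_paths: "finite {p \<in> paths Q. path_length p < n}"
  using short_paths_cyclic_quiver[OF s_pos, of n] by simp

text \<open>One term of the triple sum survives. \<open>arrow_sum\<close> admits only single arrows
  \<open>p\<close>, so \<open>p'\<close> needs length \<open>n - 1\<close> to reach \<open>n\<close>
  arrows in total, and these fill the second tensor factor. The first tensor factor is left over and
  must start at \<open>v\<close>. So the second one starts at \<open>v - n\<close>, which is
  \<open>v + n - 1\<close> modulo \<open>s\<close>, and \<open>p'\<close> starts one step later, at
  \<open>v + n\<close>.\<close>

lemma Theta_top:
  fixes \<phi> :: "(nat, nat) path \<times> (nat, nat) path \<Rightarrow> 'k"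
  assumes dvd: "s dvd 2 * n - Suc 0" and v: "v < s"
  shows "Theta Q n (2 * n - Suc 0) \<phi> A.arrow_sum Y (A.bas v (n - Suc 0))
    = \<phi> (top_basis ((v + (n - Suc 0)) mod s)) * coord ((v + n) mod s) (n - Suc 0) Y"
proof -
  define b where "b = (v + (n - Suc 0)) mod s"
  have b: "b < s" by (simp add: b_def)
  have succ_b: "Suc b mod s = (v + n) mod s"
    using n_ge_2 by (simp add: b_def mod_Suc_eq)
  \<comment> \<open>Adding \<open>n\<close> is undone by adding \<open>n - 1\<close>, since
    \<open>s\<close> divides \<open>2n - 1\<close>.\<close>
  have add_n: "(x + n) mod s = v \<Longrightarrow> x = b" if "x < s" for x
  proof -
    assume "(x + n) mod s = v"
    then have "b = (x + n + (n - Suc 0)) mod s" by (simp only: b_def mod_add_left_eq flip: \<open>(x + n) mod s = v\<close>)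
    also have "x + n + (n - Suc 0) = x + (2 * n - Suc 0)" using n_ge_2 by simp
    also have "(x + (2 * n - Suc 0)) mod s = x" using dvd that by auto
    finally show "x = b" by simp
  qed
  have b_n: "(b + n) mod s = v"
  proof -
    have "(b + n) mod s = (v + (n - Suc 0) + n) mod s" unfolding b_def by (rule mod_add_left_eq)
    also have "v + (n - Suc 0) + n = v + (2 * n - Suc 0)" using n_ge_2 by simp
    also have "(v + (2 * n - Suc 0)) mod s = v" using dvd v by auto
    finally show ?thesis .
  qed
  let ?S = "{p \<in> paths Q. path_length p < n}"
  let ?p = "(b, cyc s b (Suc 0))" and ?p' = "(Suc b mod s, cyc s (Suc b mod s) (n - Suc 0))"
  let ?Z = "A.bas v (n - Suc 0)"
  let ?F = "\<lambda>u p p'. \<phi> u * dual_path Q n p A.arrow_sum * dual_path Q n p' Y * Theta_paths Q n u p p' ?Z"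
  have zero: "?F u p p' = 0"
    if u: "u \<in> tensor_basis Q n n (2 * n - Suc 0)" and p: "p \<in> ?S" and p': "p' \<in> ?S"
      and ne: "\<not> (u = top_basis b \<and> p = ?p \<and> p' = ?p')" for u p p'
  proof (rule ccontr)
    assume F: "?F u p p' \<noteq> 0"
    obtain c where c: "c < s" "u = top_basis c" using u by (auto simp: tensor_basis_top)
    obtain w l where w: "p = (w, cyc s w l)" "w < s" "l < n"
      using p unfolding short_paths_cyclic_quiver[OF s_pos] by auto
    obtain w' l' where w': "p' = (w', cyc s w' l')" "w' < s" "l' < n"
      using p' unfolding short_paths_cyclic_quiver[OF s_pos] by auto
    have l: "l = Suc 0" using F w by (auto split: if_splits)
    let ?as = "cyc s c n @ cyc s ((c + n) mod s) (n - Suc 0)"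
    let ?bs = "cyc s w l @ cyc s w' l'" and ?m = "length (cyc s w l @ cyc s w' l')"
    have Th: "Theta_paths Q n u p p' ?Z \<noteq> 0" using F by auto
    then have cond: "l' \<noteq> 0" "n \<le> ?m" "?bs = take ?m ?as"
      unfolding c w w' Theta_paths_eq
      by (auto simp: A.zero_dual_apply simp del: length_append split: if_splits)
    \<comment> \<open>The total length \<open>1 + l'\<close> is at least \<open>n\<close>, while
      \<open>l' < n\<close>.\<close>
    then have l': "l' = n - Suc 0" using w' l by simp
    then have m: "?m = n" using l n_ge_2 by simp
    have "?bs = cyc s c n" using cond(3) unfolding m by simp
    moreover have "cyc s c n = c # cyc s (Suc c mod s) (n - Suc 0)"
      using cyc_Suc[OF c(1), of "n - Suc 0"] n_ge_2 by simp
    moreover have "?bs = w # cyc s w' (n - Suc 0)"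
      using cyc_Suc[OF w(2), of 0] l l' by simp
    ultimately have wc: "w = c" "cyc s w' (n - Suc 0) = cyc s (Suc c mod s) (n - Suc 0)" "?bs = cyc s c n"
      by simp_all
    have w'c: "w' = Suc c mod s" using wc(2) w'(2) n_ge_2 by (simp add: cyc_eq_cyc_iff)
    have "head Q (last (cyc s c n)) = (c + n) mod s"
      using path_target_cyc[OF c(1), of n] n_ge_2 by (simp add: path_target_conv)
    then have "Theta_paths Q n u p p' ?Z
        = dual_path Q n ((c + n) mod s, cyc s ((c + n) mod s) (n - Suc 0)) ?Z"
      unfolding c w w' using Theta_paths_eq_dual_path[OF wc(3)] l cond(1) by simp
    then have "(c + n) mod s = v" using Th v n_ge_2 by (auto simp: dual_path_bas split: if_splits)
    then have "c = b" using add_n c(1) by blast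
    then show False using ne c w w' l l' wc(1) w'c by simp
  qed
  have mem: "top_basis b \<in> tensor_basis Q n n (2 * n - Suc 0)" "?p \<in> ?S" "?p' \<in> ?S"
    using b dvd n_ge_2 s_pos by (auto simp: tensor_basis_top paths_cyclic_quiver)
  have "Theta Q n (2 * n - Suc 0) \<phi> A.arrow_sum Y ?Z
    = (\<Sum>u\<in>tensor_basis Q n n (2 * n - Suc 0). \<Sum>p\<in>?S. \<Sum>p'\<in>?S. ?F u p p')"
    by (simp add: Theta_def)
  also have "\<dots> = (\<Sum>p\<in>?S. \<Sum>p'\<in>?S. ?F (top_basis b) p p')"
    by (rule sum_eq_single[OF finite_tensor_basis_top mem(1)]) (intro sum.neutral ballI zero, auto)
  also have "\<dots> = (\<Sum>p'\<in>?S. ?F (top_basis b) ?p p')"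
    by (rule sum_eq_single[OF finite_short_paths mem(2)]) (intro sum.neutral ballI zero mem, auto)
  also have "\<dots> = ?F (top_basis b) ?p ?p'"
    by (rule sum_eq_single[OF finite_short_paths mem(3)]) (intro zero mem, auto)
  also have "\<dots> = \<phi> (top_basis b) * coord ((v + n) mod s) (n - Suc 0) Y"
  proof -
    have bs: "cyc s b (Suc 0) @ cyc s (Suc b mod s) (n - Suc 0) = cyc s b n"
      using cyc_append[of s b "Suc 0" "n - Suc 0"] n_ge_2 by simp
    have "head Q (last (cyc s b n)) = v"
      using path_target_cyc[OF b, of n] n_ge_2 b_n by (simp add: path_target_conv)
    then have "Theta_paths Q n (top_basis b) ?p ?p' ?Z = dual_path Q n (v, cyc s v (n - Suc 0)) ?Z"
      unfolding b_n using Theta_paths_eq_dual_path[OF bs] n_ge_2 by simp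
    also have "\<dots> = 1" using v n_ge_2 by simp
    finally show ?thesis using b n_ge_2 succ_b by simp
  qed
  finally show ?thesis by (simp add: b_def)
qed

section \<open>The kernel condition in degree 2n - 1\<close>

lemma D_d3_top:
  fixes \<phi> :: "(nat, nat) path \<times> (nat, nat) path \<Rightarrow> 'k"
  assumes dvd: "s dvd 2 * n - Suc 0" and D: "D_d3 Q n (2 * n - Suc 0) \<phi> = (\<lambda>w. 0)" and j: "j < s"
  shows "\<phi> (top_basis (Suc j mod s)) = \<phi> (top_basis j)"
proof -
  define i where "i = (Suc j + n) mod s"
  have i: "i < s" by (simp add: i_def)
  have i_Suc: "i = Suc ((j + n) mod s) mod s" by (simp add: i_def mod_Suc_eq)
  have i_add: "i = (Suc j mod s + n) mod s" by (simp add: i_def mod_add_left_eq)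
  have i_j: "(i + (n - 2)) mod s = j"
  proof -
    have "(i + (n - 2)) mod s = (Suc j + n + (n - 2)) mod s" unfolding i_def by (rule mod_add_left_eq)
    also have "Suc j + n + (n - 2) = j + (2 * n - Suc 0)" using n_ge_2 by simp
    also have "(j + (2 * n - Suc 0)) mod s = j" using dvd j by auto
    finally show ?thesis .
  qed
  \<comment> \<open>On this element the differential is a difference of two basis elements. Moving
    the first of the \<open>n + 1\<close> arrows of the second factor to the first factor leaves a
    second factor that starts at \<open>j + 1\<close>; moving the last arrow leaves one that starts
    at \<open>j\<close>. For \<open>n = 2\<close> the first factor is a trivial path.\<close>
  let ?w = "((i, cyc s i (n - 2)), (j, cyc s j (n + 1)))"
  have w: "?w \<in> tensor_basis Q n (n + 1) (2 * n - Suc 0)"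
    using i j i_j n_ge_2 s_pos
    by (auto simp: tensor_basis_def paths_cyclic_quiver path_target_cyc i_def add.commute)
  have x1: "cyc s i (n - 2) @ [j] = cyc s i (n - Suc 0)"
    using cyc_append[of s i "n - 2" 1] i_j j n_ge_2 cyc_Suc[OF j, of 0]
    by (simp add: hd_cyc numeral_2_eq_2 Suc_diff_Suc)
  have x2: "tl (cyc s j (n + 1)) = cyc s (Suc j mod s) n" using cyc_Suc[OF j, of n] by simp
  have x3: "last (cyc s j (n + 1)) = (j + n) mod s" by (simp add: last_cyc)
  have x4: "(j + n) mod s # cyc s i (n - 2) = cyc s ((j + n) mod s) (n - Suc 0)"
    using cyc_Suc[of "(j + n) mod s" s "n - 2"] i_Suc n_ge_2 s_pos
    by (simp add: numeral_2_eq_2 Suc_diff_Suc)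
  have x5: "butlast (cyc s j (n + 1)) = cyc s j n"
    by (simp add: butlast_conv_take take_cyc)
  have hd: "hd (cyc s j (n + 1)) = j" using j by (simp add: hd_cyc)
  define t1 where "t1 = top_basis (Suc j mod s)"
  define t2 where "t2 = top_basis j"
  have d3: "d3_basis Q n ?w z = (if z = t1 then 1 else 0) - (if z = t2 then 1 else (0 :: 'k))" for z
  proof -
    have "d3_basis Q n ?w z = tensor_elem n (fst t1) (snd t1) z - (tensor_elem n (fst t2) (snd t2) z :: 'k)"
      unfolding d3_basis_def prod.case x2 x3 x5 hd x1 cyclic_quiver_simps x4 t1_def t2_def fst_conv snd_conv
        i_add[symmetric] ..
    moreover have "path_length (fst t1) < n" "path_length (fst t2) < n"
      using n_ge_2 by (simp_all add: t1_def t2_def)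
    ultimately show ?thesis by (simp add: tensor_elem_def)
  qed
  have mem: "t1 \<in> tensor_basis Q n n (2 * n - Suc 0)" "t2 \<in> tensor_basis Q n n (2 * n - Suc 0)"
    using j dvd s_pos unfolding tensor_basis_top t1_def t2_def by auto
  have "0 = D_d3 Q n (2 * n - Suc 0) \<phi> ?w" using D by simp
  also have "\<dots> = (\<Sum>z\<in>tensor_basis Q n n (2 * n - Suc 0). d3_basis Q n ?w z * \<phi> z)"
    unfolding D_d3_def using w by simp
  also have "\<dots> = (\<Sum>z\<in>tensor_basis Q n n (2 * n - Suc 0).
      (if z = t1 then \<phi> z else 0) - (if z = t2 then \<phi> z else 0))"
    unfolding d3 by (rule sum.cong[OF refl]) (simp add: left_diff_distrib)
  also have "\<dots> = \<phi> t1 - \<phi> t2"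
    unfolding sum_subtractf using finite_tensor_basis_top mem by (simp add: sum.delta')
  finally have "\<phi> t1 = \<phi> t2" by simp
  then show ?thesis by (simp only: t1_def t2_def)
qed

lemma constant_on_top:
  fixes \<phi> :: "(nat, nat) path \<times> (nat, nat) path \<Rightarrow> 'k"
  assumes "s dvd 2 * n - Suc 0" "D_d3 Q n (2 * n - Suc 0) \<phi> = (\<lambda>w. 0)"
  shows "j < s \<Longrightarrow> \<phi> (top_basis j) = \<phi> (top_basis 0)"
proof (induction j)
  case (Suc j)
  then show ?case using D_d3_top[OF assms, of j] by simp
qed simp

text \<open>A second factor of length one would need a first factor of length \<open>2n - 2\<close>,
  which is at least \<open>n\<close> and hence zero in \<open>A\<close>. So there is nothing to
  divide by, and a member of a coset lies in the kernel itself.\<close>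

lemma dual_HH2_top:
  assumes "(\<phi> :: _ \<Rightarrow> 'k) \<in> \<Union> (dual_HH2 Q n (2 * n - Suc 0))"
  shows "D_d3 Q n (2 * n - Suc 0) \<phi> = (\<lambda>w. 0)"
proof -
  have "tensor_basis Q n 1 (2 * n - Suc 0) = {}"
    using n_ge_2 by (auto simp: tensor_basis_def)
  then have "D_d2 Q n (2 * n - Suc 0) \<psi> = (\<lambda>w. 0 :: 'k)" for \<psi>
    by (auto simp: D_d2_def)
  then show ?thesis using assms by (auto simp: dual_HH2_def)
qed

section \<open>From cohomology classes to arrows\<close>

lemma Theta_eq_zero_cocycle:
  fixes \<phi> :: "(nat, nat) path \<times> (nat, nat) path \<Rightarrow> 'k"
  assumes "\<And>u. u \<in> tensor_basis Q n n q \<Longrightarrow> \<phi> u = 0"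
  shows "Theta Q n q \<phi> = zero_cocycle A"
  by (intro ext) (simp add: Theta_def zero_cocycle_def dual_def assms restrict_def)

lemma zero_hom: "(\<lambda>a. \<zero>\<^bsub>dual A\<^esub>) \<in> module_hom class_ring A (dual A)"
  by (auto simp: module_hom_def A.dual_applies intro!: A.dual_eqI)

lemma coboundary_zero:
  assumes "a \<in> carrier A" "b \<in> carrier A" "d \<in> carrier A"
  shows "coboundary A (\<lambda>a. \<zero>\<^bsub>dual A\<^esub>) a b d = 0"
  using assms by (simp add: A.coboundary_apply[OF zero_hom] A.zero_dual_apply)

lemma self_in_H2_class:
  assumes "two_cocycle A \<alpha>"
  shows "\<alpha> \<in> H2_class A \<alpha>"
proof -
  have "\<alpha> a b = \<alpha> a b \<oplus>\<^bsub>dual A\<^esub> coboundary A (\<lambda>a. \<zero>\<^bsub>dual A\<^esub>) a b"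
    if "a \<in> carrier A" "b \<in> carrier A" for a b
  proof (rule A.dual_eqI)
    have "coboundary A (\<lambda>a. \<zero>\<^bsub>dual A\<^esub>) a b \<in> carrier (dual A)"
      using that by (simp add: coboundary_def)
    then show "\<alpha> a b \<oplus>\<^bsub>dual A\<^esub> coboundary A (\<lambda>a. \<zero>\<^bsub>dual A\<^esub>) a b \<in> carrier (dual A)"
      using that A.two_cocycle_closed[OF assms] by simp
  qed (use that in \<open>simp_all add: A.two_cocycle_closed[OF assms] A.add_dual_apply coboundary_zero\<close>)
  then show ?thesis using assms zero_hom unfolding H2_class_def by blast
qed

text \<open>A cocycle belongs to its own class, so equality of the classes places \<alpha> in the
  class of \<theta>, and membership there provides \<open>f\<close>.\<close>

lemma twisted_extensionI:
  assumes \<alpha>: "two_cocycle A \<alpha>" and eq: "H2_class A \<alpha> = H2_class A \<theta>"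
  shows "\<exists>f. twisted_extension A s n coord \<alpha> \<theta> f"
proof -
  have "\<alpha> \<in> H2_class A \<theta>" using self_in_H2_class[OF \<alpha>] eq by simp
  then obtain f where f: "f \<in> module_hom class_ring A (dual A)"
    "\<And>a b. a \<in> carrier A \<Longrightarrow> b \<in> carrier A \<Longrightarrow> \<alpha> a b = \<theta> a b \<oplus>\<^bsub>dual A\<^esub> coboundary A f a b"
    unfolding H2_class_def by blast
  have "twisted_extension A s n coord \<alpha> \<theta> f"
    by unfold_locales (simp_all add: \<alpha> f A.add_dual_apply)
  then show ?thesis by (rule exI[of _ f])
qed

lemma lifted_idempotentsD:
  assumes "lifted_idempotents Q n \<alpha> e" "i < s"
  shows "idempotent (hochschild_extension A \<alpha>) (e i)" "fst (e i) = A.bas i 0"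
  using assms path_class_cyc[of i 0] n_ge_2
  by (auto simp: lifted_idempotents_def complete_primitive_orthogonal_def primitive_idempotent_def)

text \<open>The count on the right mentions neither the cocycle nor the idempotents. It is used for
  \<alpha> and for the zero cocycle, and equality of the two quivers follows by comparing both with
  it.\<close>

theorem ordinary_arrows_top_zero:
  assumes \<alpha>: "two_cocycle A \<alpha>" and eq: "H2_class A \<alpha> = H2_class A \<theta>"
    and top: "\<And>a b v. a \<in> carrier A \<Longrightarrow> b \<in> carrier A \<Longrightarrow> v < s \<Longrightarrow> \<theta> a b (A.bas v (n - Suc 0)) = 0"
    and e: "lifted_idempotents Q n \<alpha> e" and ij: "i < s" "j < s"
  shows "ordinary_arrows (hochschild_extension A \<alpha>) e i j = card {b \<in> (UNIV :: bool set) \<times> {..<s}.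
    (if fst b then (snd b + (n - Suc 0)) mod s else snd b) = i \<and>
    (if fst b then snd b else Suc (snd b) mod s) = j}"
proof -
  obtain f where "twisted_extension A s n coord \<alpha> \<theta> f" using twisted_extensionI[OF \<alpha> eq] by blast
  then interpret E: twisted_extension A s n coord \<alpha> \<theta> f .
  show ?thesis
    by (rule E.ordinary_arrows_top_zero[OF top]) (simp_all add: lifted_idempotentsD[OF e] ij)
qed

theorem ordinary_arrows_top_degree:
  fixes \<phi> :: "(nat, nat) path \<times> (nat, nat) path \<Rightarrow> 'k"
  assumes \<alpha>: "two_cocycle A \<alpha>" and \<phi>: "\<phi> \<in> \<Union> (dual_HH2 Q n (2 * n - Suc 0))"
    and eq: "H2_class A \<alpha> = H2_class A (Theta Q n (2 * n - Suc 0) \<phi>)"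
    and nonzero: "H2_class A \<alpha> \<noteq> H2_class A (zero_cocycle A)"
    and e: "lifted_idempotents Q n \<alpha> e" and ij: "i < s" "j < s"
  shows "ordinary_arrows (hochschild_extension A \<alpha>) e i j = num_arrows Q i j"
proof -
  obtain f where "twisted_extension A s n coord \<alpha> (Theta Q n (2 * n - Suc 0) \<phi>) f"
    using twisted_extensionI[OF \<alpha> eq] by blast
  then interpret E: twisted_extension A s n coord \<alpha> "Theta Q n (2 * n - Suc 0) \<phi>" f .
  \<comment> \<open>If \<phi> vanished on the basis, in particular if the basis were empty,
    \<open>Theta\<close> would return the zero cocycle and the class of \<alpha> would be
    zero.\<close>
  have "\<exists>u\<in>tensor_basis Q n n (2 * n - Suc 0). \<phi> u \<noteq> 0"
    using nonzero eq Theta_eq_zero_cocycle[of "2 * n - Suc 0" \<phi>] by metis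
  then obtain u where u: "u \<in> tensor_basis Q n n (2 * n - Suc 0)" "\<phi> u \<noteq> 0" by blast
  then obtain b where b: "b < s" "s dvd 2 * n - Suc 0" "\<phi> (top_basis b) \<noteq> 0"
    unfolding tensor_basis_top by blast
  note const = constant_on_top[OF b(2) dual_HH2_top[OF \<phi>]]
  have "ordinary_arrows (hochschild_extension A \<alpha>) e i j = card {v \<in> {..<s}. v = i \<and> Suc v mod s = j}"
  proof (rule E.ordinary_arrows_top_nonzero)
    show "\<phi> (top_basis 0) \<noteq> 0" using b const[OF b(1)] by simp
    fix Y v assume "v < s"
    then show "Theta Q n (2 * n - Suc 0) \<phi> A.arrow_sum Y (A.bas v (n - Suc 0))
      = \<phi> (top_basis 0) * coord ((v + n) mod s) (n - Suc 0) Y"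
      using Theta_top[OF b(2), of v \<phi> Y] const[OF A.mod_s, of "v + (n - Suc 0)"] by simp
  qed (simp_all add: lifted_idempotentsD[OF e] ij)
  then show ?thesis by (simp add: num_arrows_def)
qed

end

text \<open>The zero class lies in the image of \<open>Theta\<close> in every degree, and its
  extension has \<open>s\<close> further arrows, dual to the longest paths. This is why the class is
  taken to be nonzero when \<open>q = 2n - 1\<close>. The families \<open>e\<close> and
  \<open>e0\<close> are arbitrary lifts, unrelated to each other.\<close>

theorem theorem4p3:
  fixes s n q :: nat
    and \<Delta> :: "(nat, nat) pre_digraph"
    and A :: "('k::field, (nat, nat, 'k) path_class) module"
    and \<alpha> :: "(nat, nat, 'k) path_class \<Rightarrow> (nat, nat, 'k) path_class \<Rightarrow>
              (nat, nat, 'k) path_class \<Rightarrow> 'k"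
    and e e0 :: "nat \<Rightarrow> (nat, nat, 'k) path_class \<times> ((nat, nat, 'k) path_class \<Rightarrow> 'k)"
  assumes "s \<ge> 1" and "n \<ge> 2" and "n \<le> q" and "q \<le> 2 * n - 1"
    and "\<Delta> = cyclic_quiver s"
    and "A = truncated_algebra \<Delta> n"
    and "two_cocycle A \<alpha>"
    and "H2_class A \<alpha> \<in> Theta_image \<Delta> n q"
    and "q = 2 * n - 1 \<Longrightarrow> H2_class A \<alpha> \<noteq> H2_class A (zero_cocycle A)"
    and "lifted_idempotents \<Delta> n \<alpha> e"
    and "lifted_idempotents \<Delta> n (zero_cocycle A) e0"
  shows "\<forall>i\<in>verts \<Delta>. \<forall>j\<in>verts \<Delta>.
    ordinary_arrows (hochschild_extension A \<alpha>) e i j =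
      (if q \<le> 2 * n - 2
       then ordinary_arrows (hochschild_extension A (zero_cocycle A)) e0 i j
       else num_arrows \<Delta> i j)"
proof (intro ballI)
  interpret C: cyclic_quiver_algebra s n "TYPE('k)"
    using assms(1,2) by unfold_locales simp_all
  note \<Delta> = assms(5) and A = assms(6)[unfolded assms(5)]
  fix i j assume "i \<in> verts \<Delta>" "j \<in> verts \<Delta>"
  then have ij: "i < s" "j < s" by (simp_all add: \<Delta>)
  obtain \<phi> where \<phi>: "\<phi> \<in> \<Union> (dual_HH2 C.Q n q)" "H2_class A \<alpha> = H2_class A (Theta C.Q n q \<phi>)"
    using assms(8) unfolding Theta_image_def \<Delta> A by blast
  show "ordinary_arrows (hochschild_extension A \<alpha>) e i j =
      (if q \<le> 2 * n - 2
       then ordinary_arrows (hochschild_extension A (zero_cocycle A)) e0 i j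
       else num_arrows \<Delta> i j)"
  proof (cases "q \<le> 2 * n - 2")
    case True
    note e = C.ordinary_arrows_top_zero[OF assms(7)[unfolded A] \<phi>(2)[unfolded A]
        C.Theta_top_zero[OF True] assms(10)[unfolded \<Delta>] ij]
    have "zero_cocycle C.A a b (C.A.bas v (n - Suc 0)) = 0" for a b v
      by (simp add: zero_cocycle_def C.A.zero_dual_apply)
    note e0 = C.ordinary_arrows_top_zero[OF C.A.two_cocycle_zero refl this
        assms(11)[unfolded A \<Delta>] ij]
    have "ordinary_arrows (hochschild_extension A \<alpha>) e i j =
        ordinary_arrows (hochschild_extension A (zero_cocycle A)) e0 i j"
      unfolding A by (rule trans[OF e e0[symmetric]])
    then show ?thesis using True by simp
  next
    case False
    then have q: "q = 2 * n - Suc 0" using assms(2,4) by simp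
    have "ordinary_arrows (hochschild_extension A \<alpha>) e i j = num_arrows \<Delta> i j"
      unfolding A \<Delta>
      using C.ordinary_arrows_top_degree[OF assms(7)[unfolded A] \<phi>[unfolded A q] _ assms(10)[unfolded \<Delta>] ij]
        assms(9) q A by simp
    then show ?thesis using False by simp
  qed
qed

end
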